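(* Let $\mathcal{A}$ be a finite-dimensional weak Hopf algebra over $\mathbb{C}$ such that $\mathcal{A}^*$ is semisimple and spherical, let $k\in\mathcal{A}^*$ be a spherical element of $\mathcal{A}^*$ and $\xi_a\in\mathbb{C}$ with $\psi_a(k)=\xi_a\psi_a(g)$ for all $a$. Define $\Omega\in\mathcal{A}$ by $$f(\Omega)=\sum_{a\in\mathrm{Irr}(\mathcal{A}^* )}\frac{1}{\sum_{x:\,l_x=l_a}d_x^2}\cdot\frac{d_a}{\xi_a}\,\mathrm{Tr}\,\psi_a(f)\qquad(f\in\mathcal{A}^* ).$$ Then $\Omega$ is non-degenerate and cocommutative, $\Omega^2=\Omega$, and there exists a linear map $T:\mathcal{A}\to\mathcal{A}$ such that for all $x\in\mathcal{A}$: $(1\otimes x)\Delta(\Omega)=(T(x)\otimes1)\Delta(\Omega)$ and $\Delta(T(x))=\sum k^{-1}(x_{(2)})T(x_{(3)})\otimes T(x_{(1)})$ (i.e. $\Delta\circ T=(T\otimes k^{-1}\otimes T)\circ\Delta^2_{\mathrm{op}}$). Moreover $$\sum T(\Omega_{(1)})\,k^{-1}(\Omega_{(2)})=S(\Omega)=\Omega .$$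
   Context: Weak Hopf algebra: a finite-dimensional unital algebra $\mathcal{A}$ with coassociative counital coproduct $\Delta$ (Sweedler notation), counit $\epsilon$, $\Delta(xy)=\Delta(x)\Delta(y)$, $\Delta^2(1)=(1\otimes\Delta(1))(\Delta(1)\otimes1)=(\Delta(1)\otimes1)(1\otimes\Delta(1))$, $\epsilon(xyz)=\sum\epsilon(xy_{(1)})\epsilon(y_{(2)}z)=\sum\epsilon(xy_{(2)})\epsilon(y_{(1)}z)$, and antipode $S$ with $\sum S(x_{(1)})x_{(2)}=\sum 1_{(1)}\epsilon(x1_{(2)})$, $\sum x_{(1)}S(x_{(2)})=\sum\epsilon(1_{(1)}x)1_{(2)}$, $\sum S(x_{(1)})x_{(2)}S(x_{(3)})=S(x)$. $\Delta^2_{\mathrm{op}}(x)=\sum x_{(3)}\otimes x_{(2)}\otimes x_{(1)}$. The dual $\mathcal{A}^*$ is a weak Hopf algebra with product $(fg)(x)=\sum f(x_{(1)})g(x_{(2)})$, unit $\epsilon$, coproduct $\Delta(f)(x\otimes y)=f(xy)$, antipode $S(f)=f\circ S$. Non-degenerate: $\{(f\otimes\mathrm{Id})\Delta(x)\}=\{(\mathrm{Id}\otimes f)\Delta(x)\}=\mathcal{A}$. For $a\in\mathrm{Irr}(\mathcal{A}^* )$ fix irreps $\psi_a:\mathcal{A}^*\to\mathrm{End}(W_a)$. $N_{ab}^c$ = multiplicity of $\psi_c$ in $f\mapsto(\psi_a\otimes\psi_b)(\Delta f)$ restricted to the range of $(\psi_a\otimes\psi_b)(\Delta\epsilon)$;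 fusion tensors $V^{c\mu}_{ab},W^{c\mu}_{ab}$ with $(\psi_a\otimes\psi_b)(\Delta f)=\sum_{c,\mu}V^{c\mu}_{ab}\psi_c(f)W^{c\mu}_{ab}$, $W^{c\mu}_{ab}V^{d\nu}_{ab}=\delta_{cd}\delta_{\mu\nu}\mathrm{id}$. Vacuum: $b_a$ with $f(1)=\sum_a\mathrm{Tr}(b_a\psi_a(f))$, $E=\{a:b_a\ne0\}$, $b_e=v_eu_e$ rank one ($v_e\in W_e,u_e\in W_e^*$); unique $l_a,r_a\in E$ with $N_{ea}^b=\delta_{e,l_a}\delta_{ab}$, $N_{ae}^b=\delta_{e,r_a}\delta_{ab}$. Conjugation: $\bar a$ = class of $f\mapsto\psi_a(Sf)^T$ on $W_a^*$; invertible $Z_a:W_{\bar a}\to W_a^*$ with $\psi_a(Sf)^T=Z_a\psi_{\bar a}(f)Z_a^{-1}$; $w_c\neq0$ defined by $\zeta_c\otimes\theta_c=w_c(u_{r_c}\circ W^{r_c}_{\bar cc})\otimes(V^{r_c}_{\bar cc}v_{r_c})$ where $\zeta_c(\xi\otimes\eta)=(Z_c\xi)(\eta)$ and $(\varphi\otimes\mathrm{id})\theta_c=Z_{\bar c}^{-1}(\varphi)$; $d_a^2=w_aw_{\bar a}$, $d_a=d_{\bar a}$; $g\in\mathcal{A}^*$ with $\psi_a(g)=\frac{d_a}{w_{\bar a}}(Z_a^{-1})^TZ_{\bar a}$. Spherical: $k\in\mathcal{A}^*$ is pivotal if it is invertible, group-like ($\Delta(k)=(k\otimes k)\Delta(\epsilon)=\Delta(\epsilon)(k\otimes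 k)$) and $S^2(f)=kfk^{-1}$ for all $f$. $\mathcal{A}^*$ is spherical with spherical element $k$ if $u_e(v_e)\neq0$ for all $e\in E$ (this is the counit of $\mathcal{A}^*$ evaluated on the central projector onto block $e$), and $k$ is pivotal with $\frac{\mathrm{Tr}\,\psi_a(k)}{u_{l_a}(v_{l_a})}=\frac{\mathrm{Tr}\,\psi_a(k^{-1})}{u_{r_a}(v_{r_a})}$ for all $a\in\mathrm{Irr}(\mathcal{A}^* )$. *)

theory Defs
  imports "Jordan_Normal_Form.Matrix"
begin

text \<open>The weak Hopf algebra A is C^'i for a finite basis type 'i; an element of A is a
coordinate function 'i => complex (x = sum_i x i e_i).  A tensor in A (x) A is a function
on 'i * 'i, a tensor in A (x) A (x) A a function on 'i * 'i * 'i.  The structure maps are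
given by structure constants:
  e_i e_j = sum_k mu i j k e_k,   1 = sum_i un i e_i,
  Delta(e_i) = sum_(a,b) de i a b e_a (x) e_b,  eps(e_i) = ep i,  S(e_i) = sum_j an i j e_j.
An element f of the dual A* is also a function 'i => complex, namely f i = f(e_i).\<close>

record 'i wha =
  mu :: "'i \<Rightarrow> 'i \<Rightarrow> 'i \<Rightarrow> complex"
  un :: "'i \<Rightarrow> complex"
  de :: "'i \<Rightarrow> 'i \<Rightarrow> 'i \<Rightarrow> complex"
  ep :: "'i \<Rightarrow> complex"
  an :: "'i \<Rightarrow> 'i \<Rightarrow> complex"

definition bas :: "'i \<Rightarrow> 'i \<Rightarrow> complex" where
  "bas i = (\<lambda>j. if j = i then 1 else 0)"

definition tn :: "('i \<Rightarrow> complex) \<Rightarrow> ('i \<Rightarrow> complex) \<Rightarrow> ('i \<times> 'i \<Rightarrow> complex)" where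
  "tn x y = (\<lambda>(a, b). x a * y b)"

definition mul :: "('i::finite) wha \<Rightarrow> ('i \<Rightarrow> complex) \<Rightarrow> ('i \<Rightarrow> complex) \<Rightarrow> ('i \<Rightarrow> complex)" where
  "mul H x y = (\<lambda>k. \<Sum>i\<in>UNIV. \<Sum>j\<in>UNIV. x i * y j * mu H i j k)"

definition cop :: "('i::finite) wha \<Rightarrow> ('i \<Rightarrow> complex) \<Rightarrow> ('i \<times> 'i \<Rightarrow> complex)" where
  "cop H x = (\<lambda>(a, b). \<Sum>i\<in>UNIV. x i * de H i a b)"

definition cou :: "('i::finite) wha \<Rightarrow> ('i \<Rightarrow> complex) \<Rightarrow> complex" where
  "cou H x = (\<Sum>i\<in>UNIV. x i * ep H i)"

definition ant :: "('i::finite) wha \<Rightarrow> ('i \<Rightarrow> complex) \<Rightarrow> ('i \<Rightarrow> complex)" where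
  "ant H x = (\<lambda>j. \<Sum>i\<in>UNIV. x i * an H i j)"

definition cop_l :: "('i::finite) wha \<Rightarrow> ('i \<times> 'i \<Rightarrow> complex) \<Rightarrow> ('i \<times> 'i \<times> 'i \<Rightarrow> complex)" where
  "cop_l H X = (\<lambda>(a, b, c). \<Sum>i\<in>UNIV. X (i, c) * de H i a b)"

definition cop_r :: "('i::finite) wha \<Rightarrow> ('i \<times> 'i \<Rightarrow> complex) \<Rightarrow> ('i \<times> 'i \<times> 'i \<Rightarrow> complex)" where
  "cop_r H X = (\<lambda>(a, b, c). \<Sum>j\<in>UNIV. X (a, j) * de H j b c)"

definition cop2 :: "('i::finite) wha \<Rightarrow> ('i \<Rightarrow> complex) \<Rightarrow> ('i \<times> 'i \<times> 'i \<Rightarrow> complex)" where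
  "cop2 H x = cop_l H (cop H x)"

definition mul2 :: "('i::finite) wha \<Rightarrow> ('i \<times> 'i \<Rightarrow> complex) \<Rightarrow> ('i \<times> 'i \<Rightarrow> complex) \<Rightarrow> ('i \<times> 'i \<Rightarrow> complex)" where
  "mul2 H X Y = (\<lambda>(k, l). \<Sum>i\<in>UNIV. \<Sum>j\<in>UNIV. \<Sum>i'\<in>UNIV. \<Sum>j'\<in>UNIV.
      X (i, j) * Y (i', j') * mu H i i' k * mu H j j' l)"

definition mul3 :: "('i::finite) wha \<Rightarrow> ('i \<times> 'i \<times> 'i \<Rightarrow> complex) \<Rightarrow> ('i \<times> 'i \<times> 'i \<Rightarrow> complex)
     \<Rightarrow> ('i \<times> 'i \<times> 'i \<Rightarrow> complex)" where
  "mul3 H X Y = (\<lambda>(k, l, m). \<Sum>i\<in>UNIV. \<Sum>j\<in>UNIV. \<Sum>h\<in>UNIV. \<Sum>i'\<in>UNIV. \<Sum>j'\<in>UNIV. \<Sum>h'\<in>UNIV.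
      X (i, j, h) * Y (i', j', h') * mu H i i' k * mu H j j' l * mu H h h' m)"

definition tn_1X :: "('i \<Rightarrow> complex) \<Rightarrow> ('i \<times> 'i \<Rightarrow> complex) \<Rightarrow> ('i \<times> 'i \<times> 'i \<Rightarrow> complex)" where
  "tn_1X x Y = (\<lambda>(a, b, c). x a * Y (b, c))"

definition tn_X1 :: "('i \<times> 'i \<Rightarrow> complex) \<Rightarrow> ('i \<Rightarrow> complex) \<Rightarrow> ('i \<times> 'i \<times> 'i \<Rightarrow> complex)" where
  "tn_X1 X y = (\<lambda>(a, b, c). X (a, b) * y c)"

definition weak_hopf_algebra :: "('i::finite) wha \<Rightarrow> bool" where
  "weak_hopf_algebra H \<longleftrightarrow>
     (\<forall>x y z. mul H (mul H x y) z = mul H x (mul H y z)) \<and>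
     (\<forall>x. mul H (un H) x = x \<and> mul H x (un H) = x) \<and>
     (\<forall>x. cop_l H (cop H x) = cop_r H (cop H x)) \<and>
     (\<forall>x. (\<lambda>b. \<Sum>a\<in>UNIV. ep H a * cop H x (a, b)) = x \<and>
          (\<lambda>a. \<Sum>b\<in>UNIV. cop H x (a, b) * ep H b) = x) \<and>
     (\<forall>x y. cop H (mul H x y) = mul2 H (cop H x) (cop H y)) \<and>
     (cop2 H (un H) = mul3 H (tn_1X (un H) (cop H (un H))) (tn_X1 (cop H (un H)) (un H)) \<and>
      cop2 H (un H) = mul3 H (tn_X1 (cop H (un H)) (un H)) (tn_1X (un H) (cop H (un H)))) \<and>
     (\<forall>x y z. cou H (mul H (mul H x y) z) =
          (\<Sum>i\<in>UNIV. \<Sum>j\<in>UNIV. cop H y (i, j) * cou H (mul H x (bas i)) * cou H (mul H (bas j) z)) \<and>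
        cou H (mul H (mul H x y) z) =
          (\<Sum>i\<in>UNIV. \<Sum>j\<in>UNIV. cop H y (i, j) * cou H (mul H x (bas j)) * cou H (mul H (bas i) z))) \<and>
     (\<forall>x. (\<lambda>k. \<Sum>i\<in>UNIV. \<Sum>j\<in>UNIV. cop H x (i, j) * mul H (ant H (bas i)) (bas j) k) =
          (\<lambda>k. \<Sum>i\<in>UNIV. \<Sum>j\<in>UNIV. cop H (un H) (i, j) * cou H (mul H x (bas j)) * bas i k)) \<and>
     (\<forall>x. (\<lambda>k. \<Sum>i\<in>UNIV. \<Sum>j\<in>UNIV. cop H x (i, j) * mul H (bas i) (ant H (bas j)) k) =
          (\<lambda>k. \<Sum>i\<in>UNIV. \<Sum>j\<in>UNIV. cop H (un H) (i, j) * cou H (mul H (bas i) x) * bas j k)) \<and>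
     (\<forall>x. (\<lambda>k. \<Sum>i\<in>UNIV. \<Sum>j\<in>UNIV. \<Sum>h\<in>UNIV. cop2 H x (i, j, h) *
              mul H (mul H (ant H (bas i)) (bas j)) (ant H (bas h)) k) = ant H x)"

text \<open>(f g)(x) = sum f(x_(1)) g(x_(2)); unit eps; S(f) = f o S;
 Delta(f)(x (x) y) = f(x y), an element of A* (x) A* viewed as a functional on A (x) A.\<close>

definition dmul :: "('i::finite) wha \<Rightarrow> ('i \<Rightarrow> complex) \<Rightarrow> ('i \<Rightarrow> complex) \<Rightarrow> ('i \<Rightarrow> complex)" where
  "dmul H f g = (\<lambda>i. \<Sum>a\<in>UNIV. \<Sum>b\<in>UNIV. de H i a b * f a * g b)"

definition dant :: "('i::finite) wha \<Rightarrow> ('i \<Rightarrow> complex) \<Rightarrow> ('i \<Rightarrow> complex)" where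
  "dant H f = (\<lambda>i. \<Sum>j\<in>UNIV. an H i j * f j)"

definition dcop :: "('i::finite) wha \<Rightarrow> ('i \<Rightarrow> complex) \<Rightarrow> ('i \<times> 'i \<Rightarrow> complex)" where
  "dcop H f = (\<lambda>(i, j). \<Sum>k\<in>UNIV. mu H i j k * f k)"

definition dmul2 :: "('i::finite) wha \<Rightarrow> ('i \<times> 'i \<Rightarrow> complex) \<Rightarrow> ('i \<times> 'i \<Rightarrow> complex) \<Rightarrow> ('i \<times> 'i \<Rightarrow> complex)" where
  "dmul2 H F G = (\<lambda>(i, j). \<Sum>a\<in>UNIV. \<Sum>b\<in>UNIV. \<Sum>c\<in>UNIV. \<Sum>d\<in>UNIV.
      de H i a b * de H j c d * F (a, c) * G (b, d))"

definition dinvertible :: "('i::finite) wha \<Rightarrow> ('i \<Rightarrow> complex) \<Rightarrow> bool" where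
  "dinvertible H k \<longleftrightarrow> (\<exists>h. dmul H k h = ep H \<and> dmul H h k = ep H)"

definition dinv :: "('i::finite) wha \<Rightarrow> ('i \<Rightarrow> complex) \<Rightarrow> ('i \<Rightarrow> complex)" where
  "dinv H k = (THE h. dmul H k h = ep H \<and> dmul H h k = ep H)"

definition ev :: "('i::finite \<Rightarrow> complex) \<Rightarrow> ('i \<Rightarrow> complex) \<Rightarrow> complex" where
  "ev f x = (\<Sum>i\<in>UNIV. f i * x i)"

definition alg_ideal :: "(('i \<Rightarrow> complex) \<Rightarrow> ('i \<Rightarrow> complex) \<Rightarrow> ('i \<Rightarrow> complex)) \<Rightarrow> ('i \<Rightarrow> complex) set \<Rightarrow> bool" where
  "alg_ideal m I \<longleftrightarrow> (\<lambda>_. 0) \<in> I \<and> (\<forall>x\<in>I. \<forall>y\<in>I. (\<lambda>i. x i + y i) \<in> I) \<and>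
     (\<forall>c. \<forall>x\<in>I. (\<lambda>i. c * x i) \<in> I) \<and> (\<forall>x\<in>I. \<forall>y. m x y \<in> I \<and> m y x \<in> I)"

fun prodl :: "(('i \<Rightarrow> complex) \<Rightarrow> ('i \<Rightarrow> complex) \<Rightarrow> ('i \<Rightarrow> complex)) \<Rightarrow> ('i \<Rightarrow> complex) \<Rightarrow> ('i \<Rightarrow> complex) list \<Rightarrow> ('i \<Rightarrow> complex)" where
  "prodl m u [] = u"
| "prodl m u (x # xs) = m x (prodl m u xs)"

definition nilpotent_ideal :: "(('i \<Rightarrow> complex) \<Rightarrow> ('i \<Rightarrow> complex) \<Rightarrow> ('i \<Rightarrow> complex)) \<Rightarrow> ('i \<Rightarrow> complex) \<Rightarrow> ('i \<Rightarrow> complex) set \<Rightarrow> bool" where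
  "nilpotent_ideal m u I \<longleftrightarrow> (\<exists>n>0. \<forall>xs. length xs = n \<and> set xs \<subseteq> I \<longrightarrow> prodl m u xs = (\<lambda>_. 0))"

definition semisimple_alg :: "(('i \<Rightarrow> complex) \<Rightarrow> ('i \<Rightarrow> complex) \<Rightarrow> ('i \<Rightarrow> complex)) \<Rightarrow> ('i \<Rightarrow> complex) \<Rightarrow> bool" where
  "semisimple_alg m u \<longleftrightarrow> (\<forall>I. alg_ideal m I \<and> nilpotent_ideal m u I \<longrightarrow> I = {\<lambda>_. 0})"

definition dual_semisimple :: "('i::finite) wha \<Rightarrow> bool" where
  "dual_semisimple H \<longleftrightarrow> semisimple_alg (dmul H) (ep H)"

definition mtrace :: "complex mat \<Rightarrow> complex" where
  "mtrace A = (\<Sum>i<dim_row A. A $$ (i, i))"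

definition minv :: "complex mat \<Rightarrow> complex mat" where
  "minv A = (THE B. B \<in> carrier_mat (dim_col A) (dim_row A) \<and> A * B = 1\<^sub>m (dim_row A) \<and> B * A = 1\<^sub>m (dim_col A))"

text \<open>Kronecker product; index (p, q) of W_a (x) W_b is p * dim W_b + q.\<close>
definition kron :: "complex mat \<Rightarrow> complex mat \<Rightarrow> complex mat" where
  "kron A B = mat (dim_row A * dim_row B) (dim_col A * dim_col B)
     (\<lambda>(r, s). A $$ (r div dim_row B, s div dim_col B) * B $$ (r mod dim_row B, s mod dim_col B))"

definition outer :: "complex vec \<Rightarrow> complex vec \<Rightarrow> complex mat" where
  "outer v u = mat (dim_vec v) (dim_vec u) (\<lambda>(r, s). v $ r * u $ s)"

definition is_rep :: "('i::finite) wha \<Rightarrow> nat \<Rightarrow> (('i \<Rightarrow> complex) \<Rightarrow> complex mat) \<Rightarrow> bool" where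
  "is_rep H n \<rho> \<longleftrightarrow> (\<forall>f. \<rho> f \<in> carrier_mat n n) \<and>
     (\<forall>f g. \<rho> (\<lambda>i. f i + g i) = \<rho> f + \<rho> g) \<and>
     (\<forall>c f. \<rho> (\<lambda>i. c * f i) = c \<cdot>\<^sub>m \<rho> f) \<and>
     (\<forall>f g. \<rho> (dmul H f g) = \<rho> f * \<rho> g) \<and>
     \<rho> (ep H) = 1\<^sub>m n"

definition irreducible_rep :: "nat \<Rightarrow> (('i \<Rightarrow> complex) \<Rightarrow> complex mat) \<Rightarrow> bool" where
  "irreducible_rep n \<rho> \<longleftrightarrow> n > 0 \<and>
     (\<forall>U \<subseteq> carrier_vec n.
        (0\<^sub>v n \<in> U \<and> (\<forall>x\<in>U. \<forall>y\<in>U. x + y \<in> U) \<and> (\<forall>c. \<forall>x\<in>U. c \<cdot>\<^sub>v x \<in> U) \<and>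
         (\<forall>f. \<forall>x\<in>U. \<rho> f *\<^sub>v x \<in> U))
        \<longrightarrow> U = {0\<^sub>v n} \<or> U = carrier_vec n)"

definition iso_rep :: "nat \<Rightarrow> (('i \<Rightarrow> complex) \<Rightarrow> complex mat) \<Rightarrow> nat \<Rightarrow> (('i \<Rightarrow> complex) \<Rightarrow> complex mat) \<Rightarrow> bool" where
  "iso_rep n \<rho> m \<sigma> \<longleftrightarrow> n = m \<and> (\<exists>P \<in> carrier_mat n n. invertible_mat P \<and> (\<forall>f. \<rho> f * P = P * \<sigma> f))"

text \<open>psi_a (a :: 'r) is a complete family of pairwise non-isomorphic irreducible
 representations of A*, psi_a acting on W_a = C^(nd a); so 'r plays the role of Irr(A*).\<close>
definition irreps :: "('i::finite) wha \<Rightarrow> ('r \<Rightarrow> nat) \<Rightarrow> ('r \<Rightarrow> ('i \<Rightarrow> complex) \<Rightarrow> complex mat) \<Rightarrow> bool" where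
  "irreps H nd \<psi> \<longleftrightarrow>
     (\<forall>a. is_rep H (nd a) (\<psi> a) \<and> irreducible_rep (nd a) (\<psi> a)) \<and>
     (\<forall>a b. iso_rep (nd a) (\<psi> a) (nd b) (\<psi> b) \<longrightarrow> a = b) \<and>
     (\<forall>n \<rho>. is_rep H n \<rho> \<and> irreducible_rep n \<rho> \<longrightarrow> (\<exists>a. iso_rep n \<rho> (nd a) (\<psi> a)))"

definition tens_rep :: "('i::finite) wha \<Rightarrow> ('r \<Rightarrow> nat) \<Rightarrow> ('r \<Rightarrow> ('i \<Rightarrow> complex) \<Rightarrow> complex mat)
     \<Rightarrow> 'r \<Rightarrow> 'r \<Rightarrow> ('i \<Rightarrow> complex) \<Rightarrow> complex mat" where
  "tens_rep H nd \<psi> a b f = mat (nd a * nd b) (nd a * nd b)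
     (\<lambda>(r, s). \<Sum>i\<in>UNIV. \<Sum>j\<in>UNIV. dcop H f (i, j) * kron (\<psi> a (bas i)) (\<psi> b (bas j)) $$ (r, s))"

definition fusion :: "('i::finite) wha \<Rightarrow> ('r::finite \<Rightarrow> nat) \<Rightarrow> ('r \<Rightarrow> ('i \<Rightarrow> complex) \<Rightarrow> complex mat)
     \<Rightarrow> ('r \<Rightarrow> 'r \<Rightarrow> 'r \<Rightarrow> nat) \<Rightarrow> ('r \<Rightarrow> 'r \<Rightarrow> 'r \<Rightarrow> nat \<Rightarrow> complex mat) \<Rightarrow> ('r \<Rightarrow> 'r \<Rightarrow> 'r \<Rightarrow> nat \<Rightarrow> complex mat) \<Rightarrow> bool" where
  "fusion H nd \<psi> N V W \<longleftrightarrow> (\<forall>a b.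
     (\<forall>c \<mu>. \<mu> < N a b c \<longrightarrow> V a b c \<mu> \<in> carrier_mat (nd a * nd b) (nd c) \<and>
                            W a b c \<mu> \<in> carrier_mat (nd c) (nd a * nd b)) \<and>
     (\<forall>f. tens_rep H nd \<psi> a b f = mat (nd a * nd b) (nd a * nd b)
          (\<lambda>(r, s). \<Sum>c\<in>UNIV. \<Sum>\<mu><N a b c. (V a b c \<mu> * \<psi> c f * W a b c \<mu>) $$ (r, s))) \<and>
     (\<forall>c \<mu> d \<nu>. \<mu> < N a b c \<longrightarrow> \<nu> < N a b d \<longrightarrow>
          W a b c \<mu> * V a b d \<nu> = (if c = d \<and> \<mu> = \<nu> then 1\<^sub>m (nd c) else 0\<^sub>m (nd c) (nd d))))"

definition vacuum :: "('i::finite) wha \<Rightarrow> ('r::finite \<Rightarrow> nat) \<Rightarrow> ('r \<Rightarrow> ('i \<Rightarrow> complex) \<Rightarrow> complex mat)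
     \<Rightarrow> ('r \<Rightarrow> complex mat) \<Rightarrow> bool" where
  "vacuum H nd \<psi> b \<longleftrightarrow> (\<forall>a. b a \<in> carrier_mat (nd a) (nd a)) \<and>
     (\<forall>f. ev f (un H) = (\<Sum>a\<in>UNIV. mtrace (b a * \<psi> a f)))"

definition vacE :: "('r \<Rightarrow> nat) \<Rightarrow> ('r \<Rightarrow> complex mat) \<Rightarrow> 'r set" where
  "vacE nd b = {a. b a \<noteq> 0\<^sub>m (nd a) (nd a)}"

definition vac_vectors :: "('r \<Rightarrow> nat) \<Rightarrow> ('r \<Rightarrow> complex mat) \<Rightarrow> ('r \<Rightarrow> complex vec) \<Rightarrow> ('r \<Rightarrow> complex vec) \<Rightarrow> bool" where
  "vac_vectors nd b u v \<longleftrightarrow> (\<forall>e \<in> vacE nd b. v e \<in> carrier_vec (nd e) \<and> u e \<in> carrier_vec (nd e) \<and>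
     b e = outer (v e) (u e))"

definition left_right :: "('r \<Rightarrow> nat) \<Rightarrow> ('r \<Rightarrow> complex mat) \<Rightarrow> ('r \<Rightarrow> 'r \<Rightarrow> 'r \<Rightarrow> nat) \<Rightarrow> ('r \<Rightarrow> 'r) \<Rightarrow> ('r \<Rightarrow> 'r) \<Rightarrow> bool" where
  "left_right nd b N l r \<longleftrightarrow> (\<forall>a. l a \<in> vacE nd b \<and> r a \<in> vacE nd b \<and>
     (\<forall>e \<in> vacE nd b. \<forall>c. N e a c = (if e = l a \<and> a = c then 1 else 0) \<and>
                          N a e c = (if e = r a \<and> a = c then 1 else 0)))"

text \<open>Conjugation: psi_a(S f)^T = Z_a psi_(bar a)(f) Z_a^(-1), Z_a : W_(bar a) -> W_a^* invertible
 (matrices w.r.t. the standard basis of W_(bar a) and the dual basis of W_a^*).\<close>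
definition conjugation :: "('i::finite) wha \<Rightarrow> ('r \<Rightarrow> nat) \<Rightarrow> ('r \<Rightarrow> ('i \<Rightarrow> complex) \<Rightarrow> complex mat)
     \<Rightarrow> ('r \<Rightarrow> 'r) \<Rightarrow> ('r \<Rightarrow> complex mat) \<Rightarrow> bool" where
  "conjugation H nd \<psi> cb Z \<longleftrightarrow> (\<forall>a. Z a \<in> carrier_mat (nd a) (nd (cb a)) \<and> invertible_mat (Z a) \<and>
     (\<forall>f. transpose_mat (\<psi> a (dant H f)) = Z a * \<psi> (cb a) f * minv (Z a)))"

text \<open>w_c: zeta_c (x) theta_c = w_c (u_(r_c) o W^(r_c)_(bar c c)) (x) (V^(r_c)_(bar c c) v_(r_c)),
 where zeta_c(xi (x) eta) = (Z_c xi)(eta) and (phi (x) id) theta_c = Z_(bar c)^(-1)(phi).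
 Tensors in W_(bar c) (x) W_c are indexed by t = p * nd c + q.  (Here N_(bar c c)^(r_c) = 1, so
 the multiplicity index is 0.)\<close>
definition wdata :: "('r \<Rightarrow> nat) \<Rightarrow> ('r \<Rightarrow> 'r) \<Rightarrow> ('r \<Rightarrow> complex mat) \<Rightarrow> ('r \<Rightarrow> 'r)
     \<Rightarrow> ('r \<Rightarrow> 'r \<Rightarrow> 'r \<Rightarrow> nat \<Rightarrow> complex mat) \<Rightarrow> ('r \<Rightarrow> 'r \<Rightarrow> 'r \<Rightarrow> nat \<Rightarrow> complex mat)
     \<Rightarrow> ('r \<Rightarrow> complex vec) \<Rightarrow> ('r \<Rightarrow> complex vec) \<Rightarrow> ('r \<Rightarrow> complex) \<Rightarrow> bool" where
  "wdata nd cb Z r V W u v w \<longleftrightarrow> (\<forall>c. w c \<noteq> 0 \<and>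
     (let n = nd c; M = nd (cb c) * nd c;
          zeta = (\<lambda>t. Z c $$ (t mod n, t div n));
          theta = (\<lambda>t. minv (Z (cb c)) $$ (t mod n, t div n));
          uW = transpose_mat (W (cb c) c (r c) 0) *\<^sub>v u (r c);
          Vv = V (cb c) c (r c) 0 *\<^sub>v v (r c)
      in \<forall>t<M. \<forall>t'<M. zeta t * theta t' = w c * (uW $ t) * (Vv $ t')))"

definition ddata :: "('r \<Rightarrow> 'r) \<Rightarrow> ('r \<Rightarrow> complex) \<Rightarrow> ('r \<Rightarrow> complex) \<Rightarrow> bool" where
  "ddata cb w d \<longleftrightarrow> (\<forall>a. (d a)\<^sup>2 = w a * w (cb a) \<and> d a = d (cb a))"

definition gdata :: "('r \<Rightarrow> ('i \<Rightarrow> complex) \<Rightarrow> complex mat) \<Rightarrow> ('r \<Rightarrow> 'r) \<Rightarrow> ('r \<Rightarrow> complex mat)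
     \<Rightarrow> ('r \<Rightarrow> complex) \<Rightarrow> ('r \<Rightarrow> complex) \<Rightarrow> ('i \<Rightarrow> complex) \<Rightarrow> bool" where
  "gdata \<psi> cb Z w d g \<longleftrightarrow> (\<forall>a. \<psi> a g = (d a / w (cb a)) \<cdot>\<^sub>m (transpose_mat (minv (Z a)) * Z (cb a)))"

definition group_like :: "('i::finite) wha \<Rightarrow> ('i \<Rightarrow> complex) \<Rightarrow> bool" where
  "group_like H k \<longleftrightarrow> dcop H k = dmul2 H (tn k k) (dcop H (ep H)) \<and>
                      dcop H k = dmul2 H (dcop H (ep H)) (tn k k)"

definition pivotal :: "('i::finite) wha \<Rightarrow> ('i \<Rightarrow> complex) \<Rightarrow> bool" where
  "pivotal H k \<longleftrightarrow> dinvertible H k \<and> group_like H k \<and>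
     (\<forall>f. dant H (dant H f) = dmul H (dmul H k f) (dinv H k))"

definition spherical_element :: "('i::finite) wha \<Rightarrow> ('r \<Rightarrow> nat) \<Rightarrow> ('r \<Rightarrow> ('i \<Rightarrow> complex) \<Rightarrow> complex mat)
     \<Rightarrow> ('r \<Rightarrow> complex mat) \<Rightarrow> ('r \<Rightarrow> complex vec) \<Rightarrow> ('r \<Rightarrow> complex vec) \<Rightarrow> ('r \<Rightarrow> 'r) \<Rightarrow> ('r \<Rightarrow> 'r)
     \<Rightarrow> ('i \<Rightarrow> complex) \<Rightarrow> bool" where
  "spherical_element H nd \<psi> b u v l r k \<longleftrightarrow>
     (\<forall>e \<in> vacE nd b. u e \<bullet> v e \<noteq> 0) \<and> pivotal H k \<and>
     (\<forall>a. mtrace (\<psi> a k) / (u (l a) \<bullet> v (l a)) = mtrace (\<psi> a (dinv H k)) / (u (r a) \<bullet> v (r a)))"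

definition nondegenerate :: "('i::finite) wha \<Rightarrow> ('i \<Rightarrow> complex) \<Rightarrow> bool" where
  "nondegenerate H x \<longleftrightarrow>
     range (\<lambda>f. (\<lambda>b. \<Sum>a\<in>UNIV. f a * cop H x (a, b))) = UNIV \<and>
     range (\<lambda>f. (\<lambda>a. \<Sum>b\<in>UNIV. cop H x (a, b) * f b)) = UNIV"

definition cocommutative :: "('i::finite) wha \<Rightarrow> ('i \<Rightarrow> complex) \<Rightarrow> bool" where
  "cocommutative H x \<longleftrightarrow> cop H x = (\<lambda>(a, b). cop H x (b, a))"

definition clinear :: "(('i \<Rightarrow> complex) \<Rightarrow> ('i \<Rightarrow> complex)) \<Rightarrow> bool" where
  "clinear T \<longleftrightarrow> (\<forall>x y. T (\<lambda>i. x i + y i) = (\<lambda>i. T x i + T y i)) \<and>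
                  (\<forall>c x. T (\<lambda>i. c * x i) = (\<lambda>i. c * T x i))"

definition Omega_el :: "('r::finite \<Rightarrow> ('i \<Rightarrow> complex) \<Rightarrow> complex mat) \<Rightarrow> ('r \<Rightarrow> 'r) \<Rightarrow> ('r \<Rightarrow> complex)
     \<Rightarrow> ('r \<Rightarrow> complex) \<Rightarrow> ('i \<Rightarrow> complex)" where
  "Omega_el \<psi> l d \<xi> = (\<lambda>i. \<Sum>a\<in>UNIV. (1 / (\<Sum>x\<in>{x. l x = l a}. (d x)\<^sup>2)) * (d a / \<xi> a) * mtrace (\<psi> a (bas i)))"

end

theory Submission
  imports Defs "HOL-Library.Function_Algebras" "Jordan_Normal_Form.Spectral_Radius"
begin

text \<open>Write $B = A^*$ and $p_a = \mathrm{Tr}\,\psi_a(k) / u_{l_a}(v_{l_a})$ (the constant \<open>qdim\<close>).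
Contracting the tensors that define $w_a$ gives $p_a = \xi_a d_a = d_a / \xi_a$, so $\Omega$ is the combination of the characters
of $B$ with coefficients $p_a / \sum_{l_x = l_a} p_x^2$.

The functional $f \mapsto \mathrm{Tr}(x \mapsto f S^2(x) h)$ on $B$ is a left integral of $A$ for every $h$ in
the source subalgebra of $B$. Since $S^2$ is conjugation by $k$, it equals
$\sum_a \mathrm{Tr}\,\psi_a(fk)\, \mathrm{Tr}\,\psi_a(k^{-1}h)$; hence every functional
$\sum_a \gamma_{r_a} p_a \mathrm{Tr}\,\psi_a(fk)$ is a left integral. Multiplying it by characters yields
$\sum_c N_{ac}^b p_c = p_a p_b$ for $l_a = l_b$, and the trace of $\Delta(k)$ yields
$\sum_b N_{ac}^b p_b = p_a p_c$ for $r_a = l_c$. As the fusion matrices are real, pairing the vector $p$ with its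
conjugate shows that all $p_a$ are real and that $\sum_{l_x = e} p_x^2$ is positive and takes
the same value at $e = l_a$ and $e = r_a$. So $f \mapsto f(\Omega)$, composed with right multiplication by
$k$, is one of these integrals, normalised to be the counit on the target subalgebra. Idempotence and the
pulling-through identity with $T(x)(f) = x(S(f)k)$ are the standard properties of such an integral.\<close>

section \<open>Multilinear forms and Sweedler sums\<close>

lemma sum_bas [simp]:
  "(\<Sum>j\<in>UNIV. bas (i::'i::finite) j * f j) = f i" "(\<Sum>j\<in>UNIV. f j * bas i j) = f i"
  "(\<Sum>j\<in>UNIV. bas j i * f j) = f i" "(\<Sum>j\<in>UNIV. f j * bas j i) = f i"
  by (simp_all add: bas_def if_distrib[of "\<lambda>z. z * _"] if_distrib[of "\<lambda>z. _ * z"] cong: if_cong)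

lemma ev_bas [simp]: "ev (bas i) x = x i" "ev x (bas i) = x i"
  by (simp_all add: ev_def)

lemma ev_commute: "ev x y = ev y x"
  by (simp add: ev_def mult.commute)

definition lin_form :: "(('i::finite \<Rightarrow> complex) \<Rightarrow> complex) \<Rightarrow> bool" where
  "lin_form F \<longleftrightarrow> (\<forall>x. F x = ev x (\<lambda>i. F (bas i)))"

definition lin_map :: "(('i::finite \<Rightarrow> complex) \<Rightarrow> ('j::finite \<Rightarrow> complex)) \<Rightarrow> bool" where
  "lin_map g \<longleftrightarrow> (\<forall>j. lin_form (\<lambda>x. g x j))"

definition bilin_form ::
    "(('i::finite \<Rightarrow> complex) \<Rightarrow> ('j::finite \<Rightarrow> complex) \<Rightarrow> complex) \<Rightarrow> bool" where
  "bilin_form K \<longleftrightarrow> (\<forall>y. lin_form (\<lambda>x. K x y)) \<and> (\<forall>x. lin_form (K x))"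

definition trilin_form ::
    "(('i::finite \<Rightarrow> complex) \<Rightarrow> ('i \<Rightarrow> complex) \<Rightarrow> ('i \<Rightarrow> complex) \<Rightarrow> complex) \<Rightarrow> bool" where
  "trilin_form F \<longleftrightarrow> (\<forall>z. bilin_form (\<lambda>x y. F x y z)) \<and> (\<forall>x y. lin_form (F x y))"

lemma lin_form_ev: "lin_form F \<Longrightarrow> F x = ev x (\<lambda>i. F (bas i))"
  unfolding lin_form_def by blast

lemma lin_form_expand: "lin_form F \<Longrightarrow> F x = (\<Sum>i\<in>UNIV. F (bas i) * x i)"
  by (subst lin_form_ev) (simp_all add: ev_def mult.commute)

lemma lin_form_add: "lin_form F \<Longrightarrow> F (\<lambda>i. x i + y i) = F x + F y"
  by (simp add: lin_form_ev[of F "\<lambda>i. x i + y i"] lin_form_ev[of F x] lin_form_ev[of F y]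
      ev_def sum.distrib distrib_right)

lemma lin_form_scale: "lin_form F \<Longrightarrow> F (\<lambda>i. c * x i) = c * F x"
  by (simp add: lin_form_ev[of F "\<lambda>i. c * x i"] lin_form_ev[of F x] ev_def sum_distrib_left mult.assoc)

lemma lin_form_zero: "lin_form F \<Longrightarrow> F (\<lambda>_. 0) = 0"
  by (simp add: lin_form_ev[of F "\<lambda>_. 0"] ev_def)

lemma lin_form_sum:
  assumes F: "lin_form F"
  shows "F (\<lambda>i. \<Sum>k\<in>K. x k i) = (\<Sum>k\<in>K. F (x k))"
proof -
  have "F (\<lambda>i. \<Sum>k\<in>K. x k i) = (\<Sum>i\<in>UNIV. \<Sum>k\<in>K. x k i * F (bas i))"
    by (simp add: lin_form_ev[OF F, of "\<lambda>i. \<Sum>k\<in>K. x k i"] ev_def sum_distrib_right)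
  also have "\<dots> = (\<Sum>k\<in>K. ev (x k) (\<lambda>i. F (bas i)))"
    by (subst sum.swap) (simp add: ev_def)
  finally show ?thesis by (simp flip: lin_form_ev[OF F])
qed

lemma lin_form_lincomb: "lin_form F \<Longrightarrow> F (\<lambda>i. \<Sum>k\<in>K. c k * x k i) = (\<Sum>k\<in>K. c k * F (x k))"
  by (simp add: lin_form_sum[of F] lin_form_scale[of F])

lemma lin_formI:
  fixes F :: "('i::finite \<Rightarrow> complex) \<Rightarrow> complex"
  assumes add: "\<And>x y. F (\<lambda>i. x i + y i) = F x + F y"
    and scale: "\<And>c x. F (\<lambda>i. c * x i) = c * F x"
  shows "lin_form F"
proof -
  have zero: "F (\<lambda>i. 0) = 0" using scale[of 0] by simp
  have sum: "F (\<lambda>i. \<Sum>k\<in>K. x k * bas k i) = (\<Sum>k\<in>K. x k * F (bas k))" if "finite K"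
    for K and x :: "'i \<Rightarrow> complex"
    using that by (induction K) (simp_all add: zero add scale)
  have "F x = ev x (\<lambda>i. F (bas i))" for x
    using sum[of UNIV x] by (simp add: ev_def)
  then show ?thesis unfolding lin_form_def by blast
qed

lemma lin_mapI: "(\<And>j. lin_form (\<lambda>x. g x j)) \<Longrightarrow> lin_map g"
  by (simp add: lin_map_def)

named_theorems lin_intros

lemma lin_form_coord: "lin_map g \<Longrightarrow> lin_form (\<lambda>x. g x i)"
  by (simp add: lin_map_def)

lemma lin_map_id [lin_intros]: "lin_map (\<lambda>x. x)"
  by (simp add: lin_map_def lin_form_def ev_def)

lemmas lin_form_id_coord [lin_intros] = lin_form_coord[OF lin_map_id]

lemma lin_map_add: "lin_map g \<Longrightarrow> g (\<lambda>i. x i + y i) = (\<lambda>i. g x i + g y i)"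
  using lin_form_add[OF lin_form_coord] by (intro ext)

lemma lin_map_scale: "lin_map g \<Longrightarrow> g (\<lambda>i. c * x i) = (\<lambda>i. c * g x i)"
  using lin_form_scale[OF lin_form_coord] by (intro ext)

lemma lin_map_zero: "lin_map g \<Longrightarrow> g (\<lambda>_. 0) = (\<lambda>_. 0)"
  using lin_form_zero[OF lin_form_coord] by (intro ext)

lemma lin_form_comp:
  assumes F: "lin_form F" and g: "lin_map g"
  shows "lin_form (\<lambda>x. F (g x))"
proof (rule lin_formI)
  show "F (g (\<lambda>i. x i + y i)) = F (g x) + F (g y)" for x y
    by (simp add: lin_map_add[OF g] lin_form_add[OF F])
  show "F (g (\<lambda>i. c * x i)) = c * F (g x)" for c x
    by (simp add: lin_map_scale[OF g] lin_form_scale[OF F])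
qed

lemma lin_map_comp: "lin_map f \<Longrightarrow> lin_map g \<Longrightarrow> lin_map (\<lambda>x. f (g x))"
  by (rule lin_mapI) (rule lin_form_comp[OF lin_form_coord])

lemma lin_form_const_mult [lin_intros]: "lin_form F \<Longrightarrow> lin_form (\<lambda>x. c * F x)"
  by (rule lin_formI) (simp_all add: lin_form_add[of F] lin_form_scale[of F] algebra_simps)

lemma lin_form_mult_const [lin_intros]: "lin_form F \<Longrightarrow> lin_form (\<lambda>x. F x * c)"
  by (rule lin_formI) (simp_all add: lin_form_add[of F] lin_form_scale[of F] algebra_simps)

lemma lin_form_setsum [lin_intros]: "(\<And>k. lin_form (F k)) \<Longrightarrow> lin_form (\<lambda>x. \<Sum>k\<in>K. F k x)"
  by (rule lin_formI) (simp_all add: lin_form_add[of "F _"] lin_form_scale[of "F _"] sum.distrib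
      sum_distrib_left)

lemma lin_form_0 [lin_intros]: "lin_form (\<lambda>x. 0)"
  by (simp add: lin_form_def ev_def)

lemma lin_form_ev_left [lin_intros]: "lin_map g \<Longrightarrow> lin_form (\<lambda>x. ev (g x) y)"
  unfolding ev_def by (intro lin_form_setsum lin_form_mult_const lin_form_coord)

lemma lin_form_ev_right [lin_intros]: "lin_map g \<Longrightarrow> lin_form (\<lambda>x. ev y (g x))"
  unfolding ev_def by (intro lin_form_setsum lin_form_const_mult lin_form_coord)

lemma bilin_formI [lin_intros]:
  "(\<And>y. lin_form (\<lambda>x. K x y)) \<Longrightarrow> (\<And>x. lin_form (\<lambda>y. K x y)) \<Longrightarrow> bilin_form K"
  by (simp add: bilin_form_def)

lemma trilin_formI [lin_intros]:
  "(\<And>z. bilin_form (\<lambda>x y. F x y z)) \<Longrightarrow> (\<And>x y. lin_form (\<lambda>z. F x y z)) \<Longrightarrow> trilin_form F"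
  by (simp add: trilin_form_def)

lemma bilin_form_comp:
  "bilin_form K \<Longrightarrow> lin_map g \<Longrightarrow> lin_form (\<lambda>x. K (g x) y)"
  "bilin_form K \<Longrightarrow> lin_map h \<Longrightarrow> lin_form (\<lambda>y. K x (h y))"
  unfolding bilin_form_def by (auto intro: lin_form_comp[of "\<lambda>x. K x y"] lin_form_comp[of "K x"])

lemma bilin_form_flip: "bilin_form K \<Longrightarrow> bilin_form (\<lambda>x y. K y x)"
  by (simp add: bilin_form_def)

lemma bilin_form_expand:
  assumes K: "bilin_form K"
  shows "K x y = (\<Sum>i\<in>UNIV. \<Sum>j\<in>UNIV. K (bas i) (bas j) * (x i * y j))"
proof -
  have "K x y = (\<Sum>i\<in>UNIV. K (bas i) y * x i)"
    using K by (intro lin_form_expand[of "\<lambda>x. K x y"]) (simp add: bilin_form_def)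
  also have "\<dots> = (\<Sum>i\<in>UNIV. (\<Sum>j\<in>UNIV. K (bas i) (bas j) * y j) * x i)"
    using K by (simp add: bilin_form_def lin_form_expand[of "K (bas _)" y])
  finally show ?thesis by (simp add: sum_distrib_left sum_distrib_right mult_ac)
qed

lemma trilin_form_expand:
  assumes F: "trilin_form F"
  shows "F x y z = (\<Sum>i\<in>UNIV. \<Sum>j\<in>UNIV. \<Sum>k\<in>UNIV. F (bas i) (bas j) (bas k) * (x i * y j * z k))"
proof -
  have "F x y z = (\<Sum>i\<in>UNIV. \<Sum>j\<in>UNIV. F (bas i) (bas j) z * (x i * y j))"
    using F by (intro bilin_form_expand[of "\<lambda>x y. F x y z"]) (simp add: trilin_form_def)
  also have "\<dots> = (\<Sum>i\<in>UNIV. \<Sum>j\<in>UNIV. (\<Sum>k\<in>UNIV. F (bas i) (bas j) (bas k) * z k) * (x i * y j))"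
    using F by (simp add: trilin_form_def lin_form_expand[of "F (bas _) (bas _)" z])
  finally show ?thesis by (simp add: sum_distrib_left sum_distrib_right mult_ac)
qed

text \<open>An identity between tensors is stated by applying an arbitrary multilinear form to both sides, so only
scalar-valued sums over $x_{(1)} \otimes x_{(2)}$ occur.\<close>

definition sweedler :: "(('i::finite \<Rightarrow> complex) \<Rightarrow> 'i \<times> 'i \<Rightarrow> complex) \<Rightarrow> ('i \<Rightarrow> complex) \<Rightarrow>
   (('i \<Rightarrow> complex) \<Rightarrow> ('i \<Rightarrow> complex) \<Rightarrow> complex) \<Rightarrow> complex" where
  "sweedler \<Delta> x K = (\<Sum>p\<in>UNIV. \<Sum>q\<in>UNIV. \<Delta> x (p, q) * K (bas p) (bas q))"

lemma sweedler_cong: "(\<And>a b. K a b = L a b) \<Longrightarrow> sweedler \<Delta> x K = sweedler \<Delta> x L"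
  by (simp add: sweedler_def)

lemma sweedler_mult_left: "sweedler \<Delta> x (\<lambda>a b. c * K a b) = c * sweedler \<Delta> x K"
  by (simp add: sweedler_def sum_distrib_left mult.left_commute)

lemma sweedler_mult_right: "sweedler \<Delta> x (\<lambda>a b. K a b * c) = sweedler \<Delta> x K * c"
  by (simp add: sweedler_def sum_distrib_right mult.assoc)

lemma sweedler_sum: "sweedler \<Delta> x (\<lambda>a b. \<Sum>k\<in>I. K k a b) = (\<Sum>k\<in>I. sweedler \<Delta> x (K k))"
  unfolding sweedler_def sum_distrib_left by (simp add: sum.swap[of _ I])

lemma sweedler_coords: "sweedler \<Delta> x (\<lambda>a b. a i * b j) = \<Delta> x (i, j)"
  by (simp add: sweedler_def mult.assoc[symmetric] flip: sum_distrib_right)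

lemma sweedler_coord_left: "sweedler \<Delta> x (\<lambda>a b. a i * F b) = (\<Sum>q\<in>UNIV. \<Delta> x (i, q) * F (bas q))"
proof -
  have "sweedler \<Delta> x (\<lambda>a b. a i * F b) = (\<Sum>q\<in>UNIV. \<Sum>p\<in>UNIV. bas p i * (\<Delta> x (p, q) * F (bas q)))"
    unfolding sweedler_def by (subst sum.swap) (simp only: mult.left_commute)
  then show ?thesis by simp
qed

lemma sweedler_coord_right: "sweedler \<Delta> x (\<lambda>a b. F a * b i) = (\<Sum>p\<in>UNIV. \<Delta> x (p, i) * F (bas p))"
  by (simp add: sweedler_def flip: mult.assoc)

definition coopposite ::
    "(('i \<Rightarrow> complex) \<Rightarrow> 'i \<times> 'i \<Rightarrow> complex) \<Rightarrow> ('i \<Rightarrow> complex) \<Rightarrow> 'i \<times> 'i \<Rightarrow> complex" where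
  "coopposite \<Delta> x = (\<lambda>(a, b). \<Delta> x (b, a))"

lemma sweedler_coopposite: "sweedler (coopposite \<Delta>) x K = sweedler \<Delta> x (\<lambda>a b. K b a)"
  unfolding sweedler_def coopposite_def by (subst sum.swap) simp

lemma sweedler_swap:
  "sweedler \<Delta> x (\<lambda>a b. sweedler \<Delta>' y (\<lambda>c d. F a b c d)) =
      sweedler \<Delta>' y (\<lambda>c d. sweedler \<Delta> x (\<lambda>a b. F a b c d))"
proof -
  have pair_sum: "sweedler \<Delta> z K = (\<Sum>pq\<in>UNIV. \<Delta> z pq * K (bas (fst pq)) (bas (snd pq)))"
    for \<Delta> :: "('k::finite \<Rightarrow> complex) \<Rightarrow> 'k \<times> 'k \<Rightarrow> complex" and z K
    unfolding sweedler_def by (simp add: sum.cartesian_product split_def)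
  show ?thesis unfolding pair_sum sum_distrib_left
    by (subst sum.swap) (simp add: mult.left_commute)
qed

lemma lin_form_sweedler [lin_intros]:
  "(\<And>a b. lin_form (\<lambda>x. K x a b)) \<Longrightarrow> lin_form (\<lambda>x. sweedler \<Delta> y (\<lambda>a b. K x a b))"
  unfolding sweedler_def by (intro lin_intros)

lemma sweedler_lin_form:
  assumes G: "lin_form G"
  shows "sweedler \<Delta> x (\<lambda>a b. c a b * G (f a b)) =
      (\<Sum>i\<in>UNIV. G (bas i) * sweedler \<Delta> x (\<lambda>a b. c a b * f a b i))"
  unfolding lin_form_expand[OF G, of "f _ _"]
  by (simp add: sweedler_sum sum_distrib_left mult.left_commute[of "c _ _"] flip: sweedler_mult_left)

lemma sweedler_bilin_form:
  assumes K: "bilin_form K"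
  shows "sweedler \<Delta> x (\<lambda>a b. K (f a b) (g a b)) =
    (\<Sum>i\<in>UNIV. \<Sum>j\<in>UNIV. K (bas i) (bas j) * sweedler \<Delta> x (\<lambda>a b. f a b i * g a b j))"
  unfolding bilin_form_expand[OF K, of "f _ _"] by (simp add: sweedler_sum sweedler_mult_left)

lemma sweedler_transfer:
  assumes \<Delta>: "\<And>i j. \<Delta> x (i, j) = sweedler \<Delta>' y (\<lambda>a b. f a b i * g a b j)" and K: "bilin_form K"
  shows "sweedler \<Delta> x K = sweedler \<Delta>' y (\<lambda>a b. K (f a b) (g a b))"
  unfolding sweedler_bilin_form[OF K] by (simp add: sweedler_coords \<Delta>)

lemma lin_form_sweedler_vector:
  "lin_form G \<Longrightarrow> G (\<lambda>i. sweedler \<Delta> x (\<lambda>a b. c a b * f a b i)) = sweedler \<Delta> x (\<lambda>a b. c a b * G (f a b))"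
  by (simp add: sweedler_lin_form lin_form_expand[of G "\<lambda>i. sweedler _ _ (\<lambda>a b. _ a b i)"])

lemma eq_lin_formI: "(\<And>G. lin_form G \<Longrightarrow> G x = G y) \<Longrightarrow> x = y"
  using lin_form_id_coord by (intro ext) blast

section \<open>Matrices and coordinate spaces\<close>

lemma mult_mat_unit_vec:
  fixes A :: "'a::semiring_1 mat"
  assumes "A \<in> carrier_mat m n" "i < n"
  shows "A *\<^sub>v unit_vec n i = col A i"
  by (rule eq_vecI) (use assms in auto)

lemma mult_mat_zero_vec: "A \<in> carrier_mat m n \<Longrightarrow> A *\<^sub>v 0\<^sub>v n = (0\<^sub>v m :: 'a::semiring_1 vec)"
  by (rule eq_vecI) auto

lemma mat_eq_mult_vecI:
  fixes A B :: "'a::semiring_1 mat"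
  assumes A: "A \<in> carrier_mat m n" and B: "B \<in> carrier_mat m n"
    and eq: "\<And>y. y \<in> carrier_vec n \<Longrightarrow> A *\<^sub>v y = B *\<^sub>v y"
  shows "A = B"
proof (rule mat_col_eqI)
  fix i assume "i < dim_col B"
  then show "col A i = col B i"
    using eq[of "unit_vec n i"] mult_mat_unit_vec[OF A, of i] mult_mat_unit_vec[OF B, of i] B by auto
qed (use A B in auto)

lemma smult_one_mat_mult_vec:
  "x \<in> carrier_vec n \<Longrightarrow> c \<cdot>\<^sub>m 1\<^sub>m n *\<^sub>v x =
    c \<cdot>\<^sub>v (x :: 'a::comm_semiring_1 vec)"
  by (rule eq_vecI) auto

lemma vec_diff_zero: "x \<in> carrier_vec n \<Longrightarrow> y \<in> carrier_vec n \<Longrightarrow> x - y = 0\<^sub>v n \<Longrightarrow> x = (y :: complex vec)"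
  by (metis carrier_vecD eq_vecI index_minus_vec(1) index_zero_vec(1) right_minus_eq)

lemma mtrace_mult_commute:
  assumes "A \<in> carrier_mat n m" "B \<in> carrier_mat m n"
  shows "mtrace (A * B) = mtrace (B * A)"
proof -
  have "mtrace (A * B) = (\<Sum>i<n. \<Sum>j<m. A $$ (i, j) * B $$ (j, i))"
    using assms by (auto simp: mtrace_def scalar_prod_def atLeast0LessThan intro!: sum.cong)
  also have "\<dots> = mtrace (B * A)"
    using assms by (subst sum.swap)
      (auto simp: mtrace_def scalar_prod_def atLeast0LessThan mult.commute intro!: sum.cong)
  finally show ?thesis .
qed

lemma mtrace_one: "mtrace (1\<^sub>m n) = of_nat n"
  by (simp add: mtrace_def)

lemma invertible_mat_inverse:
  assumes A: "A \<in> carrier_mat n n" and inv: "invertible_mat A"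
  obtains B where "B \<in> carrier_mat n n" "A * B = 1\<^sub>m n" "B * A = 1\<^sub>m n"
proof -
  obtain B where "inverts_mat A B" "inverts_mat B A" using inv unfolding invertible_mat_def by blast
  then have B: "A * B = 1\<^sub>m n" "B * A = 1\<^sub>m (dim_row B)" using A by (auto simp: inverts_mat_def)
  moreover have "dim_col B = n" "dim_row B = n"
    using arg_cong[OF B(1), of dim_col] arg_cong[OF B(2), of dim_col] A by simp_all
  ultimately show thesis using that[of B] by auto
qed

lemma bijective_mat_inverse:
  fixes P :: "complex mat"
  assumes P: "P \<in> carrier_mat m n"
    and inj: "\<And>x. x \<in> carrier_vec n \<Longrightarrow> P *\<^sub>v x = 0\<^sub>v m \<Longrightarrow> x = 0\<^sub>v n"
    and surj: "\<And>y. y \<in> carrier_vec m \<Longrightarrow> \<exists>x\<in>carrier_vec n. P *\<^sub>v x = y"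
  obtains Q where "Q \<in> carrier_mat n m" "P * Q = 1\<^sub>m m" "Q * P = 1\<^sub>m n" "n = m"
proof -
  obtain q where q: "\<And>i. q i \<in> carrier_vec n" "\<And>i. P *\<^sub>v q i = unit_vec m i"
    using surj[OF unit_vec_carrier] by metis
  define Q where "Q = mat n m (\<lambda>(s, i). q i $ s)"
  have Q: "Q \<in> carrier_mat n m" by (simp add: Q_def)
  have col_Q: "col Q i = q i" if "i < m" for i
    using that q(1)[of i] by (auto simp: Q_def)
  have PQ: "P * Q = 1\<^sub>m m"
  proof (rule mat_col_eqI)
    fix i assume "i < dim_col (1\<^sub>m m :: complex mat)"
    then show "col (P * Q) i = col (1\<^sub>m m) i"
      by (simp add: col_mult2[OF P Q] col_Q q)
  qed (use P Q in auto)
  have QP: "Q * P = 1\<^sub>m n"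
  proof (rule mat_eq_mult_vecI)
    fix y :: "complex vec" assume y: "y \<in> carrier_vec n"
    have "P *\<^sub>v (Q *\<^sub>v (P *\<^sub>v y) - y) = P * Q *\<^sub>v (P *\<^sub>v y) - P *\<^sub>v y"
      using P Q y by (simp add: mult_minus_distrib_mat_vec[OF P])
    also have "\<dots> = 0\<^sub>v m" using P y by (simp add: PQ)
    finally have "Q *\<^sub>v (P *\<^sub>v y) - y = 0\<^sub>v n" by (rule inj[rotated]) (use P Q y in auto)
    then have "Q *\<^sub>v (P *\<^sub>v y) = y" by (rule vec_diff_zero[rotated 2]) (use P Q y in auto)
    then show "Q * P *\<^sub>v y = 1\<^sub>m n *\<^sub>v y" using P Q y by simp
  qed (use P Q in auto)
  have "(of_nat n :: complex) = of_nat m"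
    using mtrace_mult_commute[OF P Q] by (simp add: PQ QP mtrace_one)
  then show thesis using that Q PQ QP by simp
qed

definition fun_scale :: "complex \<Rightarrow> ('i \<Rightarrow> complex) \<Rightarrow> 'i \<Rightarrow> complex" where
  "fun_scale c x = (\<lambda>i. c * x i)"

lemma sum_fun_apply: "(\<Sum>k\<in>K. g k) i = (\<Sum>k\<in>K. g k i)" for g :: "'k \<Rightarrow> 'i \<Rightarrow> complex"
  by (induction K rule: infinite_finite_induct) auto

interpretation fun_space: vector_space "fun_scale :: _ \<Rightarrow> ('i \<Rightarrow> complex) \<Rightarrow> _"
  by unfold_locales (auto simp: fun_scale_def fun_eq_iff algebra_simps)

interpretation fun_space: finite_dimensional_vector_space fun_scale "range (bas :: 'i::finite \<Rightarrow> _)"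
proof
  show "finite (range (bas :: 'i \<Rightarrow> _))" by simp
  have inj: "inj (bas :: 'i \<Rightarrow> _)" by (rule injI) (metis bas_def zero_neq_one)
  show "fun_space.independent (range (bas :: 'i \<Rightarrow> _))"
  proof (rule fun_space.independent_if_scalars_zero)
    fix f :: "('i \<Rightarrow> complex) \<Rightarrow> complex" and x :: "'i \<Rightarrow> complex"
    assume sum: "(\<Sum>x\<in>range bas. fun_scale (f x) x) = 0" and "x \<in> range bas"
    then obtain j where j: "x = bas j" by blast
    have "(\<Sum>i\<in>UNIV. f (bas i) * bas i j) = 0"
      using fun_cong[OF sum, of j] by (simp add: sum.reindex[OF inj] sum_fun_apply fun_scale_def)
    then show "f x = 0" by (simp add: j)
  qed simp
  have "x \<in> fun_space.span (range bas)" for x :: "'i \<Rightarrow> complex"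
  proof -
    have "(\<Sum>i\<in>UNIV. fun_scale (x i) (bas i)) \<in> fun_space.span (range bas)"
      by (intro fun_space.span_sum fun_space.span_scale fun_space.span_base) simp
    moreover have "(\<Sum>i\<in>UNIV. fun_scale (x i) (bas i)) = x"
      by (rule ext) (simp add: sum_fun_apply fun_scale_def)
    ultimately show ?thesis by simp
  qed
  then show "fun_space.span (range (bas :: 'i \<Rightarrow> _)) = UNIV" by blast
qed

lemma fun_subspace_iff:
  "fun_space.subspace L \<longleftrightarrow> (\<lambda>_. 0) \<in> L \<and> (\<forall>x\<in>L. \<forall>y\<in>L. (\<lambda>i. x i + y i) \<in> L) \<and> (\<forall>c. \<forall>x\<in>L. (\<lambda>i. c * x i) \<in> L)"
  by (simp add: fun_space.subspace_def plus_fun_def zero_fun_def fun_scale_def)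

lemma fun_subspace_add: "fun_space.subspace L \<Longrightarrow> x \<in> L \<Longrightarrow> y \<in> L \<Longrightarrow> (\<lambda>i. x i + y i) \<in> L"
  by (simp add: fun_subspace_iff)

lemma fun_subspace_scale: "fun_space.subspace L \<Longrightarrow> x \<in> L \<Longrightarrow> (\<lambda>i. c * x i) \<in> L"
  by (simp add: fun_subspace_iff)

lemma fun_subspace_sum:
  "fun_space.subspace L \<Longrightarrow> (\<And>k. k \<in> K \<Longrightarrow> x k \<in> L) \<Longrightarrow> (\<lambda>i. \<Sum>k\<in>K. c k * x k i) \<in> L"
  using fun_space.subspace_sum[of L K "\<lambda>k. fun_scale (c k) (x k)"]
  by (simp add: fun_subspace_scale sum_fun_apply[abs_def] fun_scale_def)

lemma lin_form_linear: "Vector_Spaces.linear fun_scale (*) F \<Longrightarrow> lin_form F"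
  by (rule lin_formI) (auto simp: Vector_Spaces.linear_iff plus_fun_def fun_scale_def)

lemma lin_map_inj_imp_surj:
  fixes g :: "('i::finite \<Rightarrow> complex) \<Rightarrow> 'i \<Rightarrow> complex"
  assumes g: "lin_map g" and kernel: "\<And>x. g x = (\<lambda>_. 0) \<Longrightarrow> x = (\<lambda>_. 0)"
  shows "surj g"
proof -
  have linear: "Vector_Spaces.linear fun_scale fun_scale g"
    using lin_map_add[OF g] lin_map_scale[OF g]
    by (simp add: Vector_Spaces.linear_iff fun_space.vector_space_axioms plus_fun_def fun_scale_def)
  have "inj g"
    using module_hom.inj_iff_eq_0[OF Vector_Spaces.linear.axioms(3)[OF linear]] kernel
    by (auto simp: zero_fun_def)
  then show ?thesis using fun_space.linear_inj_imp_surj[OF linear] by blast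
qed

definition dual_bases ::
    "('i::finite \<Rightarrow> complex) set \<Rightarrow> nat \<Rightarrow> (nat \<Rightarrow> 'i \<Rightarrow> complex) \<Rightarrow> (nat \<Rightarrow> ('i \<Rightarrow> complex) \<Rightarrow> complex) \<Rightarrow> bool" where
  "dual_bases L n h \<kappa> \<longleftrightarrow> (\<forall>j<n. h j \<in> L) \<and> (\<forall>j. lin_form (\<kappa> j)) \<and>
     (\<forall>i<n. \<forall>j<n. \<kappa> i (h j) = (if i = j then 1 else 0)) \<and>
     (\<forall>x\<in>L. x = (\<lambda>q. \<Sum>j<n. \<kappa> j x * h j q))"

lemma subspace_dual_bases:
  fixes L :: "('i::finite \<Rightarrow> complex) set"
  assumes L: "fun_space.subspace L"
  obtains n h \<kappa> where "dual_bases L n h \<kappa>"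
proof -
  interpret forms: vector_space_pair "fun_scale :: _ \<Rightarrow> ('i \<Rightarrow> complex) \<Rightarrow> _" "(*) :: complex \<Rightarrow> _"
    by unfold_locales (auto simp: algebra_simps)
  obtain B where B: "B \<subseteq> L" "fun_space.independent B" "L \<subseteq> fun_space.span B"
    by (rule fun_space.basis_exists)
  have fin: "finite B" by (rule fun_space.finiteI_independent[OF B(2)])
  obtain h where h: "bij_betw h {..<card B} B"
    using ex_bij_betw_nat_finite[OF fin] unfolding atLeast0LessThan by blast
  then have h_eq: "h i = h j \<longleftrightarrow> i = j" if "i < card B" "j < card B" for i j
    using that inj_on_eq_iff[OF bij_betw_imp_inj_on[OF h]] by simp
  have "\<exists>\<kappa>. lin_form \<kappa> \<and> (\<forall>x\<in>B. \<kappa> x = (if h i = x then 1 else 0))" for i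
    using forms.linear_independent_extend[OF B(2), of "\<lambda>x. if h i = x then 1 else 0"]
    by (auto dest: lin_form_linear)
  then obtain \<kappa> where \<kappa>: "\<And>i. lin_form (\<kappa> i)" "\<And>i x. x \<in> B \<Longrightarrow> \<kappa> i x = (if h i = x then 1 else 0)"
    by metis
  have hB: "h j \<in> B" if "j < card B" for j using h that by (auto simp: bij_betw_def)
  have \<kappa>_h: "\<kappa> i (h j) = (if i = j then 1 else 0)" if "i < card B" "j < card B" for i j
    using that by (simp add: \<kappa>(2) hB h_eq)
  have "x = (\<lambda>q. \<Sum>j<card B. \<kappa> j x * h j q)" if "x \<in> L" for x
  proof -
    have "x \<in> fun_space.span B" using that B(3) by blast
    then obtain c where "x = (\<Sum>b\<in>B. fun_scale (c b) b)"
      unfolding fun_space.span_finite[OF fin] by blast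
    then have x: "x = (\<lambda>q. \<Sum>j<card B. c (h j) * h j q)"
      by (simp add: sum_fun_apply[abs_def] fun_scale_def flip: sum.reindex_bij_betw[OF h])
    have "\<kappa> i x = c (h i)" if "i < card B" for i
      using that by (subst x) (simp add: lin_form_lincomb[OF \<kappa>(1)] \<kappa>_h if_distrib[of "\<lambda>z. _ * z"]
          cong: if_cong)
    then show ?thesis by (subst (1) x) simp
  qed
  then show thesis using that[of "card B" h \<kappa>] hB B(1) \<kappa>(1) \<kappa>_h by (auto simp: dual_bases_def)
qed

lemma linear_factorization:
  fixes F G :: "('i::finite \<Rightarrow> complex) \<Rightarrow> complex vec"
  assumes L: "fun_space.subspace L"
    and F: "\<And>f. F f \<in> carrier_vec n" "\<And>i. i < n \<Longrightarrow> lin_form (\<lambda>f. F f $ i)"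
    and G: "\<And>f. G f \<in> carrier_vec k" "\<And>i. i < k \<Longrightarrow> lin_form (\<lambda>f. G f $ i)"
    and surj: "\<And>z. z \<in> carrier_vec n \<Longrightarrow> \<exists>f\<in>L. F f = z"
    and kernel: "\<And>f. f \<in> L \<Longrightarrow> F f = 0\<^sub>v n \<Longrightarrow> G f = 0\<^sub>v k"
  shows "\<exists>P\<in>carrier_mat k n. \<forall>f\<in>L. G f = P *\<^sub>v F f"
proof -
  obtain e where e: "\<And>i. e i \<in> L" "\<And>i. F (e i) = unit_vec n i"
    using surj[OF unit_vec_carrier] by metis
  define P where "P = mat k n (\<lambda>(r, i). G (e i) $ r)"
  have "G f = P *\<^sub>v F f" if f: "f \<in> L" for f
  proof (rule eq_vecI)
    fix r assume "r < dim_vec (P *\<^sub>v F f)"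
    then have r: "r < k" by (simp add: P_def)
    define f0 where "f0 = (\<lambda>p. f p + (\<Sum>i<n. - (F f $ i) * e i p))"
    have f0: "h f0 = h f - (\<Sum>i<n. F f $ i * h (e i))" if "lin_form h" for h
      unfolding f0_def lin_form_add[OF that] lin_form_lincomb[OF that] by (simp add: sum_negf)
    have "f0 \<in> L"
      unfolding f0_def by (intro fun_subspace_add[OF L f] fun_subspace_sum[OF L] e)
    moreover have "F f0 = 0\<^sub>v n"
    proof (rule eq_vecI)
      fix s assume s: "s < dim_vec (0\<^sub>v n :: complex vec)"
      then have "F f0 $ s = F f $ s - (\<Sum>i<n. F f $ i * unit_vec n i $ s)"
        using f0[OF F(2)[of s]] by (simp add: e(2))
      also have "\<dots> = 0"
        using s by (simp add: unit_vec_def if_distrib[of "\<lambda>t. _ * t"] cong: if_cong)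
      finally show "F f0 $ s = 0\<^sub>v n $ s" using s by simp
    qed (use F(1)[of f0] in simp)
    ultimately have "G f0 $ r = 0" using r by (simp add: kernel)
    then have "G f $ r = (\<Sum>i<n. F f $ i * G (e i) $ r)"
      unfolding f0[OF G(2)[OF r]] by simp
    then show "G f $ r = (P *\<^sub>v F f) $ r"
      using r F(1)[of f] by (simp add: P_def scalar_prod_def atLeast0LessThan mult.commute)
  qed (use G(1)[of f] in \<open>simp add: P_def\<close>)
  then show ?thesis by (intro bexI[of _ P]) (auto simp: P_def)
qed

section \<open>Irreducible representations of finite-dimensional algebras\<close>

lemma irreducible_repD:
  assumes "irreducible_rep n \<rho>" "U \<subseteq> carrier_vec n" "0\<^sub>v n \<in> U" "\<And>x y. x \<in> U \<Longrightarrow> y \<in> U \<Longrightarrow> x + y \<in> U"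
    "\<And>c x. x \<in> U \<Longrightarrow> c \<cdot>\<^sub>v x \<in> U" "\<And>f x. x \<in> U \<Longrightarrow> \<rho> f *\<^sub>v x \<in> U"
  shows "U = {0\<^sub>v n} \<or> U = carrier_vec n"
  by (rule assms(1)[unfolded irreducible_rep_def, THEN conjunct2, THEN spec, THEN mp, THEN mp])
    (use assms(2-) in auto)

lemma irreducible_rep_pos: "irreducible_rep n \<rho> \<Longrightarrow> n > 0"
  by (simp add: irreducible_rep_def)

locale intertwiner =
  fixes n m :: nat and \<rho> \<sigma> :: "('i \<Rightarrow> complex) \<Rightarrow> complex mat" and P :: "complex mat"
  assumes irr_source: "irreducible_rep n \<rho>" and irr_target: "irreducible_rep m \<sigma>"
    and carrier_source: "\<rho> f \<in> carrier_mat n n" and carrier_target: "\<sigma> f \<in> carrier_mat m m"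
    and carrier_P: "P \<in> carrier_mat m n"
    and intertwines: "\<sigma> f * P = P * \<rho> f"
begin

lemma intertwines_vec: "x \<in> carrier_vec n \<Longrightarrow> \<sigma> f *\<^sub>v (P *\<^sub>v x) = P *\<^sub>v (\<rho> f *\<^sub>v x)"
  using intertwines[of f] carrier_P carrier_source[of f] carrier_target[of f]
  by (metis assoc_mult_mat_vec)

lemma kernel_trivial:
  assumes nonzero: "P \<noteq> 0\<^sub>m m n" and x: "x \<in> carrier_vec n" "P *\<^sub>v x = 0\<^sub>v m"
  shows "x = 0\<^sub>v n"
proof -
  let ?U = "{x \<in> carrier_vec n. P *\<^sub>v x = 0\<^sub>v m}"
  have "?U = {0\<^sub>v n} \<or> ?U = carrier_vec n"
  proof (rule irreducible_repD[OF irr_source])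
    fix f x assume "x \<in> ?U"
    then show "\<rho> f *\<^sub>v x \<in> ?U"
      using intertwines_vec[of x f] carrier_source[of f] mult_mat_zero_vec[OF carrier_target[of f]]
      by (auto intro: mult_mat_vec_carrier)
  qed (auto simp: mult_add_distrib_mat_vec[OF carrier_P] mult_mat_vec[OF carrier_P]
      mult_mat_zero_vec[OF carrier_P])
  moreover have "?U \<noteq> carrier_vec n"
  proof
    assume all: "?U = carrier_vec n"
    have "P = 0\<^sub>m m n"
    proof (rule mat_eq_mult_vecI[OF carrier_P])
      fix y :: "complex vec" assume y: "y \<in> carrier_vec n"
      then have "P *\<^sub>v y = 0\<^sub>v m" using all by blast
      also have "\<dots> = 0\<^sub>m m n *\<^sub>v y" using y by (intro eq_vecI) auto
      finally show "P *\<^sub>v y = 0\<^sub>m m n *\<^sub>v y" .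
    qed simp
    then show False using nonzero by simp
  qed
  ultimately show ?thesis using x by blast
qed

lemma surjective:
  assumes nonzero: "P \<noteq> 0\<^sub>m m n" and y: "y \<in> carrier_vec m"
  shows "\<exists>x\<in>carrier_vec n. P *\<^sub>v x = y"
proof -
  let ?U = "(\<lambda>x. P *\<^sub>v x) ` carrier_vec n"
  have "?U = {0\<^sub>v m} \<or> ?U = carrier_vec m"
  proof (rule irreducible_repD[OF irr_target])
    show "?U \<subseteq> carrier_vec m" using carrier_P by (auto intro: mult_mat_vec_carrier)
    show "0\<^sub>v m \<in> ?U"
      by (rule image_eqI[of _ _ "0\<^sub>v n"]) (simp_all add: mult_mat_zero_vec[OF carrier_P])
    show "x + y \<in> ?U" if "x \<in> ?U" "y \<in> ?U" for x y
      using that by (auto simp flip: mult_add_distrib_mat_vec[OF carrier_P])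
    show "c \<cdot>\<^sub>v x \<in> ?U" if "x \<in> ?U" for c x
      using that by (auto simp flip: mult_mat_vec[OF carrier_P])
    show "\<sigma> f *\<^sub>v x \<in> ?U" if "x \<in> ?U" for f x
      using that carrier_source[of f] by (auto simp: intertwines_vec intro: mult_mat_vec_carrier)
  qed
  moreover have "?U \<noteq> {0\<^sub>v m}"
  proof
    assume "?U = {0\<^sub>v m}"
    then have "P *\<^sub>v unit_vec n 0 = 0\<^sub>v m" by (metis imageI singletonD unit_vec_carrier)
    then have "unit_vec n 0 = (0\<^sub>v n :: complex vec)"
      by (rule kernel_trivial[OF nonzero unit_vec_carrier])
    then show False using irreducible_rep_pos[OF irr_source] by (metis unit_vec_nonzero)
  qed
  ultimately have "y \<in> ?U" using y by blast
  then show ?thesis by blast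
qed

theorem schur_iso: "P \<noteq> 0\<^sub>m m n \<Longrightarrow> iso_rep m \<sigma> n \<rho>"
proof -
  assume nonzero: "P \<noteq> 0\<^sub>m m n"
  obtain Q where Q: "Q \<in> carrier_mat n m" "P * Q = 1\<^sub>m m" "Q * P = 1\<^sub>m n" "n = m"
    using bijective_mat_inverse[OF carrier_P kernel_trivial[OF nonzero] surjective[OF nonzero]] by metis
  then have "invertible_mat P"
    using carrier_P by (auto simp: invertible_mat_def inverts_mat_def)
  then show ?thesis using carrier_P intertwines Q(4) by (auto simp: iso_rep_def)
qed

end

theorem schur_scalar:
  fixes \<rho> :: "('i \<Rightarrow> complex) \<Rightarrow> complex mat"
  assumes "intertwiner n n \<rho> \<rho> P"
  obtains c where "P = c \<cdot>\<^sub>m 1\<^sub>m n"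
proof -
  interpret intertwiner n n \<rho> \<rho> P by fact
  have "n \<noteq> 0" using irreducible_rep_pos[OF irr_source] by simp
  then obtain c x where x: "x \<in> carrier_vec n" "x \<noteq> 0\<^sub>v n" "P *\<^sub>v x = c \<cdot>\<^sub>v x"
    using spectrum_non_empty[OF carrier_P] carrier_P
    by (auto simp: spectrum_def eigenvalue_def eigenvector_def)
  have scalar: "c \<cdot>\<^sub>m 1\<^sub>m n \<in> carrier_mat n n" by simp
  interpret shifted: intertwiner n n \<rho> \<rho> "P - c \<cdot>\<^sub>m 1\<^sub>m n"
  proof
    show "\<rho> f * (P - c \<cdot>\<^sub>m 1\<^sub>m n) = (P - c \<cdot>\<^sub>m 1\<^sub>m n) * \<rho> f" for f
      unfolding mult_minus_distrib_mat[OF carrier_source carrier_P scalar]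
        minus_mult_distrib_mat[OF carrier_P scalar carrier_source]
        mult_smult_distrib[OF carrier_source one_carrier_mat]
        mult_smult_assoc_mat[OF one_carrier_mat carrier_source]
      using carrier_source[of f] by (simp add: intertwines)
  qed (use irr_source carrier_source carrier_P in auto)
  have "(P - c \<cdot>\<^sub>m 1\<^sub>m n) *\<^sub>v x = 0\<^sub>v n"
    unfolding minus_mult_distrib_mat_vec[OF carrier_P scalar x(1)] x(3)
      smult_one_mat_mult_vec[OF x(1)]
    using x(1) by simp
  then have "P - c \<cdot>\<^sub>m 1\<^sub>m n = 0\<^sub>m n n" using shifted.kernel_trivial x by blast
  then have "P $$ (i, j) = (c \<cdot>\<^sub>m 1\<^sub>m n) $$ (i, j)" if "i < n" "j < n" for i j
    using that carrier_P by (auto dest!: arg_cong[where f="\<lambda>A. A $$ (i, j)"])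
  then have "P = c \<cdot>\<^sub>m 1\<^sub>m n" using carrier_P by (intro eq_matI) auto
  then show thesis by (rule that)
qed

locale fd_algebra =
  fixes m :: "('i::finite \<Rightarrow> complex) \<Rightarrow> ('i \<Rightarrow> complex) \<Rightarrow> ('i \<Rightarrow> complex)" (infixl "\<cdot>" 75)
    and one :: "'i \<Rightarrow> complex"
  assumes m_lin_left: "lin_map (\<lambda>x. x \<cdot> y)" and m_lin_right: "lin_map (\<lambda>y. x \<cdot> y)"
    and m_assoc: "x \<cdot> y \<cdot> z = x \<cdot> (y \<cdot> z)"
    and l_one: "one \<cdot> x = x" and r_one: "x \<cdot> one = x"
begin

lemma lin_map_m_left [lin_intros]: "lin_map g \<Longrightarrow> lin_map (\<lambda>x. g x \<cdot> y)"
  by (rule lin_map_comp[OF m_lin_left])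

lemma lin_map_m_right [lin_intros]: "lin_map g \<Longrightarrow> lin_map (\<lambda>x. y \<cdot> g x)"
  by (rule lin_map_comp[OF m_lin_right])

lemmas lin_form_m_left [lin_intros] = lin_form_coord[OF lin_map_m_left]

definition matrix_rep :: "nat \<Rightarrow> (('i \<Rightarrow> complex) \<Rightarrow> complex mat) \<Rightarrow> bool" where
  "matrix_rep n \<rho> \<longleftrightarrow> (\<forall>f. \<rho> f \<in> carrier_mat n n) \<and> (\<forall>f g. \<rho> (\<lambda>i. f i + g i) = \<rho> f + \<rho> g) \<and>
     (\<forall>c f. \<rho> (\<lambda>i. c * f i) = c \<cdot>\<^sub>m \<rho> f) \<and> (\<forall>f g. \<rho> (f \<cdot> g) = \<rho> f * \<rho> g) \<and> \<rho> one = 1\<^sub>m n"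

definition left_ideal :: "('i \<Rightarrow> complex) set \<Rightarrow> bool" where
  "left_ideal L \<longleftrightarrow> fun_space.subspace L \<and> (\<forall>f. \<forall>x\<in>L. f \<cdot> x \<in> L)"

definition minimal_left_ideal :: "('i \<Rightarrow> complex) set \<Rightarrow> bool" where
  "minimal_left_ideal L \<longleftrightarrow> left_ideal L \<and> L \<noteq> {\<lambda>_. 0} \<and>
     (\<forall>L'\<subseteq>L. left_ideal L' \<longrightarrow> L' = {\<lambda>_. 0} \<or> L' = L)"

lemma left_ideal_zero: "left_ideal L \<Longrightarrow> (\<lambda>_. 0) \<in> L"
  by (simp add: left_ideal_def fun_subspace_iff)

lemma minimal_left_ideal_exists:
  assumes J: "left_ideal J" "J \<noteq> {\<lambda>_. 0}"
  obtains L where "minimal_left_ideal L" "L \<subseteq> J"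
proof -
  let ?Q = "\<lambda>L. left_ideal L \<and> L \<noteq> {\<lambda>_. 0} \<and> L \<subseteq> J"
  obtain L where L: "?Q L" and least: "\<And>L'. ?Q L' \<Longrightarrow> fun_space.dim L \<le> fun_space.dim L'"
    using ex_has_least_nat[of ?Q J fun_space.dim] J by blast
  have "L' = L" if "left_ideal L'" "L' \<noteq> {\<lambda>_. 0}" "L' \<subseteq> L" for L'
    using fun_space.subspace_dim_equal[of L' L] least[of L'] L that by (auto simp: left_ideal_def)
  then have "minimal_left_ideal L" using L unfolding minimal_left_ideal_def by blast
  then show thesis using that L by blast
qed

end

locale matrix_representation = fd_algebra m one
  for m :: "('i::finite \<Rightarrow> complex) \<Rightarrow> ('i \<Rightarrow> complex) \<Rightarrow> ('i \<Rightarrow> complex)" (infixl "\<cdot>" 75) and one +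
  fixes n :: nat and \<rho> :: "('i \<Rightarrow> complex) \<Rightarrow> complex mat"
  assumes rep: "matrix_rep n \<rho>"
begin

lemma rep_carrier [simp]: "\<rho> f \<in> carrier_mat n n"
  and rep_add: "\<rho> (\<lambda>i. f i + g i) = \<rho> f + \<rho> g"
  and rep_scale: "\<rho> (\<lambda>i. c * f i) = c \<cdot>\<^sub>m \<rho> f"
  and rep_mult: "\<rho> (f \<cdot> g) = \<rho> f * \<rho> g"
  and rep_one: "\<rho> one = 1\<^sub>m n"
  using rep by (auto simp: matrix_rep_def)

lemma rep_dim [simp]: "dim_row (\<rho> f) = n" "dim_col (\<rho> f) = n"
  by (fact carrier_matD[OF rep_carrier])+

lemma rep_vec_carrier [simp]: "\<rho> f *\<^sub>v x \<in> carrier_vec n"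
  by (rule carrier_vecI) simp

lemma rep_add_vec: "x \<in> carrier_vec n \<Longrightarrow> \<rho> (\<lambda>i. f i + g i) *\<^sub>v x = \<rho> f *\<^sub>v x + \<rho> g *\<^sub>v x"
  unfolding rep_add by (rule add_mult_distrib_mat_vec[OF rep_carrier rep_carrier])

lemma rep_scale_vec: "x \<in> carrier_vec n \<Longrightarrow> \<rho> (\<lambda>i. c * f i) *\<^sub>v x = c \<cdot>\<^sub>v (\<rho> f *\<^sub>v x)"
  unfolding rep_scale by (rule eq_vecI) auto

lemma rep_mult_vec: "x \<in> carrier_vec n \<Longrightarrow> \<rho> (f \<cdot> g) *\<^sub>v x = \<rho> f *\<^sub>v (\<rho> g *\<^sub>v x)"
  unfolding rep_mult by (rule assoc_mult_mat_vec[OF rep_carrier rep_carrier])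

lemma rep_one_vec: "x \<in> carrier_vec n \<Longrightarrow> \<rho> one *\<^sub>v x = x"
  by (simp add: rep_one)

lemma lin_form_rep: "i < n \<Longrightarrow> j < n \<Longrightarrow> lin_form (\<lambda>f. \<rho> f $$ (i, j))"
  by (rule lin_formI) (simp_all add: rep_add rep_scale index_add_mat[of _ "\<rho> _"])

lemma lin_form_rep_vec: "x \<in> carrier_vec n \<Longrightarrow> i < n \<Longrightarrow> lin_form (\<lambda>f. (\<rho> f *\<^sub>v x) $ i)"
  by (rule lin_formI) (simp_all add: rep_add_vec rep_scale_vec del: index_mult_mat_vec)

lemma rep_zero_vec: "x \<in> carrier_vec n \<Longrightarrow> \<rho> (\<lambda>_. 0) *\<^sub>v x = 0\<^sub>v n"
  by (rule eq_vecI) (simp_all add: lin_form_zero[OF lin_form_rep_vec] del: index_mult_mat_vec)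

lemma irreducible_transitive:
  assumes irr: "irreducible_rep n \<rho>" and L: "left_ideal L" and x: "x \<in> carrier_vec n"
    and f: "f \<in> L" "\<rho> f *\<^sub>v x \<noteq> 0\<^sub>v n" and y: "y \<in> carrier_vec n"
  shows "\<exists>g\<in>L. \<rho> g *\<^sub>v x = y"
proof -
  let ?U = "(\<lambda>g. \<rho> g *\<^sub>v x) ` L"
  have sub: "fun_space.subspace L" and ideal: "\<And>g h. h \<in> L \<Longrightarrow> g \<cdot> h \<in> L"
    using L by (auto simp: left_ideal_def)
  have "?U = {0\<^sub>v n} \<or> ?U = carrier_vec n"
  proof (rule irreducible_repD[OF irr])
    show "?U \<subseteq> carrier_vec n" using x by auto
    show "0\<^sub>v n \<in> ?U" by (rule image_eqI[OF _ left_ideal_zero[OF L]]) (simp add: rep_zero_vec x)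
    show "y + z \<in> ?U" if "y \<in> ?U" "z \<in> ?U" for y z
      using that sub by (auto simp: fun_subspace_iff simp flip: rep_add_vec[OF x])
    show "c \<cdot>\<^sub>v y \<in> ?U" if "y \<in> ?U" for c y
      using that sub by (auto simp: fun_subspace_iff simp flip: rep_scale_vec[OF x])
    show "\<rho> g *\<^sub>v y \<in> ?U" if "y \<in> ?U" for g y
      using that ideal by (auto simp flip: rep_mult_vec[OF x])
  qed
  then have "y \<in> ?U" using f y by blast
  then show ?thesis by blast
qed

end

context fd_algebra
begin

lemma intertwiner_of_left_ideal:
  assumes \<rho>: "matrix_rep n \<rho>" and \<sigma>: "matrix_rep k \<sigma>" and L: "left_ideal L"
    and x: "x \<in> carrier_vec n" and y: "y \<in> carrier_vec k"
    and cyclic: "\<And>z. z \<in> carrier_vec n \<Longrightarrow> \<exists>f\<in>L. \<rho> f *\<^sub>v x = z"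
    and kill: "\<And>f. f \<in> L \<Longrightarrow> \<rho> f *\<^sub>v x = 0\<^sub>v n \<Longrightarrow> \<sigma> f *\<^sub>v y = 0\<^sub>v k"
  shows "\<exists>P\<in>carrier_mat k n. (\<forall>f\<in>L. \<sigma> f *\<^sub>v y = P *\<^sub>v (\<rho> f *\<^sub>v x)) \<and> (\<forall>g. \<sigma> g * P = P * \<rho> g)"
proof -
  interpret R: matrix_representation m one n \<rho> by unfold_locales (fact \<rho>)
  interpret S: matrix_representation m one k \<sigma> by unfold_locales (fact \<sigma>)
  have ideal: "\<And>g f. f \<in> L \<Longrightarrow> g \<cdot> f \<in> L" using L by (auto simp: left_ideal_def)
  have "\<exists>P\<in>carrier_mat k n. \<forall>f\<in>L. \<sigma> f *\<^sub>v y = P *\<^sub>v (\<rho> f *\<^sub>v x)"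
    by (rule linear_factorization[OF _ R.rep_vec_carrier R.lin_form_rep_vec[OF x] S.rep_vec_carrier
        S.lin_form_rep_vec[OF y] cyclic kill]) (use L in \<open>auto simp: left_ideal_def\<close>)
  then obtain P where P: "P \<in> carrier_mat k n" and factor: "\<And>f. f \<in> L \<Longrightarrow> \<sigma> f *\<^sub>v y = P *\<^sub>v (\<rho> f *\<^sub>v x)"
    by blast
  have "\<sigma> g * P = P * \<rho> g" for g
  proof (rule mat_eq_mult_vecI)
    fix z :: "complex vec" assume "z \<in> carrier_vec n"
    then obtain f where f: "f \<in> L" "\<rho> f *\<^sub>v x = z" using cyclic by blast
    have "\<sigma> g *\<^sub>v (P *\<^sub>v z) = \<sigma> (g \<cdot> f) *\<^sub>v y"
      using f(1) by (simp add: S.rep_mult_vec[OF y] factor flip: f(2))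
    also have "\<dots> = P *\<^sub>v (\<rho> g *\<^sub>v z)"
      using factor[OF ideal[OF f(1)]] by (simp add: R.rep_mult_vec[OF x] f(2))
    finally show "\<sigma> g * P *\<^sub>v z = P * \<rho> g *\<^sub>v z"
      using assoc_mult_mat_vec[OF S.rep_carrier P] assoc_mult_mat_vec[OF P R.rep_carrier] f(2) by auto
  qed (use P in \<open>auto intro: mult_carrier_mat\<close>)
  then show ?thesis using P factor by blast
qed

end

locale framed_left_ideal = fd_algebra m one
  for m :: "('i::finite \<Rightarrow> complex) \<Rightarrow> ('i \<Rightarrow> complex) \<Rightarrow> ('i \<Rightarrow> complex)" (infixl "\<cdot>" 75) and one +
  fixes L :: "('i \<Rightarrow> complex) set" and k :: nat and h :: "nat \<Rightarrow> 'i \<Rightarrow> complex" and \<kappa>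
  assumes ideal: "left_ideal L" and frame: "dual_bases L k h \<kappa>"
begin

lemma subspace: "fun_space.subspace L"
  and m_in_ideal: "x \<in> L \<Longrightarrow> f \<cdot> x \<in> L"
  using ideal by (auto simp: left_ideal_def)

lemma basis_in_ideal: "j < k \<Longrightarrow> h j \<in> L"
  and lin_form_coordinate: "lin_form (\<kappa> j)"
  and coordinate_basis: "i < k \<Longrightarrow> j < k \<Longrightarrow> \<kappa> i (h j) = (if i = j then 1 else 0)"
  and coordinate_expand: "x \<in> L \<Longrightarrow> x = (\<lambda>q. \<Sum>j<k. \<kappa> j x * h j q)"
  using frame unfolding dual_bases_def by blast+

definition emb :: "complex vec \<Rightarrow> 'i \<Rightarrow> complex" where
  "emb y = (\<lambda>q. \<Sum>j<k. y $ j * h j q)"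

definition ideal_rep :: "('i \<Rightarrow> complex) \<Rightarrow> complex mat" where
  "ideal_rep f = mat k k (\<lambda>(i, j). \<kappa> i (f \<cdot> h j))"

lemma ideal_rep_carrier [simp]: "ideal_rep f \<in> carrier_mat k k"
  by (simp add: ideal_rep_def)

lemma ideal_rep_vec_carrier [simp]: "ideal_rep f *\<^sub>v y \<in> carrier_vec k"
  by (rule carrier_vecI) (simp add: ideal_rep_def)

lemma lin_form_emb: "lin_form G \<Longrightarrow> G (emb y) = (\<Sum>j<k. y $ j * G (h j))"
  unfolding emb_def by (rule lin_form_lincomb)

lemma emb_in_ideal: "emb y \<in> L"
  unfolding emb_def by (rule fun_subspace_sum[OF subspace]) (simp add: basis_in_ideal)

lemma coordinate_emb: "i < k \<Longrightarrow> \<kappa> i (emb y) = y $ i"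
  by (simp add: lin_form_emb[OF lin_form_coordinate] coordinate_basis if_distrib[of "\<lambda>t. _ * t"]
      cong: if_cong)

lemma emb_coordinates: "x \<in> L \<Longrightarrow> emb (vec k (\<lambda>j. \<kappa> j x)) = x"
  by (subst (2) coordinate_expand) (simp_all add: emb_def)

lemma emb_inject:
  assumes "x \<in> carrier_vec k" "y \<in> carrier_vec k" "emb x = emb y"
  shows "x = y"
proof (rule eq_vecI)
  fix i assume "i < dim_vec y"
  then show "x $ i = y $ i" using coordinate_emb[of i x] coordinate_emb[of i y] assms by simp
qed (use assms in auto)

lemma emb_zero: "emb (0\<^sub>v k) = (\<lambda>_. 0)"
  by (simp add: emb_def)

lemma emb_add: "x \<in> carrier_vec k \<Longrightarrow> y \<in> carrier_vec k \<Longrightarrow> emb (x + y) = (\<lambda>q. emb x q + emb y q)"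
  by (simp add: emb_def distrib_right sum.distrib)

lemma emb_smult: "x \<in> carrier_vec k \<Longrightarrow> emb (c \<cdot>\<^sub>v x) = (\<lambda>q. c * emb x q)"
  by (rule ext) (auto simp: emb_def sum_distrib_left mult.assoc intro!: sum.cong)

lemma coordinate_m_emb:
  assumes "i < k" "y \<in> carrier_vec k"
  shows "\<kappa> i (f \<cdot> emb y) = (ideal_rep f *\<^sub>v y) $ i"
proof -
  have "lin_form (\<lambda>x. \<kappa> i (f \<cdot> x))" by (intro lin_form_comp[OF lin_form_coordinate] lin_intros)
  then have "\<kappa> i (f \<cdot> emb y) = (\<Sum>j<k. y $ j * \<kappa> i (f \<cdot> h j))" by (rule lin_form_emb)
  then show ?thesis using assms
    by (simp add: ideal_rep_def scalar_prod_def atLeast0LessThan mult.commute)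
qed

lemma emb_rep: "y \<in> carrier_vec k \<Longrightarrow> emb (ideal_rep f *\<^sub>v y) = f \<cdot> emb y"
proof -
  assume y: "y \<in> carrier_vec k"
  have "ideal_rep f *\<^sub>v y = vec k (\<lambda>i. \<kappa> i (f \<cdot> emb y))"
    by (rule eq_vecI) (simp_all add: coordinate_m_emb[OF _ y], simp_all add: ideal_rep_def)
  then show ?thesis by (simp add: emb_coordinates m_in_ideal emb_in_ideal)
qed

lemma matrix_rep_ideal: "matrix_rep k ideal_rep"
  unfolding matrix_rep_def
proof (intro conjI allI)
  note coordinate_add = lin_form_add[OF lin_form_coordinate]
    and coordinate_scale = lin_form_scale[OF lin_form_coordinate]
  fix f g :: "'i \<Rightarrow> complex" and c :: complex
  show "ideal_rep f \<in> carrier_mat k k" by simp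
  show "ideal_rep (\<lambda>i. f i + g i) = ideal_rep f + ideal_rep g"
    by (rule eq_matI) (simp_all add: ideal_rep_def lin_map_add[OF m_lin_left] coordinate_add)
  show "ideal_rep (\<lambda>i. c * f i) = c \<cdot>\<^sub>m ideal_rep f"
    by (rule eq_matI) (simp_all add: ideal_rep_def lin_map_scale[OF m_lin_left] coordinate_scale)
  show "ideal_rep (f \<cdot> g) = ideal_rep f * ideal_rep g"
  proof (rule mat_eq_mult_vecI)
    fix y :: "complex vec" assume y: "y \<in> carrier_vec k"
    have "emb (ideal_rep (f \<cdot> g) *\<^sub>v y) = emb (ideal_rep f *\<^sub>v (ideal_rep g *\<^sub>v y))"
      by (simp add: emb_rep y m_assoc)
    then have "ideal_rep (f \<cdot> g) *\<^sub>v y = ideal_rep f *\<^sub>v (ideal_rep g *\<^sub>v y)"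
      by (rule emb_inject[rotated 2]) simp_all
    then show "ideal_rep (f \<cdot> g) *\<^sub>v y = ideal_rep f * ideal_rep g *\<^sub>v y"
      by (simp add: assoc_mult_mat_vec[OF ideal_rep_carrier ideal_rep_carrier y])
  qed (rule ideal_rep_carrier, rule mult_carrier_mat[OF ideal_rep_carrier ideal_rep_carrier])
  show "ideal_rep one = 1\<^sub>m k"
    by (rule eq_matI) (simp_all add: ideal_rep_def l_one coordinate_basis)
qed

lemma left_ideal_emb_image:
  assumes U: "U \<subseteq> carrier_vec k" "0\<^sub>v k \<in> U" "\<And>x y. x \<in> U \<Longrightarrow> y \<in> U \<Longrightarrow> x + y \<in> U"
    "\<And>c x. x \<in> U \<Longrightarrow> c \<cdot>\<^sub>v x \<in> U" "\<And>f x. x \<in> U \<Longrightarrow> ideal_rep f *\<^sub>v x \<in> U"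
  shows "left_ideal (emb ` U)"
  unfolding left_ideal_def fun_subspace_iff
proof (intro conjI ballI allI)
  have carrier: "x \<in> carrier_vec k" if "x \<in> U" for x using U(1) that by blast
  show "(\<lambda>_. 0) \<in> emb ` U" using U(2) emb_zero by (metis imageI)
  show "(\<lambda>i. x i + y i) \<in> emb ` U" if "x \<in> emb ` U" "y \<in> emb ` U" for x y
    using that by (auto simp: U(3) simp flip: emb_add[OF carrier carrier])
  show "(\<lambda>i. c * x i) \<in> emb ` U" if "x \<in> emb ` U" for c x
    using that by (auto simp: U(4) simp flip: emb_smult[OF carrier])
  show "f \<cdot> x \<in> emb ` U" if "x \<in> emb ` U" for f x
    using that by (auto simp: U(5) simp flip: emb_rep[OF carrier])
qed

lemma irreducible_ideal_rep:
  assumes min: "minimal_left_ideal L"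
  shows "irreducible_rep k ideal_rep"
  unfolding irreducible_rep_def
proof (intro conjI allI impI)
  obtain x where x: "x \<in> L" "x \<noteq> (\<lambda>_. 0)"
    using min left_ideal_zero[OF ideal] by (auto simp: minimal_left_ideal_def)
  show "k > 0"
    using coordinate_expand[OF x(1)] x(2) by (cases k) auto
  fix U assume "U \<subseteq> carrier_vec k" and "0\<^sub>v k \<in> U \<and> (\<forall>x\<in>U. \<forall>y\<in>U. x + y \<in> U) \<and> (\<forall>c. \<forall>x\<in>U. c \<cdot>\<^sub>v x \<in> U) \<and>
      (\<forall>f. \<forall>x\<in>U. ideal_rep f *\<^sub>v x \<in> U)"
  then have U: "U \<subseteq> carrier_vec k" "0\<^sub>v k \<in> U" and "left_ideal (emb ` U)"
    using left_ideal_emb_image[of U] by auto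
  moreover have "emb ` U \<subseteq> L" using emb_in_ideal by blast
  ultimately consider "emb ` U = {\<lambda>_. 0}" | "emb ` U = L"
    using min unfolding minimal_left_ideal_def by blast
  then show "U = {0\<^sub>v k} \<or> U = carrier_vec k"
  proof cases
    case 1
    then have "x = 0\<^sub>v k" if "x \<in> U" for x
      using that U(1) emb_inject[of x "0\<^sub>v k"] by (auto simp: emb_zero)
    then show ?thesis using U(2) by blast
  next
    case 2
    have "y \<in> U" if y: "y \<in> carrier_vec k" for y
    proof -
      obtain x where "x \<in> U" "emb y = emb x" using 2 emb_in_ideal[of y] by blast
      then show ?thesis using emb_inject[OF y] U(1) by auto
    qed
    then show ?thesis using U(1) by blast
  qed
qed

end

locale irreducible_family = fd_algebra m one
  for m :: "('i::finite \<Rightarrow> complex) \<Rightarrow> ('i \<Rightarrow> complex) \<Rightarrow> ('i \<Rightarrow> complex)" (infixl "\<cdot>" 75) and one +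
  fixes n :: "'r \<Rightarrow> nat" and \<psi> :: "'r \<Rightarrow> ('i \<Rightarrow> complex) \<Rightarrow> complex mat"
  assumes psi_rep: "matrix_rep (n a) (\<psi> a)" and psi_irreducible: "irreducible_rep (n a) (\<psi> a)"
    and psi_inequivalent: "iso_rep (n a) (\<psi> a) (n b) (\<psi> b) \<Longrightarrow> a = b"
begin

sublocale psi: matrix_representation m one "n a" "\<psi> a" for a
  by unfold_locales (rule psi_rep)

lemma intertwiner_psi:
  "P \<in> carrier_mat (n b) (n a) \<Longrightarrow> (\<And>f. \<psi> b f * P = P * \<psi> a f) \<Longrightarrow> intertwiner (n a) (n b) (\<psi> a) (\<psi> b) P"
  by unfold_locales (auto simp: psi_irreducible)

lemma left_ideal_annihilator:
  assumes "\<And>k. k \<in> K \<Longrightarrow> x k \<in> carrier_vec (n (\<alpha> k))"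
  shows "left_ideal {f. \<forall>k\<in>K. \<psi> (\<alpha> k) f *\<^sub>v x k = 0\<^sub>v (n (\<alpha> k))}"
  unfolding left_ideal_def fun_subspace_iff using assms
  by (auto simp: psi.rep_zero_vec psi.rep_add_vec psi.rep_scale_vec psi.rep_mult_vec
      mult_mat_zero_vec[OF psi.rep_carrier])

lemma annihilator_reduction:
  assumes L: "left_ideal L" and x: "x \<in> carrier_vec (n b)" and y: "y \<in> carrier_vec (n a)"
    and kill: "\<And>f. f \<in> L \<Longrightarrow> \<psi> b f *\<^sub>v x = 0\<^sub>v (n b) \<Longrightarrow> \<psi> a f *\<^sub>v y = 0\<^sub>v (n a)"
  shows "\<exists>y'\<in>carrier_vec (n a). (\<forall>f\<in>L. \<psi> a f *\<^sub>v y' = 0\<^sub>v (n a)) \<and>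
    (\<exists>c. \<forall>i<n a. y $ i = y' $ i + (if b = a then c * x $ i else 0))"
proof (cases "\<exists>f\<in>L. \<psi> b f *\<^sub>v x \<noteq> 0\<^sub>v (n b)")
  case False
  then have "\<psi> a f *\<^sub>v y = 0\<^sub>v (n a)" if "f \<in> L" for f using kill that by blast
  then show ?thesis using y by (intro bexI[of _ y]) auto
next
  case True
  then obtain f where f: "f \<in> L" "\<psi> b f *\<^sub>v x \<noteq> 0\<^sub>v (n b)" by blast
  have cyclic: "\<exists>f\<in>L. \<psi> b f *\<^sub>v x = z" if "z \<in> carrier_vec (n b)" for z
    by (rule psi.irreducible_transitive[OF psi_irreducible L x f that])
  obtain P where P: "P \<in> carrier_mat (n a) (n b)"
    and factor: "\<And>f. f \<in> L \<Longrightarrow> \<psi> a f *\<^sub>v y = P *\<^sub>v (\<psi> b f *\<^sub>v x)"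
    and intertwines: "\<And>g. \<psi> a g * P = P * \<psi> b g"
    using intertwiner_of_left_ideal[OF psi_rep psi_rep L x y cyclic kill] by blast
  interpret intertwiner "n b" "n a" "\<psi> b" "\<psi> a" P by (rule intertwiner_psi[OF P intertwines])
  show ?thesis
  proof (cases "b = a")
    case True
    then obtain c where c: "P = c \<cdot>\<^sub>m 1\<^sub>m (n a)" using schur_scalar intertwiner_axioms by metis
    have x': "x \<in> carrier_vec (n a)" using x True by simp
    have "\<psi> a f *\<^sub>v (y - c \<cdot>\<^sub>v x) = 0\<^sub>v (n a)" if "f \<in> L" for f
      using factor[OF that] x' y True
      by (simp add: mult_minus_distrib_mat_vec[OF psi.rep_carrier] mult_mat_vec[OF psi.rep_carrier]
          c smult_one_mat_mult_vec)
    then show ?thesis using x' y True by (intro bexI[of _ "y - c \<cdot>\<^sub>v x"] conjI exI[of _ c]) auto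
  next
    case False
    then have "P = 0\<^sub>m (n a) (n b)" using schur_iso psi_inequivalent by blast
    then have "\<psi> a f *\<^sub>v y = 0\<^sub>v (n a)" if "f \<in> L" for f
      unfolding factor[OF that] by auto
    then show ?thesis using y False by (intro bexI[of _ y]) auto
  qed
qed

theorem jacobson_density:
  assumes "finite K" "\<And>k. k \<in> K \<Longrightarrow> x k \<in> carrier_vec (n (\<alpha> k))" "y \<in> carrier_vec (n a)"
    and "\<And>f. (\<And>k. k \<in> K \<Longrightarrow> \<psi> (\<alpha> k) f *\<^sub>v x k = 0\<^sub>v (n (\<alpha> k))) \<Longrightarrow> \<psi> a f *\<^sub>v y = 0\<^sub>v (n a)"
  shows "\<exists>c. \<forall>i<n a. y $ i = (\<Sum>k\<in>{k \<in> K. \<alpha> k = a}. c k * x k $ i)"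
  using assms
proof (induction K arbitrary: y)
  case empty
  have "\<psi> a one *\<^sub>v y = 0\<^sub>v (n a)" by (rule empty.prems) simp
  then show ?case by (simp add: psi.rep_one_vec[OF empty.prems(2)])
next
  case (insert k0 K)
  let ?L = "{f. \<forall>k\<in>K. \<psi> (\<alpha> k) f *\<^sub>v x k = 0\<^sub>v (n (\<alpha> k))}"
  have L: "left_ideal ?L" by (rule left_ideal_annihilator) (simp add: insert.prems(1))
  have kill: "\<psi> a f *\<^sub>v y = 0\<^sub>v (n a)" if "f \<in> ?L" "\<psi> (\<alpha> k0) f *\<^sub>v x k0 = 0\<^sub>v (n (\<alpha> k0))" for f
    by (rule insert.prems(3)) (use that in auto)
  obtain y' c0 where y': "y' \<in> carrier_vec (n a)" "\<And>f. f \<in> ?L \<Longrightarrow> \<psi> a f *\<^sub>v y' = 0\<^sub>v (n a)"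
    and diff: "\<And>i. i < n a \<Longrightarrow> y $ i = y' $ i + (if \<alpha> k0 = a then c0 * x k0 $ i else 0)"
    using annihilator_reduction[OF L insert.prems(1)[OF insertI1] insert.prems(2) kill] by blast
  obtain c where c: "\<forall>i<n a. y' $ i = (\<Sum>k\<in>{k \<in> K. \<alpha> k = a}. c k * x k $ i)"
    using insert.IH[of y'] insert.prems(1) y' by auto
  have "y $ i = (\<Sum>k\<in>{k \<in> insert k0 K. \<alpha> k = a}. (c(k0 := c0)) k * x k $ i)" if i: "i < n a" for i
  proof -
    have "(\<Sum>k\<in>{k \<in> K. \<alpha> k = a}. (c(k0 := c0)) k * x k $ i) = y' $ i"
      using c i insert.hyps(2) by (auto intro!: sum.cong)
    moreover have "{k \<in> insert k0 K. \<alpha> k = a} =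
        (if \<alpha> k0 = a then insert k0 {k \<in> K. \<alpha> k = a} else {k \<in> K. \<alpha> k = a})"
      by auto
    ultimately show ?thesis using diff[OF i] insert.hyps by simp
  qed
  then show ?case by blast
qed

end

locale semisimple_irreducible_family = irreducible_family m one n \<psi>
  for m :: "('i::finite \<Rightarrow> complex) \<Rightarrow> ('i \<Rightarrow> complex) \<Rightarrow> ('i \<Rightarrow> complex)" (infixl "\<cdot>" 75) and one
    and n :: "'r::finite \<Rightarrow> nat" and \<psi> +
  assumes psi_complete: "matrix_rep k \<rho> \<Longrightarrow> irreducible_rep k \<rho> \<Longrightarrow> \<exists>a. iso_rep k \<rho> (n a) (\<psi> a)"
    and semisimple: "semisimple_alg m one"
begin

lemma matrix_unit_exists:
  assumes i: "i < n a" and j: "j < n a"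
  obtains e where "\<And>b i' j'. i' < n b \<Longrightarrow> j' < n b \<Longrightarrow>
    \<psi> b e $$ (i', j') = (if a = b \<and> i = i' \<and> j = j' then 1 else 0)"
proof -
  let ?K = "(SIGMA b:UNIV. {..<n b}) - {(a, j)}"
    and ?e = "\<lambda>k. unit_vec (n (fst k)) (snd k) :: complex vec"
  have "\<exists>f. (\<forall>k\<in>?K. \<psi> (fst k) f *\<^sub>v ?e k = 0\<^sub>v (n (fst k))) \<and> \<psi> a f *\<^sub>v unit_vec (n a) j \<noteq> 0\<^sub>v (n a)"
  proof (rule ccontr)
    assume "\<nexists>f. (\<forall>k\<in>?K. \<psi> (fst k) f *\<^sub>v ?e k = 0\<^sub>v (n (fst k))) \<and> \<psi> a f *\<^sub>v unit_vec (n a) j \<noteq> 0\<^sub>v (n a)"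
    then obtain c where "\<forall>i<n a. unit_vec (n a) j $ i = (\<Sum>k\<in>{k \<in> ?K. fst k = a}. c k * ?e k $ i)"
      using jacobson_density[of ?K ?e fst "unit_vec (n a) j" a] by fastforce
    then have "unit_vec (n a) j $ j = (\<Sum>k\<in>{k \<in> ?K. fst k = a}. c k * ?e k $ j)" using j by blast
    also have "\<dots> = 0" using j by (intro sum.neutral) auto
    finally show False using j by simp
  qed
  then obtain f where f: "\<And>k. k \<in> ?K \<Longrightarrow> \<psi> (fst k) f *\<^sub>v ?e k = 0\<^sub>v (n (fst k))"
    and f_j: "\<psi> a f *\<^sub>v unit_vec (n a) j \<noteq> 0\<^sub>v (n a)" by blast
  define y where "y = \<psi> a f *\<^sub>v unit_vec (n a) j"
  have "\<exists>g\<in>UNIV. \<psi> a g *\<^sub>v y = unit_vec (n a) i"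
  proof (rule psi.irreducible_transitive[OF psi_irreducible])
    show "left_ideal UNIV" by (simp add: left_ideal_def)
    show "y \<in> carrier_vec (n a)" "unit_vec (n a) i \<in> carrier_vec (n a)" by (simp_all add: y_def)
    then show "\<psi> a one *\<^sub>v y \<noteq> 0\<^sub>v (n a)" using f_j by (simp add: psi.rep_one_vec y_def)
  qed simp
  then obtain g where g: "\<psi> a g *\<^sub>v (\<psi> a f *\<^sub>v unit_vec (n a) j) = unit_vec (n a) i"
    by (auto simp: y_def)
  have "\<psi> b (g \<cdot> f) $$ (i', j') = (if a = b \<and> i = i' \<and> j = j' then 1 else 0)"
    if "i' < n b" "j' < n b" for b i' j'
  proof -
    have "\<psi> b (g \<cdot> f) $$ (i', j') = (\<psi> b (g \<cdot> f) *\<^sub>v unit_vec (n b) j') $ i'"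
      by (subst mult_mat_unit_vec[OF psi.rep_carrier that(2)]) (use that in simp)
    also have "\<psi> b (g \<cdot> f) *\<^sub>v unit_vec (n b) j' = \<psi> b g *\<^sub>v (\<psi> b f *\<^sub>v unit_vec (n b) j')"
      by (rule psi.rep_mult_vec[OF unit_vec_carrier])
    also have "\<psi> b g *\<^sub>v (\<psi> b f *\<^sub>v unit_vec (n b) j') =
        (if a = b \<and> j = j' then unit_vec (n a) i else 0\<^sub>v (n b))"
      using f[of "(b, j')"] g that by (auto simp: mult_mat_zero_vec[OF psi.rep_carrier])
    finally show ?thesis using that i by auto
  qed
  then show thesis by (rule that)
qed

lemma minimal_left_ideal_killed:
  assumes L: "minimal_left_ideal L" and f: "\<And>a. \<psi> a f = 0\<^sub>m (n a) (n a)" and x: "x \<in> L"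
  shows "f \<cdot> x = (\<lambda>_. 0)"
proof -
  have ideal: "left_ideal L" using L by (simp add: minimal_left_ideal_def)
  then obtain k h \<kappa> where "dual_bases L k h \<kappa>"
    using subspace_dual_bases unfolding left_ideal_def by blast
  then interpret framed_left_ideal m one L k h \<kappa> using ideal by unfold_locales
  obtain a where "iso_rep k ideal_rep (n a) (\<psi> a)"
    using psi_complete[OF matrix_rep_ideal irreducible_ideal_rep[OF L]] by blast
  then obtain P where k: "k = n a" and P: "P \<in> carrier_mat k k" "invertible_mat P"
    and iso: "ideal_rep f * P = P * \<psi> a f"
    unfolding iso_rep_def by blast
  obtain Q where Q: "Q \<in> carrier_mat k k" "P * Q = 1\<^sub>m k"
    using invertible_mat_inverse[OF P] by metis
  have "ideal_rep f = ideal_rep f * P * Q"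
    by (simp add: assoc_mult_mat[OF ideal_rep_carrier P(1) Q(1)] Q(2)
        right_mult_one_mat[OF ideal_rep_carrier])
  also have "\<dots> = 0\<^sub>m k k" unfolding iso f k[symmetric] using P(1) Q(1) by simp
  finally have rep_f: "ideal_rep f = 0\<^sub>m k k" .
  define y where "y = vec k (\<lambda>j. \<kappa> j x)"
  have y: "y \<in> carrier_vec k" "emb y = x" by (simp_all add: y_def emb_coordinates x)
  have "f \<cdot> x = emb (ideal_rep f *\<^sub>v y)" by (simp only: emb_rep y)
  also have "ideal_rep f *\<^sub>v y = 0\<^sub>v k" unfolding rep_f using y(1) by (intro eq_vecI) auto
  finally show ?thesis by (simp only: emb_zero)
qed

definition kernel :: "('i \<Rightarrow> complex) set" where
  "kernel = {f. \<forall>a. \<psi> a f = 0\<^sub>m (n a) (n a)}"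

lemma kernel_ideal: "left_ideal kernel" and kernel_m_right: "f \<in> kernel \<Longrightarrow> f \<cdot> g \<in> kernel"
proof -
  have "\<psi> a (\<lambda>_. 0) = 0\<^sub>m (n a) (n a)" for a
    by (rule mat_eq_mult_vecI[OF psi.rep_carrier]) (auto simp: psi.rep_zero_vec)
  then show "left_ideal kernel"
    by (simp add: left_ideal_def fun_subspace_iff kernel_def psi.rep_add psi.rep_scale psi.rep_mult)
  show "f \<cdot> g \<in> kernel" if "f \<in> kernel"
    using that by (simp add: kernel_def psi.rep_mult)
qed

text \<open>The kernel \<open>J\<close> kills every minimal left ideal contained in it, so \<open>{x \<in> J. J x = 0}\<close> is nonzero if \<open>J\<close>
is; but this ideal squares to zero.\<close>

lemma kernel_trivial: "kernel = {\<lambda>_. 0}"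
proof (rule ccontr)
  assume "kernel \<noteq> {\<lambda>_. 0}"
  then obtain L where L: "minimal_left_ideal L" "L \<subseteq> kernel"
    by (rule minimal_left_ideal_exists[OF kernel_ideal])
  let ?I = "{x \<in> kernel. \<forall>g\<in>kernel. g \<cdot> x = (\<lambda>_. 0)}"
  have "alg_ideal m ?I"
    using kernel_ideal unfolding alg_ideal_def left_ideal_def fun_subspace_iff
    by (simp add: lin_map_zero[OF m_lin_right] lin_map_add[OF m_lin_right] lin_map_scale[OF m_lin_right]
        lin_map_zero[OF m_lin_left] kernel_m_right flip: m_assoc)
  moreover have "nilpotent_ideal m one ?I"
    unfolding nilpotent_ideal_def
    by (intro exI[of _ 2]) (auto simp: numeral_2_eq_2 length_Suc_conv r_one)
  ultimately have "?I = {\<lambda>_. 0}" using semisimple unfolding semisimple_alg_def by blast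
  moreover have "L \<subseteq> ?I" using minimal_left_ideal_killed[OF L(1)] L(2) by (auto simp: kernel_def)
  ultimately have "L = {\<lambda>_. 0}" using L(1) left_ideal_zero[of L] by (auto simp: minimal_left_ideal_def)
  then show False using L(1) by (simp add: minimal_left_ideal_def)
qed

lemma psi_inject:
  assumes "\<And>a. \<psi> a f = \<psi> a g"
  shows "f = g"
proof -
  have "\<psi> a (\<lambda>i. f i + (-1) * g i) = 0\<^sub>m (n a) (n a)" for a
    unfolding psi.rep_add[of _ f "\<lambda>i. (-1) * g i"] psi.rep_scale assms by (rule eq_matI) simp_all
  then have "(\<lambda>i. f i + (-1) * g i) \<in> kernel" by (simp only: kernel_def mem_Collect_eq) blast
  then show ?thesis by (auto simp: kernel_trivial fun_eq_iff)
qed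

end

section \<open>Weak Hopf algebras\<close>

locale coproduct =
  fixes \<Delta> :: "('i::finite \<Rightarrow> complex) \<Rightarrow> 'i \<times> 'i \<Rightarrow> complex"
  assumes lin_form_\<Delta>: "lin_form (\<lambda>x. \<Delta> x p)"
begin

abbreviation sw :: "('i \<Rightarrow> complex) \<Rightarrow> (('i \<Rightarrow> complex) \<Rightarrow> ('i \<Rightarrow> complex) \<Rightarrow> complex) \<Rightarrow> complex" where
  "sw \<equiv> sweedler \<Delta>"

lemma lin_form_sw [lin_intros]: "lin_map g \<Longrightarrow> lin_form (\<lambda>x. sw (g x) K)"
  unfolding sweedler_def by (intro lin_form_setsum lin_form_mult_const lin_form_comp[OF lin_form_\<Delta>])

end

locale weak_hopf = fd_algebra m one + coproduct \<Delta>
  for m :: "('i::finite \<Rightarrow> complex) \<Rightarrow> ('i \<Rightarrow> complex) \<Rightarrow> ('i \<Rightarrow> complex)" (infixl "\<cdot>" 75) and one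
    and \<Delta> :: "('i \<Rightarrow> complex) \<Rightarrow> 'i \<times> 'i \<Rightarrow> complex" +
  fixes \<epsilon> :: "('i \<Rightarrow> complex) \<Rightarrow> complex" and S :: "('i \<Rightarrow> complex) \<Rightarrow> ('i \<Rightarrow> complex)"
  assumes lin_form_\<epsilon>: "lin_form \<epsilon>" and lin_map_S: "lin_map S"
    and coassoc_coord: "sw x (\<lambda>a b. sw a (\<lambda>c d. c i * d j * b k)) =
        sw x (\<lambda>a b. sw b (\<lambda>c d. a i * c j * d k))"
    and counit_left_coord: "sw x (\<lambda>a b. \<epsilon> a * b i) = x i"
    and counit_right_coord: "sw x (\<lambda>a b. a i * \<epsilon> b) = x i"
    and sw_m_coord: "sw (x \<cdot> y) (\<lambda>a b. a i * b j) = sw x (\<lambda>a b. sw y (\<lambda>c d. (a \<cdot> c) i * (b \<cdot> d) j))"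
    and sw_one_coord: "sw one (\<lambda>a b. sw b (\<lambda>c d. a i * c j * d k)) =
        sw one (\<lambda>a b. sw one (\<lambda>c d. a i * (b \<cdot> c) j * d k))"
    and sw_one_coord': "sw one (\<lambda>a b. sw b (\<lambda>c d. a i * c j * d k)) =
        sw one (\<lambda>a b. sw one (\<lambda>c d. a i * (c \<cdot> b) j * d k))"
    and counit_m: "\<epsilon> (x \<cdot> y \<cdot> z) = sw y (\<lambda>a b. \<epsilon> (x \<cdot> a) * \<epsilon> (b \<cdot> z))"
    and counit_m': "\<epsilon> (x \<cdot> y \<cdot> z) = sw y (\<lambda>a b. \<epsilon> (x \<cdot> b) * \<epsilon> (a \<cdot> z))"
    and antipode_left_coord: "sw x (\<lambda>a b. (S a \<cdot> b) i) = sw one (\<lambda>a b. \<epsilon> (x \<cdot> b) * a i)"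
    and antipode_right_coord: "sw x (\<lambda>a b. (a \<cdot> S b) i) = sw one (\<lambda>a b. \<epsilon> (a \<cdot> x) * b i)"
    and antipode_middle_coord: "sw x (\<lambda>a b. sw a (\<lambda>c d. (S c \<cdot> d \<cdot> S b) i)) = S x i"
begin

lemma lin_map_S_comp [lin_intros]: "lin_map g \<Longrightarrow> lin_map (\<lambda>x. S (g x))"
  by (rule lin_map_comp[OF lin_map_S])

lemma lin_form_\<epsilon>_comp [lin_intros]: "lin_map g \<Longrightarrow> lin_form (\<lambda>x. \<epsilon> (g x))"
  by (rule lin_form_comp[OF lin_form_\<epsilon>])

text \<open>Coassociativity holds for arbitrary \<open>F\<close> because a Sweedler sum evaluates \<open>F\<close> on basis vectors only.\<close>

lemma coassoc: "sw x (\<lambda>a b. sw a (\<lambda>c d. F c d b)) = sw x (\<lambda>a b. sw b (\<lambda>c d. F a c d))"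
proof -
  define F' where "F' x y z =
    (\<Sum>i\<in>UNIV. \<Sum>j\<in>UNIV. \<Sum>k\<in>UNIV. F (bas i) (bas j) (bas k) * (x i * y j * z k))" for x y z
  have F': "F (bas i) (bas j) (bas k) = F' (bas i) (bas j) (bas k)" for i j k
    by (simp add: F'_def mult.assoc[symmetric])
  have "sw x (\<lambda>a b. sw a (\<lambda>c d. F' c d b)) = sw x (\<lambda>a b. sw b (\<lambda>c d. F' a c d))"
    by (simp add: F'_def sweedler_sum sweedler_mult_left coassoc_coord)
  then show ?thesis by (simp add: sweedler_def F')
qed

lemma counit_left: "lin_form G \<Longrightarrow> sw x (\<lambda>a b. \<epsilon> a * G b) = G x"
  using sweedler_lin_form[of G \<Delta> x "\<lambda>a b. \<epsilon> a" "\<lambda>a b. b"]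
  by (simp add: counit_left_coord lin_form_expand[of G x])

lemma counit_right: "lin_form G \<Longrightarrow> sw x (\<lambda>a b. G a * \<epsilon> b) = G x"
  using sweedler_lin_form[of G \<Delta> x "\<lambda>a b. \<epsilon> b" "\<lambda>a b. a"]
  by (simp add: counit_right_coord mult.commute[of "\<epsilon> _"] lin_form_expand[of G x])

lemma sw_m:
  assumes K: "bilin_form K"
  shows "sw (x \<cdot> y) K = sw x (\<lambda>a b. sw y (\<lambda>c d. K (a \<cdot> c) (b \<cdot> d)))"
  using sweedler_bilin_form[OF K, of \<Delta> "x \<cdot> y" "\<lambda>a b. a" "\<lambda>a b. b"]
  by (simp add: sw_m_coord sweedler_bilin_form[OF K] sweedler_sum sweedler_mult_left)

lemma sw_one_trilin_form:
  assumes F: "trilin_form F"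
  shows "sw one (\<lambda>a b. sw (e a b) (\<lambda>c d. F (f a b c d) (g a b c d) (h a b c d))) =
    (\<Sum>i\<in>UNIV. \<Sum>j\<in>UNIV. \<Sum>k\<in>UNIV. F (bas i) (bas j) (bas k) *
      sw one (\<lambda>a b. sw (e a b) (\<lambda>c d. f a b c d i * g a b c d j * h a b c d k)))"
  by (simp add: trilin_form_expand[OF F, of "f _ _ _ _"] sweedler_sum sweedler_mult_left)

lemma sw_one:
  assumes F: "trilin_form F"
  shows "sw one (\<lambda>a b. sw b (\<lambda>c d. F a c d)) = sw one (\<lambda>a b. sw one (\<lambda>c d. F a (b \<cdot> c) d))"
    and "sw one (\<lambda>a b. sw b (\<lambda>c d. F a c d)) = sw one (\<lambda>a b. sw one (\<lambda>c d. F a (c \<cdot> b) d))"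
  unfolding sw_one_trilin_form[OF F] by (simp only: sw_one_coord, simp only: sw_one_coord')

text \<open>The counital maps onto the target and the source subalgebra.\<close>

definition eps_t :: "('i \<Rightarrow> complex) \<Rightarrow> ('i \<Rightarrow> complex)" where
  "eps_t x = (\<lambda>i. sw one (\<lambda>a b. \<epsilon> (a \<cdot> x) * b i))"

definition eps_s :: "('i \<Rightarrow> complex) \<Rightarrow> ('i \<Rightarrow> complex)" where
  "eps_s x = (\<lambda>i. sw one (\<lambda>a b. \<epsilon> (x \<cdot> b) * a i))"

lemma opposite: "weak_hopf (\<lambda>x y. y \<cdot> x) one (coopposite \<Delta>) \<epsilon> S"
proof (unfold_locales, unfold sweedler_coopposite)
  show "lin_map (\<lambda>x. y \<cdot> x)" "lin_map (\<lambda>y. y \<cdot> x)" for x y by (intro lin_intros)+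
  show "lin_form (\<lambda>x. coopposite \<Delta> x p)" for p
    by (cases p) (simp add: coopposite_def lin_form_\<Delta>)
  show "lin_form \<epsilon>" "lin_map S" by (fact lin_form_\<epsilon> lin_map_S)+
  show "sw x (\<lambda>a b. sw b (\<lambda>c d. d i * c j * a k)) = sw x (\<lambda>a b. sw a (\<lambda>c d. b i * d j * c k))"
      for x i j k
    using coassoc[of x "\<lambda>a b c. c i * b j * a k"] by simp
  show "sw x (\<lambda>a b. \<epsilon> b * a i) = x i" "sw x (\<lambda>a b. b i * \<epsilon> a) = x i" for x i
    using counit_left_coord[of x i] counit_right_coord[of x i] by (simp_all add: mult.commute)
  show "sw (y \<cdot> x) (\<lambda>a b. b i * a j) = sw x (\<lambda>a b. sw y (\<lambda>c d. (d \<cdot> b) i * (c \<cdot> a) j))" for x y i j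
    by (subst sw_m, intro lin_intros, rule sweedler_swap)
  show "sw one (\<lambda>a b. sw a (\<lambda>c d. b i * d j * c k)) =
      sw one (\<lambda>a b. sw one (\<lambda>c d. b i * (d \<cdot> a) j * c k))" for i j k
    unfolding coassoc[of one "\<lambda>c d b. b i * d j * c k"]
    by (subst sw_one(1), intro lin_intros, rule sweedler_swap)
  show "sw one (\<lambda>a b. sw a (\<lambda>c d. b i * d j * c k)) =
      sw one (\<lambda>a b. sw one (\<lambda>c d. b i * (a \<cdot> d) j * c k))" for i j k
    unfolding coassoc[of one "\<lambda>c d b. b i * d j * c k"]
    by (subst sw_one(2), intro lin_intros, rule sweedler_swap)
  show "\<epsilon> (z \<cdot> (y \<cdot> x)) = sw y (\<lambda>a b. \<epsilon> (b \<cdot> x) * \<epsilon> (z \<cdot> a))" for x y z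
    using counit_m[of z y x] by (simp add: m_assoc mult.commute)
  show "\<epsilon> (z \<cdot> (y \<cdot> x)) = sw y (\<lambda>a b. \<epsilon> (a \<cdot> x) * \<epsilon> (z \<cdot> b))" for x y z
    using counit_m'[of z y x] by (simp add: m_assoc mult.commute)
  show "sw x (\<lambda>a b. (a \<cdot> S b) i) = sw one (\<lambda>a b. \<epsilon> (a \<cdot> x) * b i)" for x i
    by (fact antipode_right_coord)
  show "sw x (\<lambda>a b. (S a \<cdot> b) i) = sw one (\<lambda>a b. \<epsilon> (x \<cdot> b) * a i)" for x i by (fact antipode_left_coord)
  show "sw x (\<lambda>a b. sw b (\<lambda>c d. (S a \<cdot> (c \<cdot> S d)) i)) = S x i" for x i
    using antipode_middle_coord[of x i] coassoc[of x "\<lambda>a b c. (S a \<cdot> b \<cdot> S c) i"] by (simp add: m_assoc)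
qed (simp_all add: m_assoc l_one r_one)

lemma opposite_eps: "weak_hopf.eps_t (\<lambda>x y. y \<cdot> x) one (coopposite \<Delta>) \<epsilon> = eps_s"
    "weak_hopf.eps_s (\<lambda>x y. y \<cdot> x) one (coopposite \<Delta>) \<epsilon> = eps_t"
  unfolding fun_eq_iff weak_hopf.eps_t_def[OF opposite] weak_hopf.eps_s_def[OF opposite]
  by (simp_all add: sweedler_coopposite eps_t_def eps_s_def)

lemma lin_form_eps_t: "lin_form G \<Longrightarrow> G (eps_t x) = sw one (\<lambda>a b. \<epsilon> (a \<cdot> x) * G b)"
  unfolding eps_t_def by (rule lin_form_sweedler_vector)

lemma lin_form_eps_s: "lin_form G \<Longrightarrow> G (eps_s x) = sw one (\<lambda>a b. \<epsilon> (x \<cdot> b) * G a)"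
  unfolding eps_s_def by (rule lin_form_sweedler_vector)

lemma lin_map_eps_t [lin_intros]: "lin_map g \<Longrightarrow> lin_map (\<lambda>x. eps_t (g x))"
  unfolding eps_t_def by (rule lin_mapI) (intro lin_intros, assumption)

lemma lin_map_eps_s [lin_intros]: "lin_map g \<Longrightarrow> lin_map (\<lambda>x. eps_s (g x))"
  unfolding eps_s_def by (rule lin_mapI) (intro lin_intros, assumption)

lemmas lin_form_eps_s_coord [lin_intros] = lin_form_coord[OF lin_map_eps_s]

lemma sw_m_S: "lin_form G \<Longrightarrow> sw x (\<lambda>a b. G (a \<cdot> S b)) = G (eps_t x)"
  using sweedler_lin_form[of G \<Delta> x "\<lambda>a b. 1" "\<lambda>a b. a \<cdot> S b"]
  by (simp add: antipode_right_coord lin_form_expand[of G "eps_t x"]) (simp add: eps_t_def)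

lemma sw_S_m: "lin_form G \<Longrightarrow> sw x (\<lambda>a b. G (S a \<cdot> b)) = G (eps_s x)"
  using weak_hopf.sw_m_S[OF opposite, of G x] by (simp add: sweedler_coopposite opposite_eps)

lemma sw_S_m_S:
  assumes "lin_form G"
  shows "sw x (\<lambda>a b. sw b (\<lambda>c d. G (S a \<cdot> c \<cdot> S d))) = G (S x)"
proof -
  have "sw x (\<lambda>a b. sw a (\<lambda>c d. G (S c \<cdot> d \<cdot> S b))) =
      (\<Sum>i\<in>UNIV. G (bas i) * sw x (\<lambda>a b. sw a (\<lambda>c d. (S c \<cdot> d \<cdot> S b) i)))"
    by (simp add: lin_form_expand[OF assms, of "_ \<cdot> _"] sweedler_sum sweedler_mult_left)
  then show ?thesis
    by (simp add: antipode_middle_coord lin_form_expand[OF assms, of "S x"]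
        coassoc[of x "\<lambda>c d b. G (S c \<cdot> d \<cdot> S b)"])
qed

lemma sw_one_m:
  "bilin_form K \<Longrightarrow> sw one (\<lambda>a b. sw x (\<lambda>c d. K (a \<cdot> c) (b \<cdot> d))) = sw x K"
  using sw_m[of K one x] by (simp add: l_one)

lemma sw_m_one:
  "bilin_form K \<Longrightarrow> sw x (\<lambda>a b. sw one (\<lambda>c d. K (a \<cdot> c) (b \<cdot> d))) = sw x K"
  using sw_m[of K x one] by (simp add: r_one)

lemma sw_eps_t:
  assumes K: "bilin_form K"
  shows "sw (eps_t y) K = sw one (\<lambda>a b. K (a \<cdot> eps_t y) b)"
    and "sw (eps_t y) K = sw one (\<lambda>a b. K (eps_t y \<cdot> a) b)"
proof -
  note linear = lin_intros bilin_form_comp[OF K]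
  have split: "sw (eps_t y) K = sw one (\<lambda>a b. sw b (\<lambda>c d. \<epsilon> (a \<cdot> y) * K c d))"
    unfolding sweedler_mult_left by (rule lin_form_eps_t) (intro linear)
  also have "\<dots> = sw one (\<lambda>a b. sw one (\<lambda>c d. \<epsilon> (a \<cdot> y) * K (c \<cdot> b) d))"
    by (rule sw_one) (intro linear)
  also have "\<dots> = sw one (\<lambda>c d. sw one (\<lambda>a b. \<epsilon> (a \<cdot> y) * K (c \<cdot> b) d))"
    by (rule sweedler_swap)
  also have "\<dots> = sw one (\<lambda>c d. K (c \<cdot> eps_t y) d)"
    by (intro sweedler_cong lin_form_eps_t[symmetric] linear)
  finally show "sw (eps_t y) K = sw one (\<lambda>a b. K (a \<cdot> eps_t y) b)" .
  note split
  also have "sw one (\<lambda>a b. sw b (\<lambda>c d. \<epsilon> (a \<cdot> y) * K c d)) =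
      sw one (\<lambda>a b. sw one (\<lambda>c d. \<epsilon> (a \<cdot> y) * K (b \<cdot> c) d))"
    by (rule sw_one) (intro linear)
  also have "\<dots> = sw one (\<lambda>c d. sw one (\<lambda>a b. \<epsilon> (a \<cdot> y) * K (b \<cdot> c) d))"
    by (rule sweedler_swap)
  also have "\<dots> = sw one (\<lambda>c d. K (eps_t y \<cdot> c) d)"
    by (intro sweedler_cong lin_form_eps_t[symmetric] linear)
  finally show "sw (eps_t y) K = sw one (\<lambda>a b. K (eps_t y \<cdot> a) b)" .
qed

lemma sw_eps_s:
  assumes K: "bilin_form K"
  shows "sw (eps_s y) K = sw one (\<lambda>a b. K a (eps_s y \<cdot> b))"
    and "sw (eps_s y) K = sw one (\<lambda>a b. K a (b \<cdot> eps_s y))"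
  using weak_hopf.sw_eps_t[OF opposite bilin_form_flip[OF K]]
  by (simp_all add: sweedler_coopposite opposite_eps)

lemma counit_m_eps_t: "\<epsilon> (x \<cdot> eps_t y) = \<epsilon> (x \<cdot> y)"
proof -
  have "\<epsilon> (x \<cdot> eps_t y) = sw one (\<lambda>a b. \<epsilon> (a \<cdot> y) * \<epsilon> (x \<cdot> b))"
    by (rule lin_form_eps_t) (intro lin_intros)
  also have "\<dots> = \<epsilon> (x \<cdot> one \<cdot> y)"
    by (subst counit_m') (simp add: mult.commute)
  finally show ?thesis by (simp add: r_one)
qed

lemma eps_t_m_eps_t: "eps_t (x \<cdot> eps_t y) = eps_t (x \<cdot> y)"
  unfolding eps_t_def[of "x \<cdot> _"] m_assoc[symmetric] counit_m_eps_t ..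

lemma eps_t_eps_t: "eps_t (eps_t y) = eps_t y"
  using eps_t_m_eps_t[of one y] by (simp add: l_one)

lemma eps_t_one: "eps_t one = one"
  by (rule eq_lin_formI) (simp add: lin_form_eps_t r_one counit_left)

lemma eps_s_one: "eps_s one = one"
  using weak_hopf.eps_t_one[OF opposite] by (simp add: opposite_eps)

lemma eps_s_eps_t_commute: "eps_s x \<cdot> eps_t y = eps_t y \<cdot> eps_s x"
proof (rule eq_lin_formI)
  fix G :: "('i \<Rightarrow> complex) \<Rightarrow> complex" assume G: "lin_form G"
  note linear = lin_intros lin_form_comp[OF G]
  have "G (eps_s x \<cdot> eps_t y) = sw one (\<lambda>a b. \<epsilon> (x \<cdot> b) * G (a \<cdot> eps_t y))"
    by (rule lin_form_eps_s) (intro linear)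
  also have "\<dots> = sw (eps_t y) (\<lambda>a b. \<epsilon> (x \<cdot> b) * G a)"
    by (rule sw_eps_t(1)[symmetric]) (intro linear)
  also have "\<dots> = sw one (\<lambda>a b. \<epsilon> (x \<cdot> b) * G (eps_t y \<cdot> a))"
    by (rule sw_eps_t(2)) (intro linear)
  also have "\<dots> = G (eps_t y \<cdot> eps_s x)"
    by (rule lin_form_eps_s[symmetric]) (intro linear)
  finally show "G (eps_s x \<cdot> eps_t y) = G (eps_t y \<cdot> eps_s x)" .
qed

lemma sw_eps_t_second:
  assumes K: "bilin_form K"
  shows "sw x (\<lambda>a b. K a (eps_t b)) = sw one (\<lambda>a b. K (a \<cdot> x) b)"
proof -
  note linear = lin_intros bilin_form_comp[OF K]
  have "sw one (\<lambda>a b. K (a \<cdot> x) b) = sw one (\<lambda>a b. sw (a \<cdot> x) (\<lambda>c d. K c b * \<epsilon> d))"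
    by (intro sweedler_cong counit_right[symmetric] linear)
  also have "\<dots> = sw one (\<lambda>a b. sw a (\<lambda>c d. sw x (\<lambda>y z. K (c \<cdot> y) b * \<epsilon> (d \<cdot> z))))"
    by (intro sweedler_cong sw_m linear)
  also have "\<dots> = sw one (\<lambda>a b. sw b (\<lambda>c d. sw x (\<lambda>y z. K (a \<cdot> y) d * \<epsilon> (c \<cdot> z))))"
    by (rule coassoc)
  also have "\<dots> = sw one (\<lambda>a b. sw one (\<lambda>c d. sw x (\<lambda>y z. K (a \<cdot> y) d * \<epsilon> (c \<cdot> b \<cdot> z))))"
    by (rule sw_one) (intro linear)
  also have "\<dots> = sw one (\<lambda>c d. sw one (\<lambda>a b. sw x (\<lambda>y z. K (a \<cdot> y) d * \<epsilon> (c \<cdot> (b \<cdot> z)))))"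
    by (subst sweedler_swap) (simp add: m_assoc)
  also have "\<dots> = sw one (\<lambda>c d. sw x (\<lambda>y z. K y d * \<epsilon> (c \<cdot> z)))"
    by (intro sweedler_cong sw_one_m linear)
  also have "\<dots> = sw x (\<lambda>y z. sw one (\<lambda>c d. \<epsilon> (c \<cdot> z) * K y d))"
    by (subst sweedler_swap) (simp add: mult.commute)
  also have "\<dots> = sw x (\<lambda>y z. K y (eps_t z))"
    by (intro sweedler_cong lin_form_eps_t[symmetric] linear)
  finally show ?thesis by simp
qed

lemma sw_eps_s_first:
  "bilin_form K \<Longrightarrow> sw x (\<lambda>a b. K (eps_s a) b) = sw one (\<lambda>a b. K a (x \<cdot> b))"
  using weak_hopf.sw_eps_t_second[OF opposite bilin_form_flip]
  by (simp add: sweedler_coopposite opposite_eps)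

lemma sw_one_eps_s: "bilin_form K \<Longrightarrow> sw one (\<lambda>a b. K (eps_s a) b) = sw one K"
  by (simp add: sw_eps_s_first l_one)

lemma sw_one_eps_t: "bilin_form K \<Longrightarrow> sw one (\<lambda>a b. K a (eps_t b)) = sw one K"
  by (simp add: sw_eps_t_second r_one)

lemma S_eps_s: "S (eps_s x) = eps_t (eps_s x)"
proof (rule eq_lin_formI)
  fix G :: "('i \<Rightarrow> complex) \<Rightarrow> complex" assume G: "lin_form G"
  note linear = lin_intros lin_form_comp[OF G]
  have "G (eps_t (eps_s x)) = sw (eps_s x) (\<lambda>a b. G (a \<cdot> S b))"
    by (rule sw_m_S[OF G, symmetric])
  also have "\<dots> = sw one (\<lambda>a b. G (a \<cdot> S (eps_s x \<cdot> b)))"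
    by (rule sw_eps_s) (intro linear)
  also have "\<dots> = sw (eps_s x) (\<lambda>a b. G (eps_s a \<cdot> S b))"
    by (rule sw_eps_s_first[symmetric]) (intro linear)
  also have "\<dots> = sw (eps_s x) (\<lambda>a b. sw a (\<lambda>c d. G (S c \<cdot> d \<cdot> S b)))"
    by (intro sweedler_cong sw_S_m[symmetric] linear)
  also have "\<dots> = sw (eps_s x) (\<lambda>a b. sw b (\<lambda>c d. G (S a \<cdot> c \<cdot> S d)))"
    by (rule coassoc)
  also have "\<dots> = G (S (eps_s x))"
    by (rule sw_S_m_S[OF G])
  finally show "G (S (eps_s x)) = G (eps_t (eps_s x))" ..
qed

lemma S_eps_t: "S (eps_t x) = eps_s (eps_t x)"
  using weak_hopf.S_eps_s[OF opposite, of x] by (simp add: opposite_eps)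

lemma S_one: "S one = one"
  using S_eps_t[of one] by (simp add: eps_t_one eps_s_one)

lemma sw_one_m_second:
  assumes K: "bilin_form K"
  shows "sw one (\<lambda>a b. K a (b \<cdot> x)) = sw x (\<lambda>y z. sw one (\<lambda>a b. K a z * \<epsilon> (b \<cdot> y)))"
proof -
  note linear = lin_intros bilin_form_comp[OF K]
  have "sw one (\<lambda>a b. K a (b \<cdot> x)) = sw one (\<lambda>a b. sw (b \<cdot> x) (\<lambda>c d. \<epsilon> c * K a d))"
    by (intro sweedler_cong counit_left[symmetric] linear)
  also have "\<dots> = sw one (\<lambda>a b. sw b (\<lambda>c d. sw x (\<lambda>y z. \<epsilon> (c \<cdot> y) * K a (d \<cdot> z))))"
    by (intro sweedler_cong sw_m linear)
  also have "\<dots> = sw one (\<lambda>a b. sw one (\<lambda>c d. sw x (\<lambda>y z. \<epsilon> (b \<cdot> c \<cdot> y) * K a (d \<cdot> z))))"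
    by (rule sw_one) (intro linear)
  also have "\<dots> = sw one (\<lambda>a b. sw x (\<lambda>y z. \<epsilon> (b \<cdot> y) * K a z))"
    unfolding m_assoc by (intro sweedler_cong sw_one_m linear)
  also have "\<dots> = sw x (\<lambda>y z. sw one (\<lambda>a b. K a z * \<epsilon> (b \<cdot> y)))"
    by (subst sweedler_swap) (simp add: mult.commute)
  finally show ?thesis .
qed

lemma sw_eps_t_first:
  assumes K: "bilin_form K"
  shows "sw x (\<lambda>a b. K (eps_t a) b) = sw one (\<lambda>a b. K (S a) (b \<cdot> x))"
proof -
  note linear = lin_intros bilin_form_comp[OF K]
  have "sw one (\<lambda>a b. K (S a) (b \<cdot> x)) = sw one (\<lambda>a b. K (eps_t (eps_s a)) (b \<cdot> x))"
    unfolding S_eps_s[symmetric] by (rule sw_one_eps_s[symmetric]) (intro linear)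
  also have "\<dots> = sw one (\<lambda>a b. K (eps_t a) (b \<cdot> x))"
    by (rule sw_one_eps_s) (intro linear)
  also have "\<dots> = sw x (\<lambda>y z. sw one (\<lambda>a b. K (eps_t a) z * \<epsilon> (b \<cdot> y)))"
    by (rule sw_one_m_second) (intro linear)
  also have "\<dots> = sw x (\<lambda>y z. sw one (\<lambda>a b. sw one (\<lambda>c d. \<epsilon> (c \<cdot> a) * K d z) * \<epsilon> (b \<cdot> y)))"
    by (intro sweedler_cong arg_cong[where f="\<lambda>z. z * _"] lin_form_eps_t linear)
  also have "\<dots> = sw x (\<lambda>y z. sw one (\<lambda>a b. sw one (\<lambda>c d. K d z * (\<epsilon> (c \<cdot> a) * \<epsilon> (b \<cdot> y)))))"
    unfolding sweedler_mult_right[symmetric] by (simp add: mult_ac)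
  also have "\<dots> = sw x (\<lambda>y z. sw one (\<lambda>c d. K d z * sw one (\<lambda>a b. \<epsilon> (c \<cdot> a) * \<epsilon> (b \<cdot> y))))"
    by (subst sweedler_swap[of _ one]) (simp add: sweedler_mult_left)
  also have "\<dots> = sw x (\<lambda>y z. sw one (\<lambda>c d. \<epsilon> (c \<cdot> y) * K d z))"
    by (simp add: counit_m[symmetric] r_one mult.commute)
  also have "\<dots> = sw x (\<lambda>y z. K (eps_t y) z)"
    by (intro sweedler_cong lin_form_eps_t[symmetric] linear)
  finally show ?thesis by simp
qed

lemma sw_m_eps_t:
  assumes K: "bilin_form K"
  shows "sw (x \<cdot> eps_t y) K = sw x (\<lambda>a b. K (a \<cdot> eps_t y) b)"
proof -
  note linear = lin_intros bilin_form_comp[OF K]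
  have "sw (x \<cdot> eps_t y) K = sw x (\<lambda>a b. sw (eps_t y) (\<lambda>c d. K (a \<cdot> c) (b \<cdot> d)))"
    by (rule sw_m[OF K])
  also have "\<dots> = sw x (\<lambda>a b. sw one (\<lambda>c d. K (a \<cdot> (c \<cdot> eps_t y)) (b \<cdot> d)))"
    by (intro sweedler_cong sw_eps_t(1) linear)
  also have "\<dots> = sw x (\<lambda>a b. K (a \<cdot> eps_t y) b)"
    unfolding m_assoc[symmetric] by (rule sw_m_one) (intro linear)
  finally show ?thesis .
qed

lemma sw_eps_t_m:
  assumes K: "bilin_form K"
  shows "sw (eps_t y \<cdot> x) K = sw x (\<lambda>a b. K (eps_t y \<cdot> a) b)"
proof -
  note linear = lin_intros bilin_form_comp[OF K]
  have "sw (eps_t y \<cdot> x) K = sw (eps_t y) (\<lambda>c d. sw x (\<lambda>a b. K (c \<cdot> a) (d \<cdot> b)))"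
    by (rule sw_m[OF K])
  also have "\<dots> = sw one (\<lambda>c d. sw x (\<lambda>a b. K (eps_t y \<cdot> c \<cdot> a) (d \<cdot> b)))"
    by (rule sw_eps_t(2)) (intro linear)
  also have "\<dots> = sw x (\<lambda>a b. K (eps_t y \<cdot> a) b)"
    unfolding m_assoc by (rule sw_one_m) (intro linear)
  finally show ?thesis .
qed

lemma sw_m_eps_s: "bilin_form K \<Longrightarrow> sw (x \<cdot> eps_s y) K = sw x (\<lambda>a b. K a (b \<cdot> eps_s y))"
  using weak_hopf.sw_eps_t_m[OF opposite bilin_form_flip]
  by (simp add: sweedler_coopposite opposite_eps)

lemma sw_m_eps_t_S:
  assumes G: "lin_form G"
  shows "sw x (\<lambda>a b. G (a \<cdot> eps_t y \<cdot> S b)) = G (eps_t (x \<cdot> y))"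
proof -
  note linear = lin_intros lin_form_comp[OF G]
  have "sw x (\<lambda>a b. G (a \<cdot> eps_t y \<cdot> S b)) = sw (x \<cdot> eps_t y) (\<lambda>a b. G (a \<cdot> S b))"
    by (rule sw_m_eps_t[symmetric]) (intro linear)
  then show ?thesis by (simp add: sw_m_S[OF G] eps_t_m_eps_t)
qed

lemma sw_S_eps_s_m: "lin_form G \<Longrightarrow> sw y (\<lambda>a b. G (S a \<cdot> eps_s x \<cdot> b)) = G (eps_s (x \<cdot> y))"
  using weak_hopf.sw_m_eps_t_S[OF opposite, of G y x]
  by (simp add: sweedler_coopposite opposite_eps m_assoc)

lemma sw_eps_s_S:
  assumes G: "lin_form G"
  shows "sw x (\<lambda>a b. G (eps_s a \<cdot> S b)) = G (S x)"
proof -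
  note linear = lin_intros lin_form_comp[OF G]
  have "sw x (\<lambda>a b. G (eps_s a \<cdot> S b)) = sw x (\<lambda>a b. sw a (\<lambda>c d. G (S c \<cdot> d \<cdot> S b)))"
    by (intro sweedler_cong sw_S_m[symmetric] linear)
  then show ?thesis unfolding coassoc by (simp add: sw_S_m_S[OF G])
qed

lemma sw_S_eps_t: "lin_form G \<Longrightarrow> sw x (\<lambda>a b. G (S a \<cdot> eps_t b)) = G (S x)"
  using weak_hopf.sw_eps_s_S[OF opposite, of G x] by (simp add: sweedler_coopposite opposite_eps)

lemma sw_S_S_eps_t:
  assumes G: "lin_form G"
  shows "sw x (\<lambda>p b. sw y (\<lambda>r d. G (S r \<cdot> S p \<cdot> eps_t (b \<cdot> d)))) = G (S (x \<cdot> y))"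
proof -
  note linear = lin_intros lin_form_comp[OF G]
  have "G (S (x \<cdot> y)) = sw (x \<cdot> y) (\<lambda>a b. G (eps_s a \<cdot> S b))"
    by (rule sw_eps_s_S[OF G, symmetric])
  also have "\<dots> = sw x (\<lambda>a b. sw y (\<lambda>c d. G (eps_s (a \<cdot> c) \<cdot> S (b \<cdot> d))))"
    by (rule sw_m) (intro linear)
  also have "\<dots> = sw x (\<lambda>a b. sw y (\<lambda>c d. sw c (\<lambda>r s. G (S r \<cdot> eps_s a \<cdot> s \<cdot> S (b \<cdot> d)))))"
    by (intro sweedler_cong sw_S_eps_s_m[symmetric] linear)
  also have "\<dots> = sw x (\<lambda>a b. sw y (\<lambda>r d'. sw d' (\<lambda>s d. G (S r \<cdot> (eps_s a \<cdot> (s \<cdot> S (b \<cdot> d)))))))"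
    by (simp add: coassoc m_assoc)
  also have "\<dots> = sw x (\<lambda>a b. sw a (\<lambda>p q. sw y (\<lambda>r d'. sw d' (\<lambda>s d. G (S r \<cdot> (S p \<cdot> q \<cdot> (s \<cdot> S (b \<cdot> d))))))))"
    by (intro sweedler_cong sw_S_m[symmetric] linear)
  also have "\<dots> = sw x (\<lambda>p b'. sw b' (\<lambda>q b. sw y (\<lambda>r d'. sw d' (\<lambda>s d. G (S r \<cdot> S p \<cdot> (q \<cdot> s \<cdot> S (b \<cdot> d)))))))"
    by (simp add: coassoc m_assoc)
  also have "\<dots> = sw x (\<lambda>p b'. sw y (\<lambda>r d'. sw b' (\<lambda>q b. sw d' (\<lambda>s d. G (S r \<cdot> S p \<cdot> (q \<cdot> s \<cdot> S (b \<cdot> d)))))))"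
    by (intro sweedler_cong sweedler_swap)
  also have "\<dots> = sw x (\<lambda>p b'. sw y (\<lambda>r d'. sw (b' \<cdot> d') (\<lambda>u v. G (S r \<cdot> S p \<cdot> (u \<cdot> S v)))))"
    by (intro sweedler_cong sw_m[symmetric] linear)
  also have "\<dots> = sw x (\<lambda>p b'. sw y (\<lambda>r d'. G (S r \<cdot> S p \<cdot> eps_t (b' \<cdot> d'))))"
    by (intro sweedler_cong sw_m_S linear)
  finally show ?thesis ..
qed

theorem S_m: "S (x \<cdot> y) = S y \<cdot> S x"
proof (rule eq_lin_formI)
  fix G :: "('i \<Rightarrow> complex) \<Rightarrow> complex" assume G: "lin_form G"
  note linear = lin_intros lin_form_comp[OF G]
  have "G (S (x \<cdot> y)) = sw x (\<lambda>p b'. sw y (\<lambda>r d. G (S r \<cdot> S p \<cdot> eps_t (b' \<cdot> d))))"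
    by (rule sw_S_S_eps_t[OF G, symmetric])
  also have "\<dots> = sw x (\<lambda>p b'. sw y (\<lambda>r d. sw b' (\<lambda>q b. G (S r \<cdot> S p \<cdot> (q \<cdot> eps_t d \<cdot> S b)))))"
    by (intro sweedler_cong sw_m_eps_t_S[symmetric] linear)
  also have "\<dots> = sw x (\<lambda>p b'. sw b' (\<lambda>q b. sw y (\<lambda>r d. G (S r \<cdot> (S p \<cdot> q) \<cdot> (eps_t d \<cdot> S b)))))"
    unfolding m_assoc by (intro sweedler_cong sweedler_swap)
  also have "\<dots> = sw x (\<lambda>a b. sw a (\<lambda>p q. sw y (\<lambda>r d. G (S r \<cdot> (S p \<cdot> q) \<cdot> (eps_t d \<cdot> S b)))))"
    by (rule coassoc[symmetric])
  also have "\<dots> = sw x (\<lambda>a b. sw y (\<lambda>r d. G (S r \<cdot> eps_s a \<cdot> (eps_t d \<cdot> S b))))"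
    by (intro sweedler_cong sw_S_m linear)
  also have "\<dots> = sw x (\<lambda>a b. sw y (\<lambda>r d. G (S r \<cdot> eps_t d \<cdot> (eps_s a \<cdot> S b))))"
  proof -
    have "eps_s a \<cdot> (eps_t d \<cdot> z) = eps_t d \<cdot> (eps_s a \<cdot> z)" for a d z
      by (simp only: eps_s_eps_t_commute flip: m_assoc)
    then show ?thesis by (simp only: m_assoc)
  qed
  also have "\<dots> = sw x (\<lambda>a b. G (S y \<cdot> (eps_s a \<cdot> S b)))"
    by (intro sweedler_cong sw_S_eps_t linear)
  also have "\<dots> = G (S y \<cdot> S x)"
    by (rule sw_eps_s_S) (intro linear)
  finally show "G (S (x \<cdot> y)) = G (S y \<cdot> S x)" .
qed

end

section \<open>The dual of a weak Hopf algebra\<close>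

context weak_hopf
begin

definition dual_m :: "('i \<Rightarrow> complex) \<Rightarrow> ('i \<Rightarrow> complex) \<Rightarrow> ('i \<Rightarrow> complex)" (infixl "\<star>" 75) where
  "f \<star> g = (\<lambda>i. sw (bas i) (\<lambda>a b. ev f a * ev g b))"

definition dual_one :: "'i \<Rightarrow> complex" where
  "dual_one = (\<lambda>i. \<epsilon> (bas i))"

definition dual_\<Delta> :: "('i \<Rightarrow> complex) \<Rightarrow> 'i \<times> 'i \<Rightarrow> complex" where
  "dual_\<Delta> f = (\<lambda>(i, j). ev f (bas i \<cdot> bas j))"

definition dual_\<epsilon> :: "('i \<Rightarrow> complex) \<Rightarrow> complex" where
  "dual_\<epsilon> f = ev f one"

definition dual_S :: "('i \<Rightarrow> complex) \<Rightarrow> ('i \<Rightarrow> complex)" where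
  "dual_S f = (\<lambda>i. ev f (S (bas i)))"

abbreviation dsw :: "('i \<Rightarrow> complex) \<Rightarrow> (('i \<Rightarrow> complex) \<Rightarrow> ('i \<Rightarrow> complex) \<Rightarrow> complex) \<Rightarrow> complex" where
  "dsw \<equiv> sweedler dual_\<Delta>"

lemma ev_dual_m: "ev (f \<star> g) x = sw x (\<lambda>a b. ev f a * ev g b)"
proof -
  have "lin_form (\<lambda>x. sw x (\<lambda>a b. ev f a * ev g b))" by (intro lin_intros)
  from lin_form_ev[OF this, of x] show ?thesis by (simp add: dual_m_def ev_commute[of _ x])
qed

lemma ev_dual_one: "ev dual_one x = \<epsilon> x"
  using lin_form_ev[OF lin_form_\<epsilon>, of x] by (simp add: dual_one_def ev_commute[of _ x])

lemma ev_dual_S: "ev (dual_S f) x = ev f (S x)"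
proof -
  have "lin_form (\<lambda>x. ev f (S x))" by (intro lin_intros)
  from lin_form_ev[OF this, of x] show ?thesis by (simp add: dual_S_def ev_commute[of _ x])
qed

lemma lin_map_dual_m_left [lin_intros]: "lin_map g \<Longrightarrow> lin_map (\<lambda>x. g x \<star> f)"
  by (rule lin_map_comp[of "\<lambda>x. x \<star> f"]) (unfold dual_m_def, intro lin_mapI lin_intros)

lemma lin_map_dual_m_right [lin_intros]: "lin_map g \<Longrightarrow> lin_map (\<lambda>x. f \<star> g x)"
  by (rule lin_map_comp[of "\<lambda>x. f \<star> x"]) (unfold dual_m_def, intro lin_mapI lin_intros)

lemma lin_map_dual_S [lin_intros]: "lin_map g \<Longrightarrow> lin_map (\<lambda>x. dual_S (g x))"
  by (rule lin_map_comp[of dual_S]) (unfold dual_S_def, intro lin_mapI lin_intros)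

lemma dsw_ev: "dsw f (\<lambda>p q. ev p x * ev q y) = ev f (x \<cdot> y)"
proof -
  have "bilin_form (\<lambda>x y. ev f (x \<cdot> y))" by (intro lin_intros)
  from bilin_form_expand[OF this, of x y] show ?thesis
    by (simp add: sweedler_def dual_\<Delta>_def)
qed

lemma dsw_one_ev: "dsw dual_one (\<lambda>p q. ev p x * ev q y) = \<epsilon> (x \<cdot> y)"
  by (simp add: dsw_ev ev_dual_one)

lemma dsw_m:
  "dsw (f \<star> g) (\<lambda>p q. ev p x * ev q y) = dsw f (\<lambda>p q. dsw g (\<lambda>r s. ev (p \<star> r) x * ev (q \<star> s) y))"
proof -
  have "dsw (f \<star> g) (\<lambda>p q. ev p x * ev q y) = sw x (\<lambda>a b. sw y (\<lambda>c d. ev f (a \<cdot> c) * ev g (b \<cdot> d)))"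
    unfolding dsw_ev ev_dual_m by (rule sw_m) (intro lin_intros)
  also have "\<dots> = sw x (\<lambda>a b. sw y (\<lambda>c d. dsw f (\<lambda>p q. dsw g (\<lambda>r s. (ev p a * ev q c) * (ev r b * ev s d)))))"
    by (simp only: sweedler_mult_left sweedler_mult_right dsw_ev)
  also have "\<dots> = sw x (\<lambda>a b. dsw f (\<lambda>p q. dsw g (\<lambda>r s. sw y (\<lambda>c d. (ev p a * ev q c) * (ev r b * ev s d)))))"
    by (simp only: sweedler_swap[of \<Delta> y])
  also have "\<dots> = dsw f (\<lambda>p q. dsw g (\<lambda>r s. sw x (\<lambda>a b. sw y (\<lambda>c d. (ev p a * ev q c) * (ev r b * ev s d)))))"
    by (simp only: sweedler_swap[of \<Delta> x])
  also have "\<dots> = dsw f (\<lambda>p q. dsw g (\<lambda>r s. sw x (\<lambda>a b. sw y (\<lambda>c d. (ev p a * ev r b) * (ev q c * ev s d)))))"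
    by (simp only: mult_ac)
  also have "\<dots> = dsw f (\<lambda>p q. dsw g (\<lambda>r s. ev (p \<star> r) x * ev (q \<star> s) y))"
    by (simp only: sweedler_mult_left sweedler_mult_right ev_dual_m)
  finally show ?thesis .
qed

lemma dsw_one_dsw: "dsw dual_one (\<lambda>p q. dsw q (\<lambda>r s. ev p x * ev r y * ev s z)) = \<epsilon> (x \<cdot> y \<cdot> z)"
  by (simp only: mult.assoc sweedler_mult_left dsw_ev ev_dual_one m_assoc)

lemma dsw_one_dsw_one:
  "dsw dual_one (\<lambda>p q. dsw dual_one (\<lambda>r s. ev p x * (ev q y * ev r z) * ev s w)) = \<epsilon> (x \<cdot> y) * \<epsilon> (z \<cdot> w)"
proof -
  have "dsw dual_one (\<lambda>p q. dsw dual_one (\<lambda>r s. ev p x * (ev q y * ev r z) * ev s w)) =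
      dsw dual_one (\<lambda>p q. dsw dual_one (\<lambda>r s. (ev p x * ev q y) * (ev r z * ev s w)))"
    by (simp only: mult_ac)
  then show ?thesis by (simp only: sweedler_mult_left sweedler_mult_right dsw_one_ev)
qed

lemma dsw_one:
  "dsw dual_one (\<lambda>p q. dsw dual_one (\<lambda>r s. ev p x * ev (q \<star> r) y * ev s z)) = \<epsilon> (x \<cdot> y \<cdot> z)"
  "dsw dual_one (\<lambda>p q. dsw dual_one (\<lambda>r s. ev p x * ev (r \<star> q) y * ev s z)) = \<epsilon> (x \<cdot> y \<cdot> z)"
proof -
  have expand: "dsw dual_one (\<lambda>p q. dsw dual_one (\<lambda>r s. ev p x * ev (f q r \<star> g q r) y * ev s z)) =
      sw y (\<lambda>a b. dsw dual_one (\<lambda>p q. dsw dual_one (\<lambda>r s. ev p x * (ev (f q r) a * ev (g q r) b) * ev s z)))"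
    for f g
    unfolding ev_dual_m sweedler_mult_left[symmetric] sweedler_mult_right[symmetric]
    by (simp only: sweedler_swap[of \<Delta> y])
  show "dsw dual_one (\<lambda>p q. dsw dual_one (\<lambda>r s. ev p x * ev (q \<star> r) y * ev s z)) = \<epsilon> (x \<cdot> y \<cdot> z)"
    unfolding expand[of "\<lambda>q r. q" "\<lambda>q r. r"] dsw_one_dsw_one counit_m ..
  have "dsw dual_one (\<lambda>p q. dsw dual_one (\<lambda>r s. ev p x * (ev r a * ev q b) * ev s z)) = \<epsilon> (x \<cdot> b) * \<epsilon> (a \<cdot> z)"
    for a b
    unfolding mult.commute[of "ev _ a" "ev _ b"] by (rule dsw_one_dsw_one)
  then show "dsw dual_one (\<lambda>p q. dsw dual_one (\<lambda>r s. ev p x * ev (r \<star> q) y * ev s z)) = \<epsilon> (x \<cdot> y \<cdot> z)"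
    unfolding expand[of "\<lambda>q r. r" "\<lambda>q r. q"] counit_m' by simp
qed

lemma dsw_ev_mult:
  "dsw g (\<lambda>p q. (s * ev p x) * (ev q y * t)) = s * ev g (x \<cdot> y) * t"
  "dsw g (\<lambda>p q. (s * ev q y) * (ev p x * t)) = s * ev g (x \<cdot> y) * t"
proof -
  have "dsw g (\<lambda>p q. s * (ev p x * ev q y) * t) = s * ev g (x \<cdot> y) * t"
    by (simp only: sweedler_mult_left sweedler_mult_right dsw_ev)
  then show "dsw g (\<lambda>p q. (s * ev p x) * (ev q y * t)) = s * ev g (x \<cdot> y) * t"
    "dsw g (\<lambda>p q. (s * ev q y) * (ev p x * t)) = s * ev g (x \<cdot> y) * t"
    by (simp_all only: mult_ac)
qed

lemma dual_counit_m:
  "dual_\<epsilon> (f \<star> g \<star> h) = dsw g (\<lambda>p q. dual_\<epsilon> (f \<star> p) * dual_\<epsilon> (q \<star> h))" (is "_ = ?left")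
  "dual_\<epsilon> (f \<star> g \<star> h) = dsw g (\<lambda>p q. dual_\<epsilon> (f \<star> q) * dual_\<epsilon> (p \<star> h))" (is "_ = ?right")
proof -
  let ?K = "\<lambda>a b c. ev f a * ev g b * ev h c"
  have expand: "dual_\<epsilon> (f \<star> g \<star> h) = sw one (\<lambda>a b. sw b (?K a))"
    by (simp add: dual_\<epsilon>_def ev_dual_m coassoc[of one ?K] flip: sweedler_mult_right)
  also have "\<dots> = sw one (\<lambda>a b. sw one (\<lambda>c d. ?K a (b \<cdot> c) d))"
    by (rule sw_one) (intro lin_intros)
  also have "\<dots> = dsw g (\<lambda>p q. sw one (\<lambda>a b. sw one (\<lambda>c d. (ev f a * ev p b) * (ev q c * ev h d))))"
    by (simp only: sweedler_swap[of \<Delta> one dual_\<Delta>, symmetric] dsw_ev_mult)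
  also have "\<dots> = ?left"
    by (simp only: sweedler_mult_left sweedler_mult_right dual_\<epsilon>_def ev_dual_m)
  finally show "dual_\<epsilon> (f \<star> g \<star> h) = ?left" .
  note expand
  also have "sw one (\<lambda>a b. sw b (?K a)) = sw one (\<lambda>a b. sw one (\<lambda>c d. ?K a (c \<cdot> b) d))"
    by (rule sw_one) (intro lin_intros)
  also have "\<dots> = dsw g (\<lambda>p q. sw one (\<lambda>a b. sw one (\<lambda>c d. (ev f a * ev q b) * (ev p c * ev h d))))"
    by (simp only: sweedler_swap[of \<Delta> one dual_\<Delta>, symmetric] dsw_ev_mult)
  also have "\<dots> = ?right"
    by (simp only: sweedler_mult_left sweedler_mult_right dual_\<epsilon>_def ev_dual_m)
  finally show "dual_\<epsilon> (f \<star> g \<star> h) = ?right" .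
qed

lemma dual_antipode_left:
  "dsw f (\<lambda>p q. ev (dual_S p \<star> q) x) = dsw dual_one (\<lambda>p q. dual_\<epsilon> (f \<star> q) * ev p x)"
proof -
  have "dsw f (\<lambda>p q. ev (dual_S p \<star> q) x) = sw x (\<lambda>a b. dsw f (\<lambda>p q. ev p (S a) * ev q b))"
    unfolding ev_dual_m ev_dual_S by (rule sweedler_swap)
  also have "\<dots> = sw one (\<lambda>a b. \<epsilon> (x \<cdot> b) * ev f a)"
    unfolding dsw_ev by (subst sw_S_m, intro lin_intros, rule lin_form_eps_s, intro lin_intros)
  also have "\<dots> = sw one (\<lambda>a b. dsw dual_one (\<lambda>p q. ev f a * ev q b * ev p x))"
    by (simp add: sweedler_mult_left mult.assoc dsw_one_ev[of x] mult.commute[of "ev _ _" "ev _ x"]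
        mult.commute[of "\<epsilon> _"])
  also have "\<dots> = dsw dual_one (\<lambda>p q. dual_\<epsilon> (f \<star> q) * ev p x)"
    unfolding sweedler_swap[of \<Delta> one dual_\<Delta>] by (simp only: sweedler_mult_right dual_\<epsilon>_def ev_dual_m)
  finally show ?thesis .
qed

lemma dual_antipode_right:
  "dsw f (\<lambda>p q. ev (p \<star> dual_S q) x) = dsw dual_one (\<lambda>p q. dual_\<epsilon> (p \<star> f) * ev q x)"
proof -
  have "dsw f (\<lambda>p q. ev (p \<star> dual_S q) x) = sw x (\<lambda>a b. dsw f (\<lambda>p q. ev p a * ev q (S b)))"
    unfolding ev_dual_m ev_dual_S by (rule sweedler_swap)
  also have "\<dots> = sw one (\<lambda>a b. \<epsilon> (a \<cdot> x) * ev f b)"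
    unfolding dsw_ev by (subst sw_m_S, intro lin_intros, rule lin_form_eps_t, intro lin_intros)
  also have "\<dots> = sw one (\<lambda>a b. dsw dual_one (\<lambda>p q. ev p a * ev q x * ev f b))"
    by (simp only: sweedler_mult_right dsw_one_ev)
  also have "\<dots> = sw one (\<lambda>a b. dsw dual_one (\<lambda>p q. ev p a * ev f b * ev q x))"
    by (simp only: mult_ac)
  also have "\<dots> = dsw dual_one (\<lambda>p q. dual_\<epsilon> (p \<star> f) * ev q x)"
    unfolding sweedler_swap[of \<Delta> one dual_\<Delta>] by (simp only: sweedler_mult_right dual_\<epsilon>_def ev_dual_m)
  finally show ?thesis .
qed

lemma dual_antipode_middle:
  "dsw f (\<lambda>p q. dsw p (\<lambda>r s. ev (dual_S r \<star> s \<star> dual_S q) x)) = ev (dual_S f) x"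
proof -
  have "dsw f (\<lambda>p q. dsw p (\<lambda>r s. ev (dual_S r \<star> s \<star> dual_S q) x)) =
      dsw f (\<lambda>p q. dsw p (\<lambda>r s. sw x (\<lambda>a b. sw a (\<lambda>c d. ev r (S c) * ev s d * ev q (S b)))))"
    by (simp only: ev_dual_m ev_dual_S sweedler_mult_right)
  also have "\<dots> = sw x (\<lambda>a b. sw a (\<lambda>c d. dsw f (\<lambda>p q. dsw p (\<lambda>r s. ev r (S c) * ev s d * ev q (S b)))))"
    by (simp only: sweedler_swap[of dual_\<Delta> _ \<Delta>])
  also have "\<dots> = sw x (\<lambda>a b. sw a (\<lambda>c d. ev f (S c \<cdot> d \<cdot> S b)))"
    by (simp only: sweedler_mult_right dsw_ev)
  also have "\<dots> = ev (dual_S f) x"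
    unfolding coassoc[of x "\<lambda>c d b. ev f (S c \<cdot> d \<cdot> S b)"] ev_dual_S
    by (rule sw_S_m_S) (intro lin_intros)
  finally show ?thesis .
qed

lemma dual_coassoc:
  "dsw f (\<lambda>p q. dsw p (\<lambda>r s. ev r x * ev s y * ev q z)) =
      dsw f (\<lambda>p q. dsw q (\<lambda>r s. ev p x * ev r y * ev s z))"
proof -
  have "dsw f (\<lambda>p q. dsw p (\<lambda>r s. ev r x * ev s y * ev q z)) = ev f (x \<cdot> y \<cdot> z)"
    by (simp only: sweedler_mult_right dsw_ev)
  also have "\<dots> = dsw f (\<lambda>p q. dsw q (\<lambda>r s. ev p x * (ev r y * ev s z)))"
    by (simp only: sweedler_mult_left dsw_ev m_assoc)
  finally show ?thesis by (simp only: mult.assoc)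
qed

lemma dual_m_assoc: "f \<star> g \<star> h = f \<star> (g \<star> h)"
proof (rule ext)
  fix i
  have "ev (f \<star> g \<star> h) (bas i) = sw (bas i) (\<lambda>a b. sw a (\<lambda>c d. ev f c * ev g d * ev h b))"
    by (simp only: ev_dual_m sweedler_mult_right)
  also have "\<dots> = sw (bas i) (\<lambda>a b. sw b (\<lambda>c d. ev f a * (ev g c * ev h d)))"
    by (subst coassoc) (simp only: mult.assoc)
  also have "\<dots> = ev (f \<star> (g \<star> h)) (bas i)"
    by (simp only: ev_dual_m sweedler_mult_left)
  finally show "(f \<star> g \<star> h) i = (f \<star> (g \<star> h)) i" by simp
qed

lemma dual_one_m: "dual_one \<star> f = f" and dual_m_one: "f \<star> dual_one = f"
proof -
  have "ev (dual_one \<star> f) (bas i) = ev f (bas i)" "ev (f \<star> dual_one) (bas i) = ev f (bas i)" for i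
    unfolding ev_dual_m ev_dual_one by (simp_all add: counit_left counit_right lin_intros)
  then show "dual_one \<star> f = f" "f \<star> dual_one = f" by (simp_all add: fun_eq_iff)
qed

lemma dual_counit:
  "dsw f (\<lambda>p q. dual_\<epsilon> p * ev q x) = ev f x" "dsw f (\<lambda>p q. ev p x * dual_\<epsilon> q) = ev f x"
  by (simp_all add: dual_\<epsilon>_def dsw_ev l_one r_one)

theorem dual: "weak_hopf dual_m dual_one dual_\<Delta> dual_\<epsilon> dual_S"
proof unfold_locales
  show "lin_map (\<lambda>f. f \<star> g)" "lin_map (\<lambda>g. f \<star> g)" "lin_map dual_S" for f g
    using lin_map_dual_m_left lin_map_dual_m_right lin_map_dual_S lin_map_id by blast+
  show "lin_form dual_\<epsilon>"
    unfolding dual_\<epsilon>_def by (intro lin_intros)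
  show "lin_form (\<lambda>f. dual_\<Delta> f p)" for p
    unfolding dual_\<Delta>_def split_def by (intro lin_intros)
  fix f g h :: "'i \<Rightarrow> complex" and i j k :: 'i
  show "f \<star> g \<star> h = f \<star> (g \<star> h)" by (rule dual_m_assoc)
  show "dual_one \<star> f = f" by (rule dual_one_m)
  show "f \<star> dual_one = f" by (rule dual_m_one)
  show "dual_\<epsilon> (f \<star> g \<star> h) = dsw g (\<lambda>p q. dual_\<epsilon> (f \<star> p) * dual_\<epsilon> (q \<star> h))"
    "dual_\<epsilon> (f \<star> g \<star> h) = dsw g (\<lambda>p q. dual_\<epsilon> (f \<star> q) * dual_\<epsilon> (p \<star> h))"
    by (rule dual_counit_m)+
qed (insert dual_coassoc[of _ "bas _" "bas _" "bas _"] dual_counit[of _ "bas _"]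
    dsw_m[of _ _ "bas _" "bas _"] dsw_one_dsw[of "bas _" "bas _" "bas _"]
    dsw_one[of "bas _" "bas _" "bas _"] dual_antipode_left[of _ "bas _"]
    dual_antipode_right[of _ "bas _"] dual_antipode_middle[of _ "bas _"], simp_all)

end

locale dual_trace_idempotent = weak_hopf m one \<Delta> \<epsilon> S
  for m :: "('i::finite \<Rightarrow> complex) \<Rightarrow> ('i \<Rightarrow> complex) \<Rightarrow> ('i \<Rightarrow> complex)" (infixl "\<cdot>" 75)
    and one \<Delta> \<epsilon> S +
  fixes \<Omega> k ki :: "'i \<Rightarrow> complex"
  assumes symmetric: "ev (f \<star> g) \<Omega> = ev (g \<star> f) \<Omega>"
    and multiplicative: "dsw f (\<lambda>p q. ev p \<Omega> * ev q \<Omega>) = ev f \<Omega>"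
    and twisted_shift: "lin_form G \<Longrightarrow>
      dsw g (\<lambda>p q. G p * ev (f \<star> q) \<Omega>) = dsw f (\<lambda>p q. G (dual_S p \<star> k) * ev (q \<star> g) \<Omega>)"
    and S_invariant: "ev (dual_S f) \<Omega> = ev f \<Omega>"
    and faithful: "(\<And>g. ev (f \<star> g) \<Omega> = 0) \<Longrightarrow> f = (\<lambda>_. 0)"
    and k_ki: "k \<star> ki = dual_one"
begin

lemma \<Omega>_cocommutative: "\<Delta> \<Omega> (i, j) = \<Delta> \<Omega> (j, i)"
  using symmetric[of "bas i" "bas j"] by (simp add: ev_dual_m sweedler_coords)

lemma \<Omega>_idempotent: "\<Omega> \<cdot> \<Omega> = \<Omega>"
proof (rule ext)
  show "(\<Omega> \<cdot> \<Omega>) i = \<Omega> i" for i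
    using multiplicative[of "bas i"] by (simp add: dsw_ev)
qed

lemma S_\<Omega>: "S \<Omega> = \<Omega>"
proof (rule ext)
  show "S \<Omega> i = \<Omega> i" for i
    using S_invariant[of "bas i"] by (simp add: ev_dual_S)
qed

lemma \<Omega>_nondegenerate:
  "range (\<lambda>f j. sw \<Omega> (\<lambda>a b. ev f a * b j)) = UNIV" "range (\<lambda>f j. sw \<Omega> (\<lambda>a b. a j * ev f b)) = UNIV"
proof -
  define \<Phi> where "\<Phi> f = (\<lambda>j. ev (f \<star> bas j) \<Omega>)" for f
  have surj: "surj \<Phi>"
  proof (rule lin_map_inj_imp_surj)
    show "lin_map \<Phi>" unfolding \<Phi>_def by (intro lin_mapI lin_intros)
    fix f assume kernel: "\<Phi> f = (\<lambda>_. 0)"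
    have "ev (f \<star> g) \<Omega> = 0" for g
    proof -
      have "lin_form (\<lambda>g. ev (f \<star> g) \<Omega>)" by (intro lin_intros)
      from lin_form_ev[OF this, of g] show ?thesis using kernel by (simp add: \<Phi>_def fun_eq_iff ev_def)
    qed
    then show "f = (\<lambda>_. 0)" by (rule faithful)
  qed
  have left: "\<Phi> = (\<lambda>f j. sw \<Omega> (\<lambda>a b. ev f a * b j))"
    by (simp add: \<Phi>_def ev_dual_m fun_eq_iff)
  show "range (\<lambda>f j. sw \<Omega> (\<lambda>a b. ev f a * b j)) = UNIV"
    using surj by (simp only: left)
  have right: "\<Phi> = (\<lambda>f j. sw \<Omega> (\<lambda>a b. a j * ev f b))"
    by (intro ext) (unfold \<Phi>_def, subst symmetric, simp add: ev_dual_m)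
  show "range (\<lambda>f j. sw \<Omega> (\<lambda>a b. a j * ev f b)) = UNIV"
    using surj by (simp only: right)
qed

definition twist :: "('i \<Rightarrow> complex) \<Rightarrow> ('i \<Rightarrow> complex)" where
  "twist x = (\<lambda>i. ev (dual_S (bas i) \<star> k) x)"

lemma lin_map_twist: "lin_map twist"
  by (rule lin_mapI) (unfold twist_def, rule lin_form_ev_right[OF lin_map_id])

lemma ev_twist: "ev f (twist x) = ev (dual_S f \<star> k) x"
proof -
  have "lin_form (\<lambda>f. ev (dual_S f \<star> k) x)"
    by (intro lin_intros)
  from lin_form_ev[OF this, of f] show ?thesis by (simp add: twist_def)
qed

lemma \<Omega>_shift: "sw \<Omega> (\<lambda>a b. a i * (x \<cdot> b) j) = sw \<Omega> (\<lambda>a b. (twist x \<cdot> a) i * b j)"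
proof -
  let ?f = "bas i" and ?g = "bas j"
  have "sw \<Omega> (\<lambda>a b. a i * (x \<cdot> b) j) = sw \<Omega> (\<lambda>a b. dsw ?g (\<lambda>p q. ev p x * ev q b) * ev ?f a)"
    by (simp add: dsw_ev mult.commute)
  also have "\<dots> = dsw ?g (\<lambda>p q. ev p x * ev (?f \<star> q) \<Omega>)"
    unfolding ev_dual_m sweedler_mult_left[symmetric] sweedler_mult_right[symmetric]
    by (subst sweedler_swap) (simp only: mult_ac)
  also have "\<dots> = dsw ?f (\<lambda>p q. ev p (twist x) * ev (q \<star> ?g) \<Omega>)"
    unfolding ev_twist by (rule twisted_shift) (intro lin_intros)
  also have "\<dots> = sw \<Omega> (\<lambda>a b. dsw ?f (\<lambda>p q. ev p (twist x) * ev q a) * ev ?g b)"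
    unfolding ev_dual_m sweedler_mult_left[symmetric] sweedler_mult_right[symmetric]
    by (subst sweedler_swap) (simp only: mult_ac)
  finally show ?thesis by (simp add: dsw_ev)
qed

lemma \<Delta>_twist: "\<Delta> (twist x) (i, j) = sw x (\<lambda>a c. sw a (\<lambda>a b. ev ki b * twist c i * twist a j))"
proof -
  have "\<Delta> (twist x) (i, j) = ev (bas i \<star> bas j) (twist x)"
    by (simp add: ev_dual_m sweedler_coords)
  also have "\<dots> = ev (dual_S (bas j) \<star> k \<star> ki \<star> (dual_S (bas i) \<star> k)) x"
    by (simp add: ev_twist weak_hopf.S_m[OF dual] dual_m_assoc k_ki dual_m_one)
  also have "\<dots> = sw x (\<lambda>a c. sw a (\<lambda>a b. ev (dual_S (bas j) \<star> k) a * ev ki b * ev (dual_S (bas i) \<star> k) c))"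
    by (simp only: ev_dual_m[of "_ \<star> _"] sweedler_mult_right)
  finally show ?thesis by (simp add: twist_def mult_ac)
qed

lemma twist_\<Omega>: "sw \<Omega> (\<lambda>a b. twist a i * ev ki b) = S \<Omega> i"
proof -
  have "sw \<Omega> (\<lambda>a b. twist a i * ev ki b) = ev (dual_S (bas i) \<star> k \<star> ki) \<Omega>"
    by (simp add: twist_def ev_dual_m[of "_ \<star> _"])
  then show ?thesis by (simp add: dual_m_assoc k_ki dual_m_one ev_dual_S)
qed

end

section \<open>Integrals and pivotal elements\<close>

context weak_hopf
begin

definition left_integral :: "(('i \<Rightarrow> complex) \<Rightarrow> complex) \<Rightarrow> bool" where
  "left_integral \<Lambda> \<longleftrightarrow> lin_form \<Lambda> \<and> (\<forall>f G. lin_form G \<longrightarrow> sw f (\<lambda>a b. G a * \<Lambda> b) = sw f (\<lambda>a b. G (eps_t a) * \<Lambda> b))"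

lemma left_integral_lin_form: "left_integral \<Lambda> \<Longrightarrow> lin_form \<Lambda>"
  by (simp add: left_integral_def)

lemma left_integral_eps_t:
  "left_integral \<Lambda> \<Longrightarrow> lin_form G \<Longrightarrow> sw f (\<lambda>a b. G a * \<Lambda> b) = sw f (\<lambda>a b. G (eps_t a) * \<Lambda> b)"
  unfolding left_integral_def by blast

lemma left_integral_shift:
  assumes \<Lambda>: "left_integral \<Lambda>" and G: "lin_form G"
  shows "sw g (\<lambda>a b. G a * \<Lambda> (f \<cdot> b)) = sw f (\<lambda>a b. G (S a) * \<Lambda> (b \<cdot> g))"
proof -
  note linear = lin_intros lin_form_comp[OF G] lin_form_comp[OF left_integral_lin_form[OF \<Lambda>]]
  define middle where "middle = sw f (\<lambda>a b. sw (b \<cdot> g) (\<lambda>c d. G (S a \<cdot> c) * \<Lambda> d))"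
  have "middle = sw f (\<lambda>a b. sw (b \<cdot> g) (\<lambda>c d. G (S a \<cdot> eps_t c) * \<Lambda> d))"
    unfolding middle_def by (intro sweedler_cong left_integral_eps_t[OF \<Lambda>] linear)
  also have "\<dots> = sw f (\<lambda>a b. sw one (\<lambda>u v. G (S a \<cdot> S u) * \<Lambda> (v \<cdot> (b \<cdot> g))))"
    by (intro sweedler_cong sw_eps_t_first linear)
  also have "\<dots> = sw one (\<lambda>u v. sw f (\<lambda>a b. G (S (u \<cdot> a)) * \<Lambda> (v \<cdot> b \<cdot> g)))"
    by (subst sweedler_swap) (simp add: S_m m_assoc)
  also have "\<dots> = sw f (\<lambda>a b. G (S a) * \<Lambda> (b \<cdot> g))"
    by (rule sw_one_m) (intro linear)
  finally have target: "middle = sw f (\<lambda>a b. G (S a) * \<Lambda> (b \<cdot> g))" .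
  have "middle = sw f (\<lambda>a b. sw b (\<lambda>r s. sw g (\<lambda>c d. G (S a \<cdot> (r \<cdot> c)) * \<Lambda> (s \<cdot> d))))"
    unfolding middle_def by (intro sweedler_cong sw_m linear)
  also have "\<dots> = sw f (\<lambda>b s. sw b (\<lambda>a r. sw g (\<lambda>c d. G (S a \<cdot> (r \<cdot> c)) * \<Lambda> (s \<cdot> d))))"
    by (rule coassoc[symmetric])
  also have "\<dots> = sw f (\<lambda>b s. sw g (\<lambda>c d. sw b (\<lambda>a r. G (S a \<cdot> r \<cdot> c) * \<Lambda> (s \<cdot> d))))"
    unfolding m_assoc by (intro sweedler_cong sweedler_swap)
  also have "\<dots> = sw f (\<lambda>b s. sw g (\<lambda>c d. G (eps_s b \<cdot> c) * \<Lambda> (s \<cdot> d)))"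
    by (intro sweedler_cong sw_S_m linear)
  also have "\<dots> = sw g (\<lambda>c d. sw f (\<lambda>b s. G (eps_s b \<cdot> c) * \<Lambda> (s \<cdot> d)))"
    by (rule sweedler_swap)
  also have "\<dots> = sw g (\<lambda>c d. sw one (\<lambda>u v. G (u \<cdot> c) * \<Lambda> (f \<cdot> v \<cdot> d)))"
    by (intro sweedler_cong sw_eps_s_first linear)
  also have "\<dots> = sw one (\<lambda>u v. sw g (\<lambda>c d. G (u \<cdot> c) * \<Lambda> (f \<cdot> (v \<cdot> d))))"
    unfolding m_assoc by (rule sweedler_swap)
  also have "\<dots> = sw g (\<lambda>c d. G c * \<Lambda> (f \<cdot> d))"
    by (rule sw_one_m) (intro linear)
  finally show ?thesis using target by simp
qed

text \<open>The density of $\varphi \circ \varepsilon_t$ with respect to $\varepsilon$. If $\varphi$ is a $k$-twisted character,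
this density is central, which determines $\varphi$ on the target subalgebra.\<close>

definition target_density :: "(('i \<Rightarrow> complex) \<Rightarrow> complex) \<Rightarrow> 'i \<Rightarrow> complex" where
  "target_density \<phi> = (\<lambda>i. sw one (\<lambda>a b. \<phi> (S a) * b i))"

lemma lin_form_target_density: "lin_form G \<Longrightarrow> G (target_density \<phi>) = sw one (\<lambda>a b. \<phi> (S a) * G b)"
  unfolding target_density_def by (rule lin_form_sweedler_vector)

lemma target_density_central:
  assumes \<phi>: "lin_form \<phi>" and twisted: "\<And>f g. \<phi> (g \<cdot> f) = \<phi> (f \<cdot> S (S g))"
  shows "f \<cdot> target_density \<phi> = target_density \<phi> \<cdot> f"
proof (rule eq_lin_formI)
  fix G :: "('i \<Rightarrow> complex) \<Rightarrow> complex" assume G: "lin_form G"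
  note linear = lin_intros lin_form_comp[OF G] lin_form_comp[OF \<phi>]
  have "G (target_density \<phi> \<cdot> f) = sw one (\<lambda>a b. \<phi> (S a) * G (b \<cdot> f))"
    by (rule lin_form_target_density) (intro linear)
  also have "\<dots> = sw f (\<lambda>a b. \<phi> (eps_t a) * G b)"
    by (rule sw_eps_t_first[symmetric]) (intro linear)
  also have "\<dots> = sw f (\<lambda>a b. sw a (\<lambda>c d. \<phi> (c \<cdot> S d)) * G b)"
    by (simp add: sw_m_S[OF \<phi>])
  also have "\<dots> = sw f (\<lambda>a b. sw a (\<lambda>c d. \<phi> (S (S c \<cdot> d))) * G b)"
    unfolding S_m twisted[symmetric] ..
  also have "\<dots> = sw f (\<lambda>a b. \<phi> (S (eps_s a)) * G b)"
    by (intro sweedler_cong arg_cong[where f="\<lambda>z. z * _"] sw_S_m linear)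
  also have "\<dots> = sw one (\<lambda>a b. \<phi> (S a) * G (f \<cdot> b))"
    by (rule sw_eps_s_first) (intro linear)
  also have "\<dots> = G (f \<cdot> target_density \<phi>)"
    by (rule lin_form_target_density[symmetric]) (intro linear)
  finally show "G (f \<cdot> target_density \<phi>) = G (target_density \<phi> \<cdot> f)" ..
qed

lemma counit_target_density:
  assumes \<phi>: "lin_form \<phi>"
  shows "\<epsilon> (target_density \<phi> \<cdot> z) = \<phi> (eps_t z)"
proof -
  note linear = lin_intros lin_form_comp[OF \<phi>]
  have "\<epsilon> (target_density \<phi> \<cdot> z) = sw one (\<lambda>a b. \<phi> (S a) * \<epsilon> (b \<cdot> z))"
    by (rule lin_form_target_density) (intro linear)
  also have "\<dots> = sw z (\<lambda>a b. \<phi> (eps_t a) * \<epsilon> b)"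
    by (rule sw_eps_t_first[symmetric]) (intro linear)
  also have "\<dots> = \<phi> (eps_t z)"
    by (rule counit_right) (intro linear)
  finally show ?thesis .
qed

end

locale pivotal_weak_hopf = weak_hopf +
  fixes k ki
  assumes k_inv: "k \<cdot> ki = one" and ki_inv: "ki \<cdot> k = one"
    and group_like_left: "bilin_form K \<Longrightarrow> sw k K = sw one (\<lambda>a b. K (k \<cdot> a) (k \<cdot> b))"
    and group_like_right: "bilin_form K \<Longrightarrow> sw k K = sw one (\<lambda>a b. K (a \<cdot> k) (b \<cdot> k))"
    and S_S: "S (S f) = k \<cdot> f \<cdot> ki"
begin

lemma sw_m_k:
  assumes K: "bilin_form K"
  shows "sw (f \<cdot> k) K = sw f (\<lambda>a b. K (a \<cdot> k) (b \<cdot> k))"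
proof -
  note linear = lin_intros bilin_form_comp[OF K]
  have "sw (f \<cdot> k) K = sw f (\<lambda>a b. sw k (\<lambda>c d. K (a \<cdot> c) (b \<cdot> d)))"
    by (rule sw_m[OF K])
  also have "\<dots> = sw f (\<lambda>a b. sw one (\<lambda>c d. K (a \<cdot> (c \<cdot> k)) (b \<cdot> (d \<cdot> k))))"
    by (intro sweedler_cong group_like_right linear)
  also have "\<dots> = sw f (\<lambda>a b. K (a \<cdot> k) (b \<cdot> k))"
    unfolding m_assoc[symmetric] by (rule sw_m_one) (intro linear)
  finally show ?thesis .
qed

lemma sw_k_m:
  assumes K: "bilin_form K"
  shows "sw (k \<cdot> f) K = sw f (\<lambda>a b. K (k \<cdot> a) (k \<cdot> b))"
proof -
  note linear = lin_intros bilin_form_comp[OF K]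
  have "sw (k \<cdot> f) K = sw k (\<lambda>c d. sw f (\<lambda>a b. K (c \<cdot> a) (d \<cdot> b)))"
    by (rule sw_m[OF K])
  also have "\<dots> = sw one (\<lambda>c d. sw f (\<lambda>a b. K (k \<cdot> c \<cdot> a) (k \<cdot> d \<cdot> b)))"
    by (rule group_like_left) (intro linear)
  also have "\<dots> = sw f (\<lambda>a b. K (k \<cdot> a) (k \<cdot> b))"
    unfolding m_assoc by (rule sw_one_m) (intro linear)
  finally show ?thesis .
qed

lemma sw_m_ki:
  assumes K: "bilin_form K"
  shows "sw (f \<cdot> ki) K = sw f (\<lambda>a b. K (a \<cdot> ki) (b \<cdot> ki))"
proof -
  note linear = lin_intros bilin_form_comp[OF K]
  have "sw (f \<cdot> ki \<cdot> k) (\<lambda>a b. K (a \<cdot> ki) (b \<cdot> ki)) = sw (f \<cdot> ki) (\<lambda>a b. K (a \<cdot> k \<cdot> ki) (b \<cdot> k \<cdot> ki))"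
    by (rule sw_m_k) (intro linear)
  then show ?thesis by (simp add: m_assoc k_inv ki_inv r_one)
qed

lemma sw_S_S:
  assumes K: "bilin_form K"
  shows "sw (S (S x)) K = sw x (\<lambda>a b. K (S (S a)) (S (S b)))"
proof -
  note linear = lin_intros bilin_form_comp[OF K]
  have "sw (S (S x)) K = sw (k \<cdot> x) (\<lambda>a b. K (a \<cdot> ki) (b \<cdot> ki))"
    unfolding S_S by (rule sw_m_ki[OF K])
  also have "\<dots> = sw x (\<lambda>a b. K (k \<cdot> a \<cdot> ki) (k \<cdot> b \<cdot> ki))"
    by (rule sw_k_m) (intro linear)
  finally show ?thesis by (simp add: S_S)
qed

lemma et_k: "eps_t k = one"
proof -
  have "k = eps_t k \<cdot> k"
  proof (rule eq_lin_formI)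
    fix G :: "('a \<Rightarrow> complex) \<Rightarrow> complex" assume G: "lin_form G"
    note linear = lin_intros lin_form_comp[OF G]
    have "G k = sw k (\<lambda>a b. \<epsilon> a * G b)" by (rule counit_left[OF G, symmetric])
    also have "\<dots> = sw one (\<lambda>a b. \<epsilon> (a \<cdot> k) * G (b \<cdot> k))"
      by (rule group_like_right) (intro linear)
    also have "\<dots> = G (eps_t k \<cdot> k)"
      by (rule lin_form_eps_t[symmetric]) (intro linear)
    finally show "G k = G (eps_t k \<cdot> k)" .
  qed
  then have "k \<cdot> ki = eps_t k \<cdot> k \<cdot> ki" by simp
  then show ?thesis by (simp add: m_assoc k_inv r_one)
qed

lemma S_k: "S k = ki"
proof -
  have "one = k \<cdot> S k"
  proof (rule eq_lin_formI)
    fix G :: "('a \<Rightarrow> complex) \<Rightarrow> complex" assume G: "lin_form G"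
    note linear = lin_intros lin_form_comp[OF G]
    have "G one = sw k (\<lambda>a b. G (a \<cdot> S b))"
      using sw_m_S[OF G, of k] by (simp add: et_k)
    also have "\<dots> = sw one (\<lambda>a b. G (k \<cdot> a \<cdot> S (k \<cdot> b)))"
      by (rule group_like_left) (intro linear)
    also have "\<dots> = sw one (\<lambda>a b. G (k \<cdot> (a \<cdot> S b) \<cdot> S k))"
      by (simp add: S_m m_assoc)
    also have "\<dots> = G (k \<cdot> eps_t one \<cdot> S k)"
      by (rule sw_m_S) (intro linear)
    finally show "G one = G (k \<cdot> S k)" by (simp add: eps_t_one r_one)
  qed
  then have "ki \<cdot> one = ki \<cdot> k \<cdot> S k" by (simp add: m_assoc)
  then show ?thesis by (simp add: ki_inv l_one r_one)
qed

text \<open>Inserts $S(\varepsilon_t(b_{(1)})) = S^2(b_{(2)}) S(b_{(1)})$ into the first tensor factor.\<close>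

lemma sw_m_S_S_second:
  assumes K: "bilin_form K"
  shows "sw f (\<lambda>a c. K a (c \<cdot> S (S b))) = sw b (\<lambda>p q. sw (f \<cdot> S (S q)) (\<lambda>a c. K (a \<cdot> S p) c))"
proof -
  note linear = lin_intros bilin_form_comp[OF K]
  have "sw b (\<lambda>p q. sw (f \<cdot> S (S q)) (\<lambda>a c. K (a \<cdot> S p) c)) =
      sw b (\<lambda>p q. sw f (\<lambda>a c. sw (S (S q)) (\<lambda>r s. K (a \<cdot> r \<cdot> S p) (c \<cdot> s))))"
    by (intro sweedler_cong sw_m linear)
  also have "\<dots> = sw b (\<lambda>p q. sw f (\<lambda>a c. sw q (\<lambda>r s. K (a \<cdot> S (S r) \<cdot> S p) (c \<cdot> S (S s)))))"
    by (intro sweedler_cong sw_S_S linear)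
  also have "\<dots> = sw f (\<lambda>a c. sw b (\<lambda>p q. sw q (\<lambda>r s. K (a \<cdot> S (S r) \<cdot> S p) (c \<cdot> S (S s)))))"
    by (rule sweedler_swap)
  also have "\<dots> = sw f (\<lambda>a c. sw b (\<lambda>q s. sw q (\<lambda>p r. K (a \<cdot> S (p \<cdot> S r)) (c \<cdot> S (S s)))))"
    by (simp add: coassoc S_m m_assoc)
  also have "\<dots> = sw f (\<lambda>a c. sw b (\<lambda>q s. K (a \<cdot> S (eps_t q)) (c \<cdot> S (S s))))"
    by (intro sweedler_cong sw_m_S linear)
  also have "\<dots> = sw f (\<lambda>a c. sw one (\<lambda>u v. K (a \<cdot> S (S u)) (c \<cdot> S (S (v \<cdot> b)))))"
    by (intro sweedler_cong sw_eps_t_first linear)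
  also have "\<dots> = sw f (\<lambda>a c. sw one (\<lambda>u v. K (a \<cdot> S (S u)) (c \<cdot> S (S v) \<cdot> S (S b))))"
    by (simp add: S_m m_assoc)
  also have "\<dots> = sw f (\<lambda>a c. sw (S (S one)) (\<lambda>u v. K (a \<cdot> u) (c \<cdot> v \<cdot> S (S b))))"
    by (intro sweedler_cong sw_S_S[symmetric] linear)
  also have "\<dots> = sw f (\<lambda>a c. K a (c \<cdot> S (S b)))"
    unfolding S_one by (rule sw_m_one) (intro linear)
  finally show ?thesis ..
qed

definition trace_form :: "('a \<Rightarrow> complex) \<Rightarrow> ('a \<Rightarrow> complex) \<Rightarrow> complex" where
  "trace_form h f = (\<Sum>i\<in>UNIV. (f \<cdot> S (S (bas i)) \<cdot> h) i)"

lemma lin_form_trace_form: "lin_form (trace_form h)"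
  unfolding trace_form_def by (intro lin_intros)

text \<open>After the insertion, cyclicity of the trace moves the coproduct of $f S^2(b)$ to the summation
variable, where the antipode collapses it to $\varepsilon_t$.\<close>

lemma sw_trace_form:
  assumes G: "lin_form G"
  shows "sw f (\<lambda>a c. G a * trace_form (eps_s y) c) =
    (\<Sum>j\<in>UNIV. sw (bas j) (\<lambda>a c. G (eps_t a) * (f \<cdot> S (S c) \<cdot> eps_s y) j))"
proof -
  note linear = lin_intros lin_form_comp[OF G] lin_form_id_coord
  define L where "L q = f \<cdot> S (S q) \<cdot> eps_s y" for q
  have L: "lin_map g \<Longrightarrow> lin_map (\<lambda>x. L (g x))" for g :: "('a \<Rightarrow> complex) \<Rightarrow> _"
    unfolding L_def by (intro lin_intros)
  have "sw f (\<lambda>a c. G a * trace_form (eps_s y) c) =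
      (\<Sum>i\<in>UNIV. sw f (\<lambda>a c. G a * (c \<cdot> S (S (bas i)) \<cdot> eps_s y) i))"
    by (simp add: trace_form_def sum_distrib_left sweedler_sum)
  also have "\<dots> = (\<Sum>i\<in>UNIV. sw (bas i) (\<lambda>p q. sw (f \<cdot> S (S q)) (\<lambda>a c. G (a \<cdot> S p) * (c \<cdot> eps_s y) i)))"
    by (intro sum.cong refl sw_m_S_S_second linear)
  also have "\<dots> = (\<Sum>i\<in>UNIV. sw (bas i) (\<lambda>p q. sw (L q) (\<lambda>a c. G (a \<cdot> S p) * c i)))"
    unfolding L_def by (intro sum.cong refl sweedler_cong sw_m_eps_s[symmetric] linear)
  also have "\<dots> = (\<Sum>i\<in>UNIV. sw (bas i) (\<lambda>p q. \<Sum>j\<in>UNIV. sw (bas j) (\<lambda>a c. G (a \<cdot> S p) * c i) * L q j))"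
    by (intro sum.cong refl sweedler_cong lin_form_expand lin_intros)
  also have "\<dots> = (\<Sum>i\<in>UNIV. \<Sum>j\<in>UNIV. sw (bas i) (\<lambda>p q. sw (bas j) (\<lambda>a c. L q j * G (a \<cdot> S p) * c i)))"
    unfolding sweedler_sum sweedler_mult_right[symmetric] by (simp add: mult_ac)
  also have "\<dots> = (\<Sum>j\<in>UNIV. \<Sum>i\<in>UNIV. sw (bas j) (\<lambda>a c. sw (bas i) (\<lambda>p q. L q j * G (a \<cdot> S p) * c i)))"
    by (subst sum.swap) (intro sum.cong refl sweedler_swap)
  also have "\<dots> = (\<Sum>j\<in>UNIV. sw (bas j) (\<lambda>a c. \<Sum>i\<in>UNIV. sw (bas i) (\<lambda>p q. L q j * G (a \<cdot> S p)) * c i))"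
    by (simp add: sweedler_sum sweedler_mult_right)
  also have "\<dots> = (\<Sum>j\<in>UNIV. sw (bas j) (\<lambda>a c. sw c (\<lambda>p q. L q j * G (a \<cdot> S p))))"
    by (intro sum.cong refl sweedler_cong lin_form_expand[symmetric] lin_intros)
  also have "\<dots> = (\<Sum>j\<in>UNIV. sw (bas j) (\<lambda>a q. sw a (\<lambda>c p. L q j * G (c \<cdot> S p))))"
    by (simp add: coassoc)
  also have "\<dots> = (\<Sum>j\<in>UNIV. sw (bas j) (\<lambda>a q. L q j * G (eps_t a)))"
    by (intro sum.cong refl sweedler_cong sw_m_S linear)
  finally show ?thesis by (simp add: L_def mult.commute)
qed

lemma left_integral_trace_form: "left_integral (trace_form (eps_s y))"
  unfolding left_integral_def
proof (intro conjI allI impI lin_form_trace_form)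
  fix f and G :: "('a \<Rightarrow> complex) \<Rightarrow> complex" assume G: "lin_form G"
  have "lin_form (\<lambda>x. G (eps_t x))" by (intro lin_intros lin_form_comp[OF G])
  from sw_trace_form[OF this] sw_trace_form[OF G]
  show "sw f (\<lambda>a b. G a * trace_form (eps_s y) b) = sw f (\<lambda>a b. G (eps_t a) * trace_form (eps_s y) b)"
    by (simp add: eps_t_eps_t)
qed

end

section \<open>Sums of matrix algebras\<close>

locale split_algebra = fd_algebra m one
  for m :: "('i::finite \<Rightarrow> complex) \<Rightarrow> ('i \<Rightarrow> complex) \<Rightarrow> ('i \<Rightarrow> complex)" (infixl "\<cdot>" 75) and one +
  fixes n :: "'r::finite \<Rightarrow> nat"
    and \<rho> :: "'r \<Rightarrow> nat \<Rightarrow> nat \<Rightarrow> ('i \<Rightarrow> complex) \<Rightarrow> complex"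
    and E :: "'r \<Rightarrow> nat \<Rightarrow> nat \<Rightarrow> 'i \<Rightarrow> complex"
  assumes n_pos: "n a > 0"
    and lin_form_rho: "lin_form (\<rho> a i j)"
    and rho_m: "i < n a \<Longrightarrow> j < n a \<Longrightarrow> \<rho> a i j (f \<cdot> g) = (\<Sum>h<n a. \<rho> a i h f * \<rho> a h j g)"
    and rho_one: "i < n a \<Longrightarrow> j < n a \<Longrightarrow> \<rho> a i j one = (if i = j then 1 else 0)"
    and rho_E: "i < n a \<Longrightarrow> j < n a \<Longrightarrow> i' < n b \<Longrightarrow> j' < n b \<Longrightarrow>
        \<rho> b i' j' (E a i j) = (if a = b \<and> i = i' \<and> j = j' then 1 else 0)"
    and rho_ext: "(\<And>a i j. i < n a \<Longrightarrow> j < n a \<Longrightarrow> \<rho> a i j f = \<rho> a i j g) \<Longrightarrow> f = g"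
begin

lemma lin_form_rho_comp [lin_intros]: "lin_map g \<Longrightarrow> lin_form (\<lambda>x. \<rho> a i j (g x))"
  by (rule lin_form_comp[OF lin_form_rho])

lemma split_algebra_opposite:
  "split_algebra (\<lambda>x y. y \<cdot> x) one n (\<lambda>a i j. \<rho> a j i) (\<lambda>a i j. E a j i)"
proof unfold_locales
  fix f g assume "\<And>a i j. i < n a \<Longrightarrow> j < n a \<Longrightarrow> \<rho> a j i f = \<rho> a j i g"
  then show "f = g" by (rule rho_ext)
qed (auto simp: m_lin_left m_lin_right m_assoc l_one r_one n_pos lin_form_rho rho_m rho_one rho_E
    mult.commute)

definition tr :: "'r \<Rightarrow> ('i \<Rightarrow> complex) \<Rightarrow> complex" where
  "tr a f = (\<Sum>i<n a. \<rho> a i i f)"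

lemma lin_form_tr [lin_intros]: "lin_map g \<Longrightarrow> lin_form (\<lambda>x. tr a (g x))"
  unfolding tr_def by (intro lin_intros)

lemma tr_commute: "tr a (f \<cdot> g) = tr a (g \<cdot> f)"
proof -
  have "tr a (f \<cdot> g) = (\<Sum>i<n a. \<Sum>h<n a. \<rho> a i h f * \<rho> a h i g)"
    unfolding tr_def by (simp add: rho_m)
  also have "\<dots> = tr a (g \<cdot> f)"
    unfolding tr_def by (subst sum.swap) (simp add: rho_m mult.commute)
  finally show ?thesis .
qed

lemma rho_m_E:
  assumes "i < n a" "j < n a" "i' < n b" "j' < n b"
  shows "\<rho> b i' j' (z \<cdot> E a i j) = (if a = b \<and> j = j' then \<rho> a i' i z else 0)"
proof -
  have "\<rho> b i' j' (z \<cdot> E a i j) = (\<Sum>h<n b. if h = i then (if a = b \<and> j = j' then \<rho> a i' i z else 0) else 0)"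
    unfolding rho_m[OF assms(3,4)] using assms by (intro sum.cong refl) (auto simp: rho_E)
  then show ?thesis using assms by auto
qed

lemma rho_E_m:
  "i < n a \<Longrightarrow> j < n a \<Longrightarrow> i' < n b \<Longrightarrow> j' < n b \<Longrightarrow>
    \<rho> b i' j' (E a i j \<cdot> z) = (if a = b \<and> i = i' then \<rho> a j j' z else 0)"
  using split_algebra.rho_m_E[OF split_algebra_opposite, of j a i j' b i' z] by simp

lemma tr_m_E: "i < n a \<Longrightarrow> j < n a \<Longrightarrow> tr b (f \<cdot> E a j i) = (if a = b then \<rho> a i j f else 0)"
  by (cases "a = b") (auto simp: tr_def rho_m_E)

definition scalar_on :: "'r \<Rightarrow> ('i \<Rightarrow> complex) \<Rightarrow> complex \<Rightarrow> bool" where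
  "scalar_on a z c \<longleftrightarrow> (\<forall>i<n a. \<forall>j<n a. \<rho> a i j z = (if i = j then c else 0))"

lemma scalar_on_left: "scalar_on a z c \<Longrightarrow> i < n a \<Longrightarrow> j < n a \<Longrightarrow> \<rho> a i j (z \<cdot> f) = c * \<rho> a i j f"
  by (simp add: rho_m scalar_on_def if_distrib[of "\<lambda>x. x * _"] cong: if_cong)

lemma scalar_on_right: "scalar_on a z c \<Longrightarrow> i < n a \<Longrightarrow> j < n a \<Longrightarrow> \<rho> a i j (f \<cdot> z) = c * \<rho> a i j f"
  by (simp add: rho_m scalar_on_def if_distrib[of "\<lambda>x. _ * x"] mult.commute cong: if_cong)

lemma scalar_on_tr: "scalar_on a z c \<Longrightarrow> tr a z = c * of_nat (n a)"
  by (simp add: tr_def scalar_on_def)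

lemma scalar_on_tr_left: "scalar_on a z c \<Longrightarrow> tr a (z \<cdot> f) = c * tr a f"
  by (simp add: tr_def scalar_on_left sum_distrib_left)

lemma scalar_on_tr_right: "scalar_on a z c \<Longrightarrow> tr a (f \<cdot> z) = c * tr a f"
  unfolding tr_commute[of a f z] by (rule scalar_on_tr_left)

lemma scalar_on_lincomb:
  "(\<And>k. k \<in> K \<Longrightarrow> scalar_on a (z k) (s k)) \<Longrightarrow> scalar_on a (\<lambda>i. \<Sum>k\<in>K. c k * z k i) (\<Sum>k\<in>K. c k * s k)"
  unfolding scalar_on_def by (auto simp: lin_form_lincomb[OF lin_form_rho])

lemma central_scalar_on:
  assumes "\<And>f. f \<cdot> z = z \<cdot> f"
  shows "scalar_on a z (\<rho> a 0 0 z)"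
  unfolding scalar_on_def
proof (intro allI impI)
  fix i j assume i: "i < n a" and j: "j < n a"
  have "\<rho> a i 0 (E a j 0 \<cdot> z) = \<rho> a i 0 (z \<cdot> E a j 0)" using assms by simp
  then show "\<rho> a i j z = (if i = j then \<rho> a 0 0 z else 0)"
    using i j n_pos[of a] by (auto simp: rho_E_m rho_m_E split: if_splits)
qed

definition block_unit :: "'r \<Rightarrow> 'i \<Rightarrow> complex" where
  "block_unit a = (\<lambda>x. \<Sum>i<n a. E a i i x)"

lemma scalar_on_block_unit: "scalar_on b (block_unit a) (if a = b then 1 else 0)"
  unfolding scalar_on_def block_unit_def by (simp add: lin_form_sum[OF lin_form_rho] rho_E)

lemma block_unit_central: "block_unit a \<cdot> f = f \<cdot> block_unit a"
  by (rule rho_ext) (simp add: scalar_on_left[OF scalar_on_block_unit]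
      scalar_on_right[OF scalar_on_block_unit])

lemma block_unit_orthogonal: "block_unit a \<cdot> block_unit b = (if a = b then block_unit a else (\<lambda>_. 0))"
  by (rule rho_ext) (use scalar_on_block_unit in
    \<open>auto simp: scalar_on_left[OF scalar_on_block_unit] scalar_on_def lin_form_zero[OF lin_form_rho]\<close>)

definition matrix_indices :: "('r \<times> nat \<times> nat) set" where
  "matrix_indices = (SIGMA a:UNIV. {..<n a} \<times> {..<n a})"

lemma sum_matrix_indices:
  "(\<Sum>(a, s, t)\<in>matrix_indices. F a s t) = (\<Sum>a\<in>UNIV. \<Sum>s<n a. \<Sum>t<n a. F a s t)"
  by (simp add: matrix_indices_def sum.Sigma)

lemma matrix_unit_expand: "z = (\<lambda>p. \<Sum>(a, s, t)\<in>matrix_indices. \<rho> a s t z * E a s t p)"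
proof (rule rho_ext)
  fix b i j assume ij: "i < n b" "j < n b"
  then have "(b, i, j) \<in> matrix_indices" "finite matrix_indices" by (auto simp: matrix_indices_def)
  then have "\<rho> b i j z = (\<Sum>k\<in>matrix_indices. if k = (b, i, j) then \<rho> b i j z else 0)"
    by simp
  also have "\<dots> = (\<Sum>(a, s, t)\<in>matrix_indices. \<rho> a s t z * \<rho> b i j (E a s t))"
    using ij by (intro sum.cong refl) (auto simp: matrix_indices_def rho_E split: if_splits)
  finally show "\<rho> b i j z = \<rho> b i j (\<lambda>p. \<Sum>(a, s, t)\<in>matrix_indices. \<rho> a s t z * E a s t p)"
    by (simp add: split_def lin_form_lincomb[OF lin_form_rho])
qed

lemma trace_in_matrix_units:
  assumes "lin_map A"
  shows "(\<Sum>i\<in>UNIV. A (bas i) i) = (\<Sum>(a, s, t)\<in>matrix_indices. \<rho> a s t (A (E a s t)))"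
proof -
  have "(\<Sum>i\<in>UNIV. A (bas i) i) = (\<Sum>i\<in>UNIV. \<Sum>(a, s, t)\<in>matrix_indices. \<rho> a s t (A (bas i)) * E a s t i)"
    by (intro sum.cong refl) (rule fun_cong[OF matrix_unit_expand])
  also have "\<dots> = (\<Sum>(a, s, t)\<in>matrix_indices. \<Sum>i\<in>UNIV. \<rho> a s t (A (bas i)) * E a s t i)"
    by (subst sum.swap) (simp add: split_def)
  also have "\<dots> = (\<Sum>(a, s, t)\<in>matrix_indices. \<rho> a s t (A (E a s t)))"
    by (intro sum.cong refl) (auto intro!: lin_form_expand[symmetric] lin_form_rho_comp assms)
  finally show ?thesis .
qed

lemma trace_two_sided_mult: "(\<Sum>i\<in>UNIV. (x \<cdot> bas i \<cdot> y) i) = (\<Sum>a\<in>UNIV. tr a x * tr a y)"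
proof -
  have "(\<Sum>i\<in>UNIV. (x \<cdot> bas i \<cdot> y) i) = (\<Sum>a\<in>UNIV. \<Sum>s<n a. \<Sum>t<n a. \<rho> a s t (x \<cdot> E a s t \<cdot> y))"
    unfolding sum_matrix_indices[symmetric]
    by (intro trace_in_matrix_units[of "\<lambda>z. x \<cdot> z \<cdot> y"] lin_intros)
  also have "\<dots> = (\<Sum>a\<in>UNIV. \<Sum>s<n a. \<Sum>t<n a. \<rho> a s s x * \<rho> a t t y)"
    by (intro sum.cong refl) (simp add: rho_m[of _ _ _ "x \<cdot> _"] rho_m_E if_distrib[of "\<lambda>x. x * _"]
        cong: if_cong)
  finally show ?thesis by (simp add: tr_def sum_product)
qed

end

section \<open>Fusion rules\<close>

text \<open>Fusion enters only through the vanishing of products of matrix coefficients and the decomposition of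
products of characters.\<close>

locale fusion_weak_hopf = weak_hopf m one \<Delta> \<epsilon> S + split_algebra m one n \<rho> E
  for m :: "('i::finite \<Rightarrow> complex) \<Rightarrow> ('i \<Rightarrow> complex) \<Rightarrow> ('i \<Rightarrow> complex)" (infixl "\<cdot>" 75)
    and one \<Delta> \<epsilon> S and n :: "'r::finite \<Rightarrow> nat" and \<rho> E +
  fixes N :: "'r \<Rightarrow> 'r \<Rightarrow> 'r \<Rightarrow> nat"
    and vacs :: "'r set"
    and u v :: "'r \<Rightarrow> nat \<Rightarrow> complex"
    and l r :: "'r \<Rightarrow> 'r"
  assumes counit_rho: "\<epsilon> f = (\<Sum>e\<in>vacs. \<Sum>i<n e. \<Sum>j<n e. u e i * \<rho> e i j f * v e j)"
    and fusion_zero: "(\<And>c i j. N a b c \<noteq> 0 \<Longrightarrow> i < n c \<Longrightarrow> j < n c \<Longrightarrow> \<rho> c i j f = 0) \<Longrightarrow>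
        i < n a \<Longrightarrow> j < n a \<Longrightarrow> i' < n b \<Longrightarrow> j' < n b \<Longrightarrow> sw f (\<lambda>p q. \<rho> a i j p * \<rho> b i' j' q) = 0"
    and fusion_trace: "sw f (\<lambda>p q. tr a p * tr b q) = (\<Sum>c\<in>UNIV. of_nat (N a b c) * tr c f)"
    and l_vac: "l a \<in> vacs" and r_vac: "r a \<in> vacs"
    and N_left: "e \<in> vacs \<Longrightarrow> N e a c = (if e = l a \<and> a = c then 1 else 0)"
    and N_right: "e \<in> vacs \<Longrightarrow> N a e c = (if e = r a \<and> a = c then 1 else 0)"
begin

lemma fusion_opposite:
  "fusion_weak_hopf (\<lambda>x y. y \<cdot> x) one (coopposite \<Delta>) \<epsilon> S n (\<lambda>a i j. \<rho> a j i) (\<lambda>a i j. E a j i)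
    (\<lambda>a b c. N b a c) vacs v u r l"
proof -
  interpret op: weak_hopf "\<lambda>x y. y \<cdot> x" one "coopposite \<Delta>" \<epsilon> S by (rule opposite)
  interpret op: split_algebra "\<lambda>x y. y \<cdot> x" one n "\<lambda>a i j. \<rho> a j i" "\<lambda>a i j. E a j i"
    by (rule split_algebra_opposite)
  show ?thesis
  proof
    show "\<epsilon> f = (\<Sum>e\<in>vacs. \<Sum>i<n e. \<Sum>j<n e. v e i * \<rho> e j i f * u e j)" for f
      unfolding counit_rho[of f] by (rule sum.cong[OF refl], subst sum.swap) (simp add: mult_ac)
    show "op.sw f (\<lambda>p q. \<rho> a j i p * \<rho> b j' i' q) = 0"
      if "\<And>c i j. N b a c \<noteq> 0 \<Longrightarrow> i < n c \<Longrightarrow> j < n c \<Longrightarrow> \<rho> c j i f = 0"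
        "i < n a" "j < n a" "i' < n b" "j' < n b"
      for a b i j i' j' f
      using fusion_zero[of b a f j' i' j i] that by (simp add: sweedler_coopposite mult.commute)
    show "op.sw f (\<lambda>p q. op.tr a p * op.tr b q) = (\<Sum>c\<in>UNIV. of_nat (N b a c) * op.tr c f)" for f a b
      using fusion_trace[of f b a] by (simp add: sweedler_coopposite mult.commute op.tr_def tr_def)
  qed (simp_all add: l_vac r_vac N_left N_right)
qed

lemma block_unit_opposite: "split_algebra.block_unit n (\<lambda>a i j. E a j i) = block_unit"
  by (simp add: split_algebra.block_unit_def[OF split_algebra_opposite] block_unit_def fun_eq_iff)

lemma scalar_on_opposite: "split_algebra.scalar_on n (\<lambda>a i j. \<rho> a j i) = scalar_on"
  by (auto simp: split_algebra.scalar_on_def[OF split_algebra_opposite] scalar_on_def fun_eq_iff)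

lemma counit_block_unit:
  "\<epsilon> (block_unit e \<cdot> f) = (if e \<in> vacs then \<Sum>i<n e. \<Sum>j<n e. u e i * \<rho> e i j f * v e j else 0)"
proof -
  have "\<epsilon> (block_unit e \<cdot> f) = (\<Sum>a\<in>vacs. if e = a then \<Sum>i<n a. \<Sum>j<n a. u a i * \<rho> a i j f * v a j else 0)"
    unfolding counit_rho by (intro sum.cong refl) (simp add: scalar_on_left[OF scalar_on_block_unit])
  then show ?thesis by simp
qed

lemma counit_sum_block_unit: "\<epsilon> f = (\<Sum>e\<in>vacs. \<epsilon> (block_unit e \<cdot> f))"
  unfolding counit_rho[of f] by (simp add: counit_block_unit)

lemma counit_scalar_on:
  assumes "\<And>e. e \<in> vacs \<Longrightarrow> scalar_on e z (s e)"
  shows "\<epsilon> (z \<cdot> f) = (\<Sum>e\<in>vacs. s e * \<epsilon> (block_unit e \<cdot> f))"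
  unfolding counit_rho[of "z \<cdot> f"]
  by (intro sum.cong refl) (simp add: counit_block_unit scalar_on_left[OF assms] sum_distrib_left
      mult_ac)

lemma counit_block_unit_left_zero:
  assumes e: "e \<in> vacs" "e \<noteq> l a" and ij: "i < n a" "j < n a"
  shows "sw f (\<lambda>p q. \<epsilon> (block_unit e \<cdot> p) * \<rho> a i j q) = 0"
proof -
  have "sw f (\<lambda>p q. \<epsilon> (block_unit e \<cdot> p) * \<rho> a i j q) =
    (\<Sum>i'<n e. \<Sum>j'<n e. u e i' * v e j' * sw f (\<lambda>p q. \<rho> e i' j' p * \<rho> a i j q))"
    unfolding sweedler_mult_left[symmetric] sweedler_sum[symmetric] counit_block_unit using e(1)
    by (simp add: sum_distrib_right mult_ac sum_distrib_left)
  also have "\<dots> = 0"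
  proof (intro sum.neutral ballI)
    fix i' j' assume "i' \<in> {..<n e}" "j' \<in> {..<n e}"
    then have "sw f (\<lambda>p q. \<rho> e i' j' p * \<rho> a i j q) = 0"
      using e ij by (intro fusion_zero) (auto simp: N_left)
    then show "u e i' * v e j' * sw f (\<lambda>p q. \<rho> e i' j' p * \<rho> a i j q) = 0" by simp
  qed
  finally show ?thesis .
qed

lemma sw_counit_block_unit_rho:
  assumes e: "e \<in> vacs" and ij: "i < n a" "j < n a"
  shows "sw f (\<lambda>p q. \<epsilon> (block_unit e \<cdot> p) * \<rho> a i j q) = (if e = l a then \<rho> a i j f else 0)"
proof -
  have "\<rho> a i j f = sw f (\<lambda>p q. \<epsilon> p * \<rho> a i j q)"
    by (rule counit_left[symmetric, OF lin_form_rho])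
  also have "\<dots> = (\<Sum>e\<in>vacs. sw f (\<lambda>p q. \<epsilon> (block_unit e \<cdot> p) * \<rho> a i j q))"
    by (subst counit_sum_block_unit) (simp add: sum_distrib_right sweedler_sum)
  also have "\<dots> = sw f (\<lambda>p q. \<epsilon> (block_unit (l a) \<cdot> p) * \<rho> a i j q)"
    using ij by (subst sum.remove[OF _ l_vac[of a]]) (simp_all add: counit_block_unit_left_zero)
  finally show ?thesis using counit_block_unit_left_zero[OF e _ ij] by auto
qed

lemma scalar_on_eps_t_block_unit:
  "e \<in> vacs \<Longrightarrow> scalar_on a (eps_t (block_unit e)) (if e = l a then 1 else 0)"
  unfolding scalar_on_def
  by (simp add: lin_form_eps_t[OF lin_form_rho] block_unit_central[symmetric] sw_counit_block_unit_rho
      rho_one)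

lemma scalar_on_eps_s_block_unit:
  "e \<in> vacs \<Longrightarrow> scalar_on a (eps_s (block_unit e)) (if e = r a then 1 else 0)"
  using fusion_weak_hopf.scalar_on_eps_t_block_unit[OF fusion_opposite]
  by (simp add: opposite_eps block_unit_opposite scalar_on_opposite)

lemma l_vac_id: "e \<in> vacs \<Longrightarrow> l e = e"
  using N_left[OF l_vac[of e], of e e] N_right[of e "l e" e] by (metis zero_neq_one)

lemma S_eps_t_block_unit:
  assumes e: "e \<in> vacs"
  shows "S (eps_t (block_unit e)) = eps_s (block_unit e)"
proof -
  have "\<epsilon> (eps_t (block_unit e) \<cdot> f) = (\<Sum>a\<in>vacs. (if e = a then 1 else 0) * \<epsilon> (block_unit a \<cdot> f))" for f
    by (rule counit_scalar_on) (use scalar_on_eps_t_block_unit[OF e] l_vac_id in metis)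
  then have "\<epsilon> (eps_t (block_unit e) \<cdot> f) = \<epsilon> (block_unit e \<cdot> f)" for f
    using e by (simp add: if_distrib[of "\<lambda>x. x * _"] cong: if_cong)
  then show ?thesis by (simp add: S_eps_t eps_s_def)
qed

lemma fusion_preserves_l:
  assumes "N a c b \<noteq> 0"
  shows "l b = l a"
proof -
  let ?P = "eps_t (block_unit (l b))"
  have "sw (?P \<cdot> block_unit b) (\<lambda>x y. tr a x * tr c y) =
      (\<Sum>b'\<in>UNIV. of_nat (N a c b') * tr b' (?P \<cdot> block_unit b))"
    by (rule fusion_trace)
  also have "\<dots> = (\<Sum>b'\<in>UNIV. if b' = b then of_nat (N a c b * n b) else 0)"
    by (intro sum.cong refl)
      (simp add: scalar_on_tr_left[OF scalar_on_eps_t_block_unit[OF l_vac]]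
          scalar_on_tr[OF scalar_on_block_unit])
  finally have nonzero: "sw (?P \<cdot> block_unit b) (\<lambda>x y. tr a x * tr c y) \<noteq> 0"
    using assms n_pos[of b] by simp
  have "sw (?P \<cdot> block_unit b) (\<lambda>x y. tr a x * tr c y) =
      sw (block_unit b) (\<lambda>x y. tr a (?P \<cdot> x) * tr c y)"
    by (rule sw_eps_t_m) (intro lin_intros)
  also have "\<dots> = (if l b = l a then 1 else 0) * sw (block_unit b) (\<lambda>x y. tr a x * tr c y)"
    by (simp add: scalar_on_tr_left[OF scalar_on_eps_t_block_unit[OF l_vac]] sweedler_mult_left
        mult.assoc)
  finally show ?thesis using nonzero by (auto split: if_splits)
qed

text \<open>Otherwise applying $S \otimes \mathrm{id}$ and multiplying gives $\psi_c(\varepsilon_s(P)) = 0$ for the block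
projector $P$ of $r_c$, although this matrix is the identity.\<close>

lemma fusion_conjugate_nonzero:
  assumes conjugate: "\<And>i j f. i < n c \<Longrightarrow> j < n c \<Longrightarrow>
      \<rho> c i j (S f) = (\<Sum>s<n c'. \<Sum>t<n c'. A i j s t * \<rho> c' s t f)"
  shows "N c' c (r c) \<noteq> 0"
proof
  assume N: "N c' c (r c) = 0"
  let ?P = "block_unit (r c)"
  have vanish: "sw ?P (\<lambda>p q. \<rho> c' s t p * \<rho> c i j q) = 0" if "s < n c'" "t < n c'" "i < n c" "j < n c"
      for s t i j
    using scalar_on_block_unit N that by (intro fusion_zero) (auto simp: scalar_on_def)
  have "1 = \<rho> c 0 0 (eps_s ?P)"
    using scalar_on_eps_s_block_unit[OF r_vac, of c c] n_pos[of c] by (simp add: scalar_on_def)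
  also have "\<dots> = sw ?P (\<lambda>p q. \<rho> c 0 0 (S p \<cdot> q))"
    by (rule sw_S_m[symmetric, OF lin_form_rho])
  also have "\<dots> = (\<Sum>h<n c. \<Sum>s<n c'. \<Sum>t<n c'. A 0 h s t * sw ?P (\<lambda>p q. \<rho> c' s t p * \<rho> c h 0 q))"
    unfolding sweedler_mult_left[symmetric] sweedler_sum[symmetric]
    by (simp add: rho_m conjugate n_pos sum_distrib_right mult.assoc)
  also have "\<dots> = 0" by (simp add: vanish n_pos)
  finally show False by simp
qed

lemma l_conjugate:
  assumes "\<And>f. tr a' f = tr a (S f)"
  shows "l a' = r a"
proof -
  have "tr a' (eps_t (block_unit (l a'))) = tr a (eps_s (block_unit (l a')))"
    by (simp add: assms S_eps_t_block_unit l_vac)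
  then show ?thesis
    using n_pos[of a'] by (simp add: scalar_on_tr[OF scalar_on_eps_t_block_unit[OF l_vac]]
        scalar_on_tr[OF scalar_on_eps_s_block_unit[OF l_vac]] split: if_splits)
qed

end

section \<open>Spherical elements\<close>

text \<open>\<open>bar a\<close> is the class of the contragredient of \<open>a\<close>.\<close>

locale pivotal_fusion_weak_hopf = fusion_weak_hopf m one \<Delta> \<epsilon> S n \<rho> E N vacs u v l r
    + pivotal_weak_hopf m one \<Delta> \<epsilon> S k ki
  for m :: "('i::finite \<Rightarrow> complex) \<Rightarrow> ('i \<Rightarrow> complex) \<Rightarrow> ('i \<Rightarrow> complex)" (infixl "\<cdot>" 75)
    and one \<Delta> \<epsilon> S
    and n :: "'r::finite \<Rightarrow> nat" and \<rho> E N vacs u v l r k ki +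
  fixes bar :: "'r \<Rightarrow> 'r"
  assumes tr_bar: "tr (bar a) f = tr a (S f)"
begin

lemma bar_bar: "bar (bar a) = a"
proof -
  have "tr (bar (bar a)) (block_unit a) = tr a (k \<cdot> (block_unit a \<cdot> ki))"
    by (simp add: tr_bar S_S m_assoc)
  also have "\<dots> = tr a (block_unit a)"
    by (subst tr_commute) (simp add: m_assoc ki_inv r_one)
  finally show ?thesis
    using n_pos[of a] by (simp add: scalar_on_tr[OF scalar_on_block_unit] split: if_splits)
qed

lemma l_bar: "l (bar a) = r a"
  by (rule l_conjugate) (rule tr_bar)

lemma r_bar: "r (bar a) = l a"
  using l_bar[of "bar a"] by (simp add: bar_bar)

definition twisted_tr :: "'r \<Rightarrow> ('i \<Rightarrow> complex) \<Rightarrow> complex" where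
  "twisted_tr a f = tr a (f \<cdot> k)"

lemma lin_form_twisted_tr [lin_intros]: "lin_map g \<Longrightarrow> lin_form (\<lambda>x. twisted_tr a (g x))"
  unfolding twisted_tr_def by (intro lin_intros)

lemma twisted_tr_S_S: "twisted_tr a (g \<cdot> f) = twisted_tr a (f \<cdot> S (S g))"
  using tr_commute[of a g "f \<cdot> k"] unfolding twisted_tr_def S_S by (simp add: m_assoc ki_inv r_one)

lemma twisted_tr_eps_t_block_unit:
  "e \<in> vacs \<Longrightarrow> twisted_tr a (eps_t (block_unit e)) = (if e = l a then tr a k else 0)"
  by (simp add: twisted_tr_def scalar_on_tr_left[OF scalar_on_eps_t_block_unit])

lemma twisted_tr_eps_t_expand:
  "\<exists>s. \<forall>z. twisted_tr a (eps_t z) = (\<Sum>e\<in>vacs. s e * \<epsilon> (block_unit e \<cdot> z))"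
proof -
  let ?q = "target_density (twisted_tr a)"
  have lin: "lin_form (twisted_tr a)" by (rule lin_form_twisted_tr[OF lin_map_id])
  have "scalar_on b ?q (\<rho> b 0 0 ?q)" for b
    by (rule central_scalar_on) (rule target_density_central[OF lin twisted_tr_S_S])
  then have "twisted_tr a (eps_t z) = (\<Sum>e\<in>vacs. \<rho> e 0 0 ?q * \<epsilon> (block_unit e \<cdot> z))" for z
    by (subst counit_target_density[OF lin, symmetric]) (rule counit_scalar_on)
  then show ?thesis by (intro exI allI)
qed

lemma sw_twisted_tr:
  "sw f (\<lambda>x y. twisted_tr a x * twisted_tr c y) =
    (\<Sum>b\<in>UNIV. of_nat (N a c b) * twisted_tr b f)"
  unfolding twisted_tr_def fusion_trace[symmetric] by (rule sw_m_k[symmetric]) (intro lin_intros)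

lemma sw_counit_block_unit_twisted_tr:
  assumes e: "e \<in> vacs"
  shows "sw f (\<lambda>x y. \<epsilon> (block_unit e \<cdot> x) * twisted_tr b y) = (if e = l b then twisted_tr b f else 0)"
proof -
  have expand: "twisted_tr b y = (\<Sum>i<n b. \<Sum>h<n b. \<rho> b h i k * \<rho> b i h y)" for y
    unfolding twisted_tr_def tr_def by (simp add: rho_m mult.commute)
  have "sw f (\<lambda>x y. \<epsilon> (block_unit e \<cdot> x) * twisted_tr b y) =
     (\<Sum>i<n b. \<Sum>h<n b. \<rho> b h i k * sw f (\<lambda>x y. \<epsilon> (block_unit e \<cdot> x) * \<rho> b i h y))"
    unfolding sweedler_mult_left[symmetric] sweedler_sum[symmetric] expand
    by (simp add: sum_distrib_left mult_ac)
  also have "\<dots> = (if e = l b then twisted_tr b f else 0)"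
    by (simp add: sw_counit_block_unit_rho[OF e] expand)
  finally show ?thesis .
qed

lemma twisted_tr_E_ki: "twisted_tr b (E a 0 0 \<cdot> ki) = (if a = b then 1 else 0)"
proof -
  have "twisted_tr b (E a 0 0 \<cdot> ki) = tr b (one \<cdot> E a 0 0)"
    by (simp add: twisted_tr_def m_assoc ki_inv l_one r_one)
  then show ?thesis using n_pos[of a] by (auto simp: tr_m_E rho_one)
qed

end

locale spherical_weak_hopf = pivotal_fusion_weak_hopf m one \<Delta> \<epsilon> S n \<rho> E N vacs u v l r k ki bar
  for m :: "('i::finite \<Rightarrow> complex) \<Rightarrow> ('i \<Rightarrow> complex) \<Rightarrow> ('i \<Rightarrow> complex)" (infixl "\<cdot>" 75)
    and one \<Delta> \<epsilon> S
    and n :: "'r::finite \<Rightarrow> nat" and \<rho> E N vacs u v l r k ki bar +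
  assumes counit_block_unit_nonzero: "e \<in> vacs \<Longrightarrow> \<epsilon> (block_unit e) \<noteq> 0"
    and spherical: "tr a k / \<epsilon> (block_unit (l a)) = tr a ki / \<epsilon> (block_unit (r a))"
    and tr_k_nonzero: "tr a k \<noteq> 0"
begin

definition qdim :: "'r \<Rightarrow> complex" where
  "qdim a = tr a k / \<epsilon> (block_unit (l a))"

lemma qdim_nonzero: "qdim a \<noteq> 0"
  by (simp add: qdim_def tr_k_nonzero counit_block_unit_nonzero l_vac)

lemma tr_k: "tr a k = qdim a * \<epsilon> (block_unit (l a))"
  by (simp add: qdim_def counit_block_unit_nonzero l_vac)

lemma tr_ki: "tr a ki = qdim a * \<epsilon> (block_unit (r a))"
  using spherical[of a] by (simp add: qdim_def counit_block_unit_nonzero r_vac l_vac field_simps)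

lemma twisted_tr_eps_t: "twisted_tr a (eps_t z) = qdim a * \<epsilon> (block_unit (l a) \<cdot> z)"
proof -
  obtain s where s: "\<And>z. twisted_tr a (eps_t z) = (\<Sum>e\<in>vacs. s e * \<epsilon> (block_unit e \<cdot> z))"
    using twisted_tr_eps_t_expand by blast
  have "s e = (if e = l a then qdim a else 0)" if e: "e \<in> vacs" for e
  proof -
    have "twisted_tr a (eps_t (block_unit e)) = s e * \<epsilon> (block_unit e)"
      using e by (simp add: s block_unit_orthogonal if_distrib[of \<epsilon>] lin_form_zero[OF lin_form_\<epsilon>]
          if_distrib[of "\<lambda>x. _ * x"] cong: if_cong)
    then show ?thesis
      using counit_block_unit_nonzero[OF e]
      by (auto simp: twisted_tr_eps_t_block_unit[OF e] tr_k split: if_splits)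
  qed
  then have "twisted_tr a (eps_t z) = (\<Sum>e\<in>vacs. if e = l a then qdim a * \<epsilon> (block_unit e \<cdot> z) else 0)"
    unfolding s by (intro sum.cong refl) simp
  then show ?thesis by (simp add: l_vac)
qed

lemma eps_s_weighted_scalar_on:
  "scalar_on a (eps_s (\<lambda>i. \<Sum>e\<in>vacs. c e * block_unit e i)) (c (r a))"
proof -
  have "eps_s (\<lambda>i. \<Sum>e\<in>vacs. c e * block_unit e i) = (\<lambda>i. \<Sum>e\<in>vacs. c e * eps_s (block_unit e) i)"
  proof (rule ext)
    fix i show "eps_s (\<lambda>i. \<Sum>e\<in>vacs. c e * block_unit e i) i = (\<Sum>e\<in>vacs. c e * eps_s (block_unit e) i)"
      by (rule lin_form_lincomb[of "\<lambda>x. eps_s x i"]) (intro lin_intros)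
  qed
  then have "scalar_on a (eps_s (\<lambda>i. \<Sum>e\<in>vacs. c e * block_unit e i)) (\<Sum>e\<in>vacs. c e * (if e = r a then 1 else 0))"
    using scalar_on_lincomb[of vacs a, OF scalar_on_eps_s_block_unit] by simp
  then show ?thesis by (simp add: if_distrib[of "\<lambda>x. _ * x"] r_vac cong: if_cong)
qed

lemma left_integral_weighted: "left_integral (\<lambda>f. \<Sum>a\<in>UNIV. \<gamma> (r a) * qdim a * twisted_tr a f)"
proof -
  define y where "y = (\<lambda>i. \<Sum>e\<in>vacs. \<gamma> e / \<epsilon> (block_unit e) * block_unit e i)"
  have scalar: "scalar_on a (eps_s y) (\<gamma> (r a) / \<epsilon> (block_unit (r a)))" for a
    unfolding y_def by (rule eps_s_weighted_scalar_on)
  have "trace_form (eps_s y) f = (\<Sum>a\<in>UNIV. \<gamma> (r a) * qdim a * twisted_tr a f)" for f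
  proof -
    have "trace_form (eps_s y) f = (\<Sum>i\<in>UNIV. (f \<cdot> k \<cdot> bas i \<cdot> (ki \<cdot> eps_s y)) i)"
      unfolding trace_form_def S_S by (simp add: m_assoc)
    also have "\<dots> = (\<Sum>a\<in>UNIV. twisted_tr a f * tr a (ki \<cdot> eps_s y))"
      by (simp add: trace_two_sided_mult twisted_tr_def)
    also have "\<dots> = (\<Sum>a\<in>UNIV. \<gamma> (r a) * qdim a * twisted_tr a f)"
      by (intro sum.cong refl) (simp add: scalar_on_tr_right[OF scalar] tr_ki
          counit_block_unit_nonzero r_vac)
    finally show ?thesis .
  qed
  then have "trace_form (eps_s y) = (\<lambda>f. \<Sum>a\<in>UNIV. \<gamma> (r a) * qdim a * twisted_tr a f)" by (rule ext)
  then show ?thesis using left_integral_trace_form[of y] by (simp only:)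
qed

lemma fusion_qdim_source:
  "(\<Sum>c\<in>UNIV. of_nat (N a c b) * qdim c) =
    (if l a = l b then qdim a * qdim b else 0)"
proof -
  define \<Lambda> where "\<Lambda> f = (\<Sum>c\<in>UNIV. qdim c * twisted_tr c f)" for f
  have \<Lambda>: "left_integral \<Lambda>"
    using left_integral_weighted[of "\<lambda>_. 1"] unfolding \<Lambda>_def by simp
  define f where "f = E b 0 0 \<cdot> ki"
  have "(\<Sum>c\<in>UNIV. of_nat (N a c b) * qdim c) =
      (\<Sum>c\<in>UNIV. qdim c * sw f (\<lambda>x y. twisted_tr a x * twisted_tr c y))"
    unfolding sw_twisted_tr f_def twisted_tr_E_ki
    by (simp add: if_distrib[of "\<lambda>x. _ * x"] mult.commute cong: if_cong)
  also have "\<dots> = sw f (\<lambda>x y. twisted_tr a x * \<Lambda> y)"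
    unfolding sweedler_mult_left[symmetric] sweedler_sum[symmetric] \<Lambda>_def
    by (simp add: sum_distrib_left mult_ac)
  also have "\<dots> = sw f (\<lambda>x y. twisted_tr a (eps_t x) * \<Lambda> y)"
    by (rule left_integral_eps_t[OF \<Lambda>]) (intro lin_intros)
  also have "\<dots> = (\<Sum>c\<in>UNIV. qdim a * qdim c * sw f (\<lambda>x y. \<epsilon> (block_unit (l a) \<cdot> x) * twisted_tr c y))"
    unfolding sweedler_mult_left[symmetric] sweedler_sum[symmetric] \<Lambda>_def twisted_tr_eps_t
    by (simp add: sum_distrib_left mult_ac)
  also have "\<dots> = (\<Sum>c\<in>UNIV. if b = c then (if l a = l b then qdim a * qdim b else 0) else 0)"
    unfolding sw_counit_block_unit_twisted_tr[OF l_vac] f_def twisted_tr_E_ki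
    by (intro sum.cong refl) auto
  finally show ?thesis by simp
qed

lemma fusion_qdim_target:
  "(\<Sum>b\<in>UNIV. of_nat (N a c b) * qdim b) =
    (if r a = l c then qdim a * qdim c else 0)"
proof -
  have "(\<Sum>b\<in>UNIV. of_nat (N a c b) * qdim b) * \<epsilon> (block_unit (l a)) =
      (\<Sum>b\<in>UNIV. of_nat (N a c b) * tr b k)"
    unfolding sum_distrib_right
  proof (intro sum.cong refl)
    fix b show "of_nat (N a c b) * qdim b * \<epsilon> (block_unit (l a)) = of_nat (N a c b) * tr b k"
      using fusion_preserves_l[of a c b] by (cases "N a c b = 0") (simp_all add: tr_k)
  qed
  also have "\<dots> = sw one (\<lambda>x y. twisted_tr a x * twisted_tr c y)"
    unfolding sw_twisted_tr by (simp add: twisted_tr_def l_one)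
  also have "\<dots> = sw one (\<lambda>x y. twisted_tr a x * twisted_tr c (eps_t y))"
    by (rule sw_one_eps_t[symmetric]) (intro lin_intros)
  also have "\<dots> = qdim c * sw one (\<lambda>x y. twisted_tr a x * \<epsilon> (block_unit (l c) \<cdot> y))"
    unfolding twisted_tr_eps_t sweedler_mult_left[symmetric] by (simp add: mult_ac)
  also have "\<dots> = qdim c * twisted_tr a (eps_s (block_unit (l c)))"
    using lin_form_eps_s[OF lin_form_twisted_tr[OF lin_map_id], of a "block_unit (l c)"]
    by (simp add: mult.commute)
  also have "\<dots> = qdim c * ((if l c = r a then 1 else 0) * tr a k)"
    unfolding twisted_tr_def scalar_on_tr_left[OF scalar_on_eps_s_block_unit[OF l_vac]] ..
  finally show ?thesis using counit_block_unit_nonzero[OF l_vac[of a]]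
    by (auto simp: tr_k split: if_splits)
qed

definition sector_dim :: "'r \<Rightarrow> real" where
  "sector_dim e = (\<Sum>x\<in>{x. l x = e}. (cmod (qdim x))\<^sup>2)"

lemma cnj_qdim_mult: "cnj (qdim x) * qdim x = complex_of_real ((cmod (qdim x))\<^sup>2)"
  by (metis complex_norm_square mult.commute of_real_power)

text \<open>Both sides equal $\sum_{b,c} \overline{\mathrm{qdim}_b} N_{ac}^b \mathrm{qdim}_c$.\<close>

lemma qdim_sector_dim:
  "qdim a * complex_of_real (sector_dim (l a)) =
    cnj (qdim a) * complex_of_real (sector_dim (r a))"
proof -
  have expand: "complex_of_real (sector_dim e) =
      (\<Sum>x\<in>UNIV. if l x = e then cnj (qdim x) * qdim x else 0)" for e
    unfolding sector_dim_def cnj_qdim_mult of_real_sum by (simp add: sum.If_cases)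
  have "qdim a * complex_of_real (sector_dim (l a)) =
      (\<Sum>b\<in>UNIV. cnj (qdim b) * (\<Sum>c\<in>UNIV. of_nat (N a c b) * qdim c))"
    unfolding fusion_qdim_source expand sum_distrib_left by (intro sum.cong refl) auto
  also have "\<dots> = (\<Sum>b\<in>UNIV. \<Sum>c\<in>UNIV. qdim c * (of_nat (N a c b) * cnj (qdim b)))"
    by (simp add: sum_distrib_left mult_ac)
  also have "\<dots> = (\<Sum>c\<in>UNIV. qdim c * cnj (\<Sum>b\<in>UNIV. of_nat (N a c b) * qdim b))"
    by (subst sum.swap) (simp add: sum_distrib_left)
  also have "\<dots> = cnj (qdim a) * complex_of_real (sector_dim (r a))"
    unfolding fusion_qdim_target expand sum_distrib_left by (intro sum.cong refl) auto
  finally show ?thesis .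
qed

lemma sector_dim_pos: "e \<in> vacs \<Longrightarrow> sector_dim e > 0"
  unfolding sector_dim_def by (rule sum_pos2[of _ e]) (auto simp: l_vac_id qdim_nonzero)

lemma sector_dim_l_r: "sector_dim (l a) = sector_dim (r a)"
proof -
  have "cmod (qdim a) * sector_dim (l a) = cmod (qdim a) * sector_dim (r a)"
    using arg_cong[OF qdim_sector_dim[of a], of cmod] sector_dim_pos[OF l_vac[of a]]
        sector_dim_pos[OF r_vac[of a]]
    by (simp add: norm_mult)
  then show ?thesis using qdim_nonzero[of a] by simp
qed

lemma qdim_real: "cnj (qdim a) = qdim a"
  using qdim_sector_dim[of a] sector_dim_pos[OF l_vac[of a]] by (simp add: sector_dim_l_r)

lemma sector_dim_eq: "complex_of_real (sector_dim e) = (\<Sum>x\<in>{x. l x = e}. (qdim x)\<^sup>2)"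
  unfolding sector_dim_def of_real_sum
  by (intro sum.cong refl) (metis cnj_qdim_mult qdim_real power2_eq_square)

definition \<omega> :: "('i \<Rightarrow> complex) \<Rightarrow> complex" where
  "\<omega> f = (\<Sum>a\<in>UNIV. qdim a / complex_of_real (sector_dim (l a)) * tr a f)"

lemma lin_form_omega [lin_intros]: "lin_map g \<Longrightarrow> lin_form (\<lambda>x. \<omega> (g x))"
  unfolding \<omega>_def by (intro lin_intros)

lemma left_integral_omega: "left_integral (\<lambda>f. \<omega> (f \<cdot> k))"
  using left_integral_weighted[of "\<lambda>e. 1 / complex_of_real (sector_dim e)"]
  by (simp add: \<omega>_def twisted_tr_def sector_dim_l_r)

lemma omega_eps_t: "\<omega> (eps_t f \<cdot> k) = \<epsilon> f"
proof -
  let ?F = "\<lambda>e a. \<epsilon> (block_unit e \<cdot> f) / complex_of_real (sector_dim e) * (qdim a)\<^sup>2"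
  have "\<omega> (eps_t f \<cdot> k) = (\<Sum>a\<in>UNIV. ?F (l a) a)"
    unfolding \<omega>_def twisted_tr_def[symmetric] twisted_tr_eps_t by (simp add: power2_eq_square mult_ac)
  also have "\<dots> = (\<Sum>e\<in>vacs. \<Sum>a\<in>{a. l a = e}. ?F e a)"
    using sum.group[of UNIV vacs l "\<lambda>a. ?F (l a) a"] l_vac
    by (auto intro!: sum.cong simp: image_subset_iff)
  also have "\<dots> = (\<Sum>e\<in>vacs. \<epsilon> (block_unit e \<cdot> f))"
  proof (intro sum.cong refl)
    fix e assume "e \<in> vacs"
    then have "sector_dim e \<noteq> 0" using sector_dim_pos[of e] by simp
    then show "(\<Sum>a\<in>{a. l a = e}. ?F e a) = \<epsilon> (block_unit e \<cdot> f)"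
      unfolding sum_distrib_left[symmetric] sector_dim_eq[symmetric] by simp
  qed
  finally show ?thesis by (simp flip: counit_sum_block_unit)
qed

lemma omega_multiplicative: "sw f (\<lambda>x y. \<omega> x * \<omega> y) = \<omega> f"
proof -
  let ?L = "\<lambda>f. \<omega> (f \<cdot> k)"
  have lin: "lin_form ?L" by (intro lin_intros)
  have "sw f (\<lambda>x y. \<omega> x * \<omega> y) = sw f (\<lambda>x y. ?L (x \<cdot> ki) * ?L (y \<cdot> ki))"
    by (simp add: m_assoc ki_inv r_one)
  also have "\<dots> = sw (f \<cdot> ki) (\<lambda>x y. ?L x * ?L y)"
    by (rule sw_m_ki[symmetric]) (intro lin_intros)
  also have "\<dots> = sw (f \<cdot> ki) (\<lambda>x y. ?L (eps_t x) * ?L y)"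
    by (rule left_integral_eps_t[OF left_integral_omega lin])
  also have "\<dots> = ?L (f \<cdot> ki)"
    unfolding omega_eps_t by (rule counit_left[OF lin])
  finally show ?thesis by (simp add: m_assoc ki_inv r_one)
qed

lemma omega_shift:
  assumes G: "lin_form G"
  shows "sw g (\<lambda>a b. G a * \<omega> (f \<cdot> b)) = sw f (\<lambda>a b. G (S a \<cdot> k) * \<omega> (b \<cdot> g))"
proof -
  let ?L = "\<lambda>f. \<omega> (f \<cdot> k)"
  note linear = lin_intros lin_form_comp[OF G]
  have "sw f (\<lambda>a b. G (S a \<cdot> k) * \<omega> (b \<cdot> g)) = sw f (\<lambda>a b. G (S a \<cdot> k) * ?L (b \<cdot> (g \<cdot> ki)))"
    by (simp add: m_assoc ki_inv r_one)
  also have "\<dots> = sw (g \<cdot> ki) (\<lambda>a b. G (a \<cdot> k) * ?L (f \<cdot> b))"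
    by (rule left_integral_shift[OF left_integral_omega, symmetric]) (intro linear)
  also have "\<dots> = sw g (\<lambda>a b. G (a \<cdot> ki \<cdot> k) * ?L (f \<cdot> (b \<cdot> ki)))"
    by (rule sw_m_ki) (intro linear)
  finally show ?thesis by (simp add: m_assoc ki_inv r_one)
qed

lemma omega_commute: "\<omega> (f \<cdot> g) = \<omega> (g \<cdot> f)"
  unfolding \<omega>_def tr_commute[of _ f g] ..

lemma qdim_bar: "qdim (bar a) = qdim a"
  using tr_ki[of a] counit_block_unit_nonzero[OF r_vac[of a]]
  by (simp add: qdim_def[of "bar a"] l_bar tr_bar S_k)

lemma omega_S: "\<omega> (S f) = \<omega> f"
proof -
  have "\<omega> (S f) = (\<Sum>a\<in>UNIV. qdim (bar a) / complex_of_real (sector_dim (l (bar a))) * tr (bar a) f)"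
    by (simp add: \<omega>_def tr_bar l_bar sector_dim_l_r qdim_bar)
  also have "\<dots> = \<omega> f"
    unfolding \<omega>_def by (rule sum.reindex_bij_witness[of _ bar bar]) (auto simp: bar_bar)
  finally show ?thesis .
qed

lemma omega_faithful:
  assumes "\<And>g. \<omega> (f \<cdot> g) = 0"
  shows "f = (\<lambda>_. 0)"
proof (rule rho_ext)
  fix a i j assume ij: "i < n a" "j < n a"
  have "\<omega> (f \<cdot> E a j i) = qdim a / complex_of_real (sector_dim (l a)) * \<rho> a i j f"
    unfolding \<omega>_def tr_m_E[OF ij] by (simp add: if_distrib[of "\<lambda>x. _ * x"] cong: if_cong)
  then show "\<rho> a i j f = \<rho> a i j (\<lambda>_. 0)"
    using assms[of "E a j i"] qdim_nonzero[of a] sector_dim_pos[OF l_vac[of a]]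
    by (simp add: lin_form_zero[OF lin_form_rho])
qed

end

section \<open>Weak Hopf algebras given by structure constants\<close>

lemma mul_bas: "mul H (bas i) (bas j) k = mu H i j k"
  and mul_bas_left: "mul H (bas i) y k = (\<Sum>j\<in>UNIV. y j * mu H i j k)"
  and mul_bas_right: "mul H x (bas j) k = (\<Sum>i\<in>UNIV. x i * mu H i j k)"
  for H :: "('i::finite) wha"
  by (simp_all add: mul_def mult.assoc flip: sum_distrib_left)

lemma cop_bas: "cop H (bas i) (a, b) = de H i a b"
  by (simp add: cop_def)

lemma sweedler_cop2:
  "sweedler (cop H) x (\<lambda>a b. sweedler (cop H) a (\<lambda>c d. F c d b)) =
    (\<Sum>i\<in>UNIV. \<Sum>j\<in>UNIV. \<Sum>h\<in>UNIV. cop2 H x (i, j, h) * F (bas i) (bas j) (bas h))"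
proof -
  let ?F = "\<lambda>p q i j. cop H x (p, q) * de H p i j * F (bas i) (bas j) (bas q)"
  have "sweedler (cop H) x (\<lambda>a b. sweedler (cop H) a (\<lambda>c d. F c d b)) =
      (\<Sum>p\<in>UNIV. \<Sum>q\<in>UNIV. \<Sum>i\<in>UNIV. \<Sum>j\<in>UNIV. ?F p q i j)"
    by (simp add: sweedler_def cop_bas sum_distrib_left mult.assoc)
  also have "\<dots> = (\<Sum>q\<in>UNIV. \<Sum>i\<in>UNIV. \<Sum>j\<in>UNIV. \<Sum>p\<in>UNIV. ?F p q i j)"
    by (subst sum.swap, rule sum.cong[OF refl], subst sum.swap, rule sum.cong[OF refl], rule sum.swap)
  also have "\<dots> = (\<Sum>i\<in>UNIV. \<Sum>j\<in>UNIV. \<Sum>q\<in>UNIV. \<Sum>p\<in>UNIV. ?F p q i j)"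
    by (subst sum.swap, rule sum.cong[OF refl], rule sum.swap)
  finally show ?thesis by (simp add: cop2_def cop_l_def sum_distrib_right)
qed

lemma mul2_sweedler:
  "mul2 H (cop H x) (cop H y) (k, l) =
    sweedler (cop H) x (\<lambda>a b. sweedler (cop H) y (\<lambda>c d. mul H a c k * mul H b d l))"
  by (simp add: mul2_def sweedler_def mul_bas sum_distrib_left mult.assoc)

lemma mul2_tn:
  "mul2 H (tn x y) (cop H z) (k, l) = sweedler (cop H) z (\<lambda>a b. mul H x a k * mul H y b l)"
proof -
  let ?F = "\<lambda>i j i' j'. x i * y j * cop H z (i', j') * mu H i i' k * mu H j j' l"
  have "mul2 H (tn x y) (cop H z) (k, l) = (\<Sum>i\<in>UNIV. \<Sum>j\<in>UNIV. \<Sum>i'\<in>UNIV. \<Sum>j'\<in>UNIV. ?F i j i' j')"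
    by (simp add: mul2_def tn_def)
  also have "\<dots> = (\<Sum>i\<in>UNIV. \<Sum>i'\<in>UNIV. \<Sum>j'\<in>UNIV. \<Sum>j\<in>UNIV. ?F i j i' j')"
    by (rule sum.cong[OF refl], subst sum.swap, rule sum.cong[OF refl], rule sum.swap)
  also have "\<dots> = (\<Sum>i'\<in>UNIV. \<Sum>j'\<in>UNIV. \<Sum>j\<in>UNIV. \<Sum>i\<in>UNIV. ?F i j i' j')"
    by (subst sum.swap, rule sum.cong[OF refl], subst sum.swap, rule sum.cong[OF refl], rule sum.swap)
  finally show ?thesis
    by (simp add: sweedler_def mul_bas_right sum_product sum_distrib_left mult_ac)
qed

lemma mul3_tn_1X_tn_X1:
  "mul3 H (tn_1X x X) (tn_X1 Y z) (k, l, m) = (\<Sum>j\<in>UNIV. \<Sum>h\<in>UNIV. \<Sum>i\<in>UNIV. \<Sum>j'\<in>UNIV.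
    X (j, h) * Y (i, j') * (mul H x (bas i) k * mul H (bas j) (bas j') l * mul H (bas h) z m))"
proof -
  let ?F = "\<lambda>i j h i' j' h'. X (j, h) * Y (i', j') * (x i * mu H i i' k * mu H j j' l * (z h' * mu H h h' m))"
  have "mul3 H (tn_1X x X) (tn_X1 Y z) (k, l, m) =
      (\<Sum>i\<in>UNIV. \<Sum>j\<in>UNIV. \<Sum>h\<in>UNIV. \<Sum>i'\<in>UNIV. \<Sum>j'\<in>UNIV. \<Sum>h'\<in>UNIV. ?F i j h i' j' h')"
    by (simp add: mul3_def tn_1X_def tn_X1_def mult_ac)
  also have "\<dots> = (\<Sum>j\<in>UNIV. \<Sum>h\<in>UNIV. \<Sum>i'\<in>UNIV. \<Sum>j'\<in>UNIV. \<Sum>h'\<in>UNIV. \<Sum>i\<in>UNIV. ?F i j h i' j' h')"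
    by (subst sum.swap, rule sum.cong[OF refl], subst sum.swap, rule sum.cong[OF refl],
        subst sum.swap, rule sum.cong[OF refl], subst sum.swap, rule sum.cong[OF refl], rule sum.swap)
  finally show ?thesis
    by (simp add: mul_bas mul_bas_right mul_bas_left sum_distrib_left sum_distrib_right)
qed

lemma mul3_tn_X1_tn_1X:
  "mul3 H (tn_X1 X z) (tn_1X x Y) (k, l, m) = (\<Sum>i\<in>UNIV. \<Sum>j\<in>UNIV. \<Sum>j'\<in>UNIV. \<Sum>h'\<in>UNIV.
    X (i, j) * Y (j', h') * (mul H (bas i) x k * mul H (bas j) (bas j') l * mul H z (bas h') m))"
proof -
  let ?F = "\<lambda>i j h i' j' h'. X (i, j) * Y (j', h') * (x i' * mu H i i' k * mu H j j' l * (z h * mu H h h' m))"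
  have "mul3 H (tn_X1 X z) (tn_1X x Y) (k, l, m) =
      (\<Sum>i\<in>UNIV. \<Sum>j\<in>UNIV. \<Sum>h\<in>UNIV. \<Sum>i'\<in>UNIV. \<Sum>j'\<in>UNIV. \<Sum>h'\<in>UNIV. ?F i j h i' j' h')"
    by (simp add: mul3_def tn_1X_def tn_X1_def mult_ac)
  also have "\<dots> = (\<Sum>i\<in>UNIV. \<Sum>j\<in>UNIV. \<Sum>h\<in>UNIV. \<Sum>j'\<in>UNIV. \<Sum>h'\<in>UNIV. \<Sum>i'\<in>UNIV. ?F i j h i' j' h')"
    by (rule sum.cong[OF refl], rule sum.cong[OF refl], rule sum.cong[OF refl],
        subst sum.swap, rule sum.cong[OF refl], rule sum.swap)
  also have "\<dots> = (\<Sum>i\<in>UNIV. \<Sum>j\<in>UNIV. \<Sum>j'\<in>UNIV. \<Sum>h'\<in>UNIV. \<Sum>h\<in>UNIV. \<Sum>i'\<in>UNIV. ?F i j h i' j' h')"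
    by (rule sum.cong[OF refl], rule sum.cong[OF refl], subst sum.swap, rule sum.cong[OF refl],
        rule sum.swap)
  finally show ?thesis
    by (simp add: mul_bas mul_bas_right mul_bas_left sum_distrib_left sum_distrib_right)
qed

lemma lin_map_clinear: "lin_map T \<Longrightarrow> clinear T"
  by (simp add: clinear_def lin_map_add lin_map_scale)

lemma dmul_bas_left: "dmul H (bas a) g i = (\<Sum>b\<in>UNIV. de H i a b * g b)"
  unfolding dmul_def by (subst sum.swap) (simp flip: sum_distrib_right)

lemma dmul_bas_right: "dmul H f (bas b) i = (\<Sum>a\<in>UNIV. de H i a b * f a)"
  by (simp add: dmul_def)

lemma dmul2_tn_left:
  "dmul2 H (tn x y) (dcop H g) (i, j) = sweedler (dcop H) g (\<lambda>a b. dmul H x a i * dmul H y b j)"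
proof -
  let ?F = "\<lambda>a b c d. de H i a b * de H j c d * (x a * y c) * dcop H g (b, d)"
  have "dmul2 H (tn x y) (dcop H g) (i, j) = (\<Sum>a\<in>UNIV. \<Sum>b\<in>UNIV. \<Sum>c\<in>UNIV. \<Sum>d\<in>UNIV. ?F a b c d)"
    by (simp add: dmul2_def tn_def)
  also have "\<dots> = (\<Sum>b\<in>UNIV. \<Sum>c\<in>UNIV. \<Sum>d\<in>UNIV. \<Sum>a\<in>UNIV. ?F a b c d)"
    by (subst sum.swap, rule sum.cong[OF refl], subst sum.swap, rule sum.cong[OF refl], rule sum.swap)
  also have "\<dots> = (\<Sum>b\<in>UNIV. \<Sum>d\<in>UNIV. \<Sum>c\<in>UNIV. \<Sum>a\<in>UNIV. ?F a b c d)"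
    by (rule sum.cong[OF refl], rule sum.swap)
  finally show ?thesis
    by (simp add: sweedler_def dmul_bas_right sum_product sum_distrib_left mult_ac)
qed

lemma dmul2_tn_right:
  "dmul2 H (dcop H g) (tn x y) (i, j) = sweedler (dcop H) g (\<lambda>a b. dmul H a x i * dmul H b y j)"
proof -
  let ?F = "\<lambda>a b c d. de H i a b * de H j c d * dcop H g (a, c) * (x b * y d)"
  have "dmul2 H (dcop H g) (tn x y) (i, j) = (\<Sum>a\<in>UNIV. \<Sum>b\<in>UNIV. \<Sum>c\<in>UNIV. \<Sum>d\<in>UNIV. ?F a b c d)"
    by (simp add: dmul2_def tn_def)
  also have "\<dots> = (\<Sum>a\<in>UNIV. \<Sum>c\<in>UNIV. \<Sum>d\<in>UNIV. \<Sum>b\<in>UNIV. ?F a b c d)"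
    by (rule sum.cong[OF refl], subst sum.swap, rule sum.cong[OF refl], rule sum.swap)
  finally show ?thesis
    by (simp add: sweedler_def dmul_bas_left sum_product sum_distrib_left mult_ac)
qed

locale wha_structure =
  fixes H :: "('i::finite) wha"
  assumes wha: "weak_hopf_algebra H"
begin

sublocale coproduct "cop H"
  by unfold_locales (unfold cop_def split_def, intro lin_intros)

lemma lin_map_mul_left: "lin_map (\<lambda>x. mul H x y)"
  and lin_map_mul_right: "lin_map (\<lambda>y. mul H x y)"
  and lin_form_cou: "lin_form (cou H)"
  and lin_map_ant: "lin_map (ant H)"
  unfolding mul_def cou_def ant_def by (intro lin_mapI lin_intros)+

lemma mul_assoc: "mul H (mul H x y) z = mul H x (mul H y z)"
  and mul_un: "mul H (un H) x = x" "mul H x (un H) = x"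
  using wha by (simp_all add: weak_hopf_algebra_def)

lemma sw_coassoc:
  "sw x (\<lambda>a b. sw a (\<lambda>c d. c i * d j * b k)) = sw x (\<lambda>a b. sw b (\<lambda>c d. a i * c j * d k))"
proof -
  have "sw x (\<lambda>a b. sw a (\<lambda>c d. c i * d j * b k)) = cop_l H (cop H x) (i, j, k)"
    by (simp add: sweedler_mult_right sweedler_coords sweedler_coord_right cop_l_def cop_bas)
  also have "\<dots> = cop_r H (cop H x) (i, j, k)"
    using wha by (simp add: weak_hopf_algebra_def)
  also have "\<dots> = sw x (\<lambda>a b. a i * cop H b (j, k))"
    by (simp add: sweedler_coord_left cop_r_def cop_bas)
  finally show ?thesis by (simp add: sweedler_mult_left sweedler_coords mult.assoc)
qed

lemma sw_cou: "sw x (\<lambda>a b. cou H a * b i) = x i" "sw x (\<lambda>a b. a i * cou H b) = x i"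
proof -
  have "(\<lambda>b. \<Sum>a\<in>UNIV. ep H a * cop H x (a, b)) = x" "(\<lambda>a. \<Sum>b\<in>UNIV. cop H x (a, b) * ep H b) = x"
    using wha by (simp_all add: weak_hopf_algebra_def)
  from this[THEN fun_cong, of i]
  show "sw x (\<lambda>a b. cou H a * b i) = x i" "sw x (\<lambda>a b. a i * cou H b) = x i"
    unfolding sweedler_coord_left sweedler_coord_right by (simp_all add: cou_def mult.commute)
qed

lemma sw_mul: "sw (mul H x y) (\<lambda>a b. a i * b j) = sw x (\<lambda>a b. sw y (\<lambda>c d. mul H a c i * mul H b d j))"
  using wha unfolding sweedler_coords mul2_sweedler[symmetric] by (simp add: weak_hopf_algebra_def)

lemma sw_un:
  "sw (un H) (\<lambda>a b. sw b (\<lambda>c d. a i * c j * d k)) =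
    sw (un H) (\<lambda>a b. sw (un H) (\<lambda>c d. a i * mul H b c j * d k))" (is "?lhs = ?left")
  "sw (un H) (\<lambda>a b. sw b (\<lambda>c d. a i * c j * d k)) =
    sw (un H) (\<lambda>a b. sw (un H) (\<lambda>c d. a i * mul H c b j * d k))" (is "_ = ?right")
proof -
  let ?c = "cop H (un H)"
  have cop2: "cop2 H (un H) (i, j, k) = ?lhs"
    unfolding sw_coassoc[symmetric] sweedler_cop2 by (simp flip: mult.assoc)
  have "cop2 H (un H) (i, j, k) = mul3 H (tn_X1 ?c (un H)) (tn_1X (un H) ?c) (i, j, k)"
    "cop2 H (un H) (i, j, k) = mul3 H (tn_1X (un H) ?c) (tn_X1 ?c (un H)) (i, j, k)"
    using wha unfolding weak_hopf_algebra_def by metis+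
  note products = this[unfolded mul3_tn_X1_tn_1X mul3_tn_1X_tn_X1 mul_un cop2]
  show "?lhs = ?left"
    unfolding products(1) by (simp add: sweedler_def sum_distrib_left mult.assoc)
  have "?lhs = sw (un H) (\<lambda>c d. sw (un H) (\<lambda>a b. a i * mul H c b j * d k))"
    unfolding products(2) by (simp add: sweedler_def sum_distrib_left mult.assoc)
  also have "\<dots> = ?right"
    by (rule sweedler_swap)
  finally show "?lhs = ?right" .
qed

lemma cou_mul:
  "cou H (mul H (mul H x y) z) = sw y (\<lambda>a b. cou H (mul H x a) * cou H (mul H b z))"
  "cou H (mul H (mul H x y) z) = sw y (\<lambda>a b. cou H (mul H x b) * cou H (mul H a z))"
  using wha unfolding weak_hopf_algebra_def sweedler_def mult.assoc by blast+

lemma sw_ant: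
  "sw x (\<lambda>a b. mul H (ant H a) b i) = sw (un H) (\<lambda>a b. cou H (mul H x b) * a i)"
  "sw x (\<lambda>a b. mul H a (ant H b) i) = sw (un H) (\<lambda>a b. cou H (mul H a x) * b i)"
  "sw x (\<lambda>a b. sw a (\<lambda>c d. mul H (mul H (ant H c) d) (ant H b) i)) = ant H x i"
proof -
  have "(\<lambda>i. sw x (\<lambda>a b. mul H (ant H a) b i)) = (\<lambda>i. sw (un H) (\<lambda>a b. cou H (mul H x b) * a i))"
    "(\<lambda>i. sw x (\<lambda>a b. mul H a (ant H b) i)) = (\<lambda>i. sw (un H) (\<lambda>a b. cou H (mul H a x) * b i))"
    "(\<lambda>i. sw x (\<lambda>a b. sw a (\<lambda>c d. mul H (mul H (ant H c) d) (ant H b) i))) = ant H x"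
    unfolding sweedler_cop2 using wha unfolding weak_hopf_algebra_def sweedler_def mult.assoc by blast+
  from this[THEN fun_cong, of i]
  show "sw x (\<lambda>a b. mul H (ant H a) b i) = sw (un H) (\<lambda>a b. cou H (mul H x b) * a i)"
    "sw x (\<lambda>a b. mul H a (ant H b) i) = sw (un H) (\<lambda>a b. cou H (mul H a x) * b i)"
    "sw x (\<lambda>a b. sw a (\<lambda>c d. mul H (mul H (ant H c) d) (ant H b) i)) = ant H x i" .
qed

sublocale weak_hopf "mul H" "un H" "cop H" "cou H" "ant H"
  by unfold_locales (fact lin_map_mul_left lin_map_mul_right mul_assoc mul_un lin_form_cou lin_map_ant
    sw_coassoc sw_cou sw_mul sw_un cou_mul sw_ant)+

lemma dual_structure:
  "dual_m = dmul H" "dual_one = ep H" "dual_\<Delta> = dcop H" "dual_\<epsilon> = (\<lambda>f. ev f (un H))" "dual_S = dant H"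
  unfolding dual_m_def dual_one_def dual_\<Delta>_def dual_\<epsilon>_def dual_S_def fun_eq_iff
  by (simp_all add: dmul_def dcop_def dant_def sweedler_def cop_bas cou_def ev_def ant_def mul_bas
      mult_ac)

sublocale dual: weak_hopf "dmul H" "ep H" "dcop H" "\<lambda>f. ev f (un H)" "dant H"
  using dual unfolding dual_structure .

end

section \<open>Fusion and conjugation data\<close>

lemma sum_lessThan_mult:
  fixes g :: "nat \<Rightarrow> complex"
  shows "(\<Sum>t<m * n. g t) = (\<Sum>i<m. \<Sum>j<n. g (i * n + j))"
proof -
  have "(\<Sum>t<m * n. g t) = (\<Sum>i<m. sum g {i * n..<i * n + n})"
    by (simp add: sum.nat_group)
  also have "\<dots> = (\<Sum>i<m. \<Sum>j<n. g (i * n + j))"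
  proof (rule sum.cong[OF refl])
    fix i show "sum g {i * n..<i * n + n} = (\<Sum>j<n. g (i * n + j))"
      using sum.shift_bounds_nat_ivl[of g 0 "i * n" n] by (simp add: atLeast0LessThan add.commute)
  qed
  finally show ?thesis .
qed

lemma pair_index_less: "i * n + j < m * n" if "i < m" "j < n" for i j m n :: nat
proof -
  have "i * n + j < Suc i * n" using that by simp
  also have "\<dots> \<le> m * n" using that by (intro mult_le_mono1) simp
  finally show ?thesis .
qed

lemma kron_index:
  assumes "A \<in> carrier_mat m m'" "B \<in> carrier_mat n n'" "i < m" "i' < n" "j < m'" "j' < n'"
  shows "kron A B $$ (i * n + i', j * n' + j') = A $$ (i, j) * B $$ (i', j')"
  using assms by (simp add: kron_def pair_index_less)

lemma minv_inverse:
  assumes A: "A \<in> carrier_mat n n" and inv: "invertible_mat A"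
  shows minv_carrier: "minv A \<in> carrier_mat n n" and mult_minv: "A * minv A = 1\<^sub>m n"
    and minv_mult: "minv A * A = 1\<^sub>m n"
proof -
  obtain B where B: "B \<in> carrier_mat n n" "A * B = 1\<^sub>m n" "B * A = 1\<^sub>m n"
    using invertible_mat_inverse[OF A inv] by blast
  have "minv A = B"
    unfolding minv_def
  proof (rule the_equality)
    fix C assume "C \<in> carrier_mat (dim_col A) (dim_row A) \<and> A * C = 1\<^sub>m (dim_row A) \<and>
        C * A = 1\<^sub>m (dim_col A)"
    then have C: "C \<in> carrier_mat n n" "C * A = 1\<^sub>m n" using A by auto
    have "C = C * A * B" using C B assoc_mult_mat[OF C(1) A B(1)] by simp
    then show "C = B" using C B by simp
  qed (use A B in auto)
  then show "minv A \<in> carrier_mat n n" "A * minv A = 1\<^sub>m n" "minv A * A = 1\<^sub>m n" using B by auto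
qed

lemma mult_inverse_product:
  assumes "A \<in> carrier_mat n n" "B \<in> carrier_mat n n" "A' \<in> carrier_mat n n" "B' \<in> carrier_mat n n"
    and "A * A' = 1\<^sub>m n" "B * B' = 1\<^sub>m n"
  shows "(A * B) * (B' * A') = (1\<^sub>m n :: complex mat)"
proof -
  have "(A * B) * (B' * A') = A * (B * B' * A')"
    using assms(1-4) by (simp add: assoc_mult_mat[of _ n n _ n _ n])
  then show ?thesis using assms by simp
qed

lemma mtrace_transpose: "A \<in> carrier_mat n n \<Longrightarrow> mtrace (transpose_mat A) = mtrace A"
  by (simp add: mtrace_def)

lemma mtrace_smult: "A \<in> carrier_mat n n \<Longrightarrow> mtrace (c \<cdot>\<^sub>m A) = c * mtrace A"
  by (auto simp: mtrace_def sum_distrib_left intro!: sum.cong)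

lemma mtrace_transpose_mult:
  assumes "A \<in> carrier_mat n m" "B \<in> carrier_mat n m"
  shows "mtrace (transpose_mat A * B) = (\<Sum>p<m. \<Sum>q<n. A $$ (q, p) * B $$ (q, p))"
  using assms by (auto simp: mtrace_def scalar_prod_def atLeast0LessThan intro!: sum.cong)

lemma mtrace_conjugate:
  assumes "A \<in> carrier_mat n n" "B \<in> carrier_mat n n" "C \<in> carrier_mat n n" and inverse: "C * A = 1\<^sub>m n"
  shows "mtrace (A * B * C) = mtrace (B :: complex mat)"
proof -
  have "mtrace (A * B * C) = mtrace (C * (A * B))"
    by (rule mtrace_mult_commute) (use assms in auto)
  also have "C * (A * B) = B"
    using assms assoc_mult_mat[of C n n A n B n] by simp
  finally show ?thesis .
qed

lemma mult_outer_mtrace: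
  assumes "v \<in> carrier_vec n" "u \<in> carrier_vec n" "A \<in> carrier_mat n n"
  shows "mtrace (outer v u * A) = (\<Sum>i<n. \<Sum>j<n. u $ i * A $$ (i, j) * v $ j)"
proof -
  have "mtrace (outer v u * A) = (\<Sum>j<n. \<Sum>i<n. u $ i * A $$ (i, j) * v $ j)"
    using assms by (auto simp: mtrace_def outer_def scalar_prod_def atLeast0LessThan mult_ac
        intro!: sum.cong)
  then show ?thesis by (subst sum.swap)
qed

lemma mult_mult_index:
  fixes A B C :: "complex mat"
  assumes "A \<in> carrier_mat n m" "B \<in> carrier_mat m m'" "C \<in> carrier_mat m' n'" "i < n" "j < n'"
  shows "(A * B * C) $$ (i, j) = (\<Sum>s<m. \<Sum>t<m'. A $$ (i, s) * C $$ (t, j) * B $$ (s, t))"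
proof -
  have "(A * B * C) $$ (i, j) = (\<Sum>s<m. A $$ (i, s) * (\<Sum>t<m'. B $$ (s, t) * C $$ (t, j)))"
    using assms by (auto simp: scalar_prod_def atLeast0LessThan intro!: sum.cong)
  then show ?thesis by (simp add: sum_distrib_left mult_ac)
qed

locale dual_irreps = wha_structure H
  for H :: "('i::finite) wha" +
  fixes nd :: "'r::finite \<Rightarrow> nat" and \<psi> :: "'r \<Rightarrow> ('i \<Rightarrow> complex) \<Rightarrow> complex mat"
  assumes ss: "dual_semisimple H" and irr: "irreps H nd \<psi>"
begin

lemma is_rep_eq_matrix_rep: "is_rep H = dual.matrix_rep"
  by (simp add: is_rep_def dual.matrix_rep_def fun_eq_iff)

sublocale semisimple_irreducible_family "dmul H" "ep H" nd \<psi>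
  using ss irr by unfold_locales (auto simp: irreps_def is_rep_eq_matrix_rep dual_semisimple_def)

text \<open>Matrix entries outside the index range are junk and need not depend linearly on the matrix.\<close>

definition coeff :: "'r \<Rightarrow> nat \<Rightarrow> nat \<Rightarrow> ('i \<Rightarrow> complex) \<Rightarrow> complex" where
  "coeff a i j f = (if i < nd a \<and> j < nd a then \<psi> a f $$ (i, j) else 0)"

definition matrix_unit :: "'r \<Rightarrow> nat \<Rightarrow> nat \<Rightarrow> 'i \<Rightarrow> complex" where
  "matrix_unit a i j = (SOME e. \<forall>b i' j'. i' < nd b \<longrightarrow> j' < nd b \<longrightarrow>
    \<psi> b e $$ (i', j') = (if a = b \<and> i = i' \<and> j = j' then 1 else 0))"

lemma psi_matrix_unit:
  assumes "i < nd a" "j < nd a" "i' < nd b" "j' < nd b"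
  shows "\<psi> b (matrix_unit a i j) $$ (i', j') = (if a = b \<and> i = i' \<and> j = j' then 1 else 0)"
proof -
  have "\<exists>e. \<forall>b i' j'. i' < nd b \<longrightarrow> j' < nd b \<longrightarrow>
      \<psi> b e $$ (i', j') = (if a = b \<and> i = i' \<and> j = j' then 1 else 0)"
    by (rule matrix_unit_exists[OF assms(1,2)]) (intro exI allI impI)
  from someI_ex[OF this] show ?thesis using assms(3,4) by (simp add: matrix_unit_def)
qed

lemma lin_form_coeff: "lin_form (coeff a i j)"
proof (cases "i < nd a \<and> j < nd a")
  case True
  then show ?thesis using psi.lin_form_rep[of i a j] by (simp add: coeff_def[abs_def])
next
  case False
  then have "coeff a i j = (\<lambda>_. 0)" by (auto simp: coeff_def)
  then show ?thesis by (simp add: lin_form_0)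
qed

sublocale split_algebra "dmul H" "ep H" nd coeff matrix_unit
proof unfold_locales
  show "f = g" if eq: "\<And>a i j. i < nd a \<Longrightarrow> j < nd a \<Longrightarrow> coeff a i j f = coeff a i j g" for f g
  proof (rule psi_inject)
    show "\<psi> a f = \<psi> a g" for a using eq[of _ a] by (intro eq_matI) (auto simp: coeff_def)
  qed
qed (use irreducible_rep_pos[OF psi_irreducible] in
    \<open>auto simp: lin_form_coeff coeff_def psi.rep_mult psi.rep_one psi_matrix_unit scalar_prod_def
        atLeast0LessThan\<close>)

lemma tr_eq_mtrace: "tr a f = mtrace (\<psi> a f)"
  by (simp add: tr_def mtrace_def coeff_def)

end

locale dual_fusion = dual_irreps H nd \<psi>
  for H :: "('i::finite) wha" and nd :: "'r::finite \<Rightarrow> nat" and \<psi> +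
  fixes N :: "'r \<Rightarrow> 'r \<Rightarrow> 'r \<Rightarrow> nat"
    and V W :: "'r \<Rightarrow> 'r \<Rightarrow> 'r \<Rightarrow> nat \<Rightarrow> complex mat"
    and b :: "'r \<Rightarrow> complex mat"
    and u v :: "'r \<Rightarrow> complex vec"
    and l r :: "'r \<Rightarrow> 'r"
  assumes fus: "fusion H nd \<psi> N V W" and vac: "vacuum H nd \<psi> b" and uv: "vac_vectors nd b u v"
    and lr: "left_right nd b N l r"
begin

lemma V_carrier: "\<mu> < N a c d \<Longrightarrow> V a c d \<mu> \<in> carrier_mat (nd a * nd c) (nd d)"
  and W_carrier: "\<mu> < N a c d \<Longrightarrow> W a c d \<mu> \<in> carrier_mat (nd d) (nd a * nd c)"
  and W_V: "\<mu> < N a c d \<Longrightarrow> W a c d \<mu> * V a c d \<mu> = 1\<^sub>m (nd d)"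
  using fus unfolding fusion_def by auto

lemma u_carrier: "e \<in> vacE nd b \<Longrightarrow> u e \<in> carrier_vec (nd e)"
  and v_carrier: "e \<in> vacE nd b \<Longrightarrow> v e \<in> carrier_vec (nd e)"
  and b_outer: "e \<in> vacE nd b \<Longrightarrow> b e = outer (v e) (u e)"
  using uv by (auto simp: vac_vectors_def)

lemma dsw_psi_psi:
  assumes ij: "i < nd a" "j < nd a" "i' < nd c" "j' < nd c"
  shows "dual.sw f (\<lambda>p q. \<psi> a p $$ (i, j) * \<psi> c q $$ (i', j')) =
    (\<Sum>d\<in>UNIV. \<Sum>\<mu><N a c d. (V a c d \<mu> * \<psi> d f * W a c d \<mu>) $$ (i * nd c + i', j * nd c + j'))"
proof -
  have "dual.sw f (\<lambda>p q. \<psi> a p $$ (i, j) * \<psi> c q $$ (i', j')) =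
      tens_rep H nd \<psi> a c f $$ (i * nd c + i', j * nd c + j')"
    using ij by (simp add: tens_rep_def sweedler_def pair_index_less
        kron_index[OF psi.rep_carrier psi.rep_carrier])
  also have "tens_rep H nd \<psi> a c f = mat (nd a * nd c) (nd a * nd c)
      (\<lambda>(r, s). \<Sum>d\<in>UNIV. \<Sum>\<mu><N a c d. (V a c d \<mu> * \<psi> d f * W a c d \<mu>) $$ (r, s))"
    using fus unfolding fusion_def by blast
  finally show ?thesis using ij by (simp add: pair_index_less)
qed

lemma dsw_psi_psi_zero:
  assumes zero: "\<And>d. N a c d \<noteq> 0 \<Longrightarrow> \<psi> d f = 0\<^sub>m (nd d) (nd d)"
    and ij: "i < nd a" "j < nd a" "i' < nd c" "j' < nd c"
  shows "dual.sw f (\<lambda>p q. \<psi> a p $$ (i, j) * \<psi> c q $$ (i', j')) = 0"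
  unfolding dsw_psi_psi[OF ij]
proof (intro sum.neutral ballI)
  fix d \<mu> assume "\<mu> \<in> {..<N a c d}"
  then have \<mu>: "\<mu> < N a c d" and "N a c d \<noteq> 0" by auto
  then have "V a c d \<mu> * \<psi> d f * W a c d \<mu> = 0\<^sub>m (nd a * nd c) (nd a * nd c)"
    by (simp add: zero right_mult_zero_mat[OF V_carrier[OF \<mu>]] left_mult_zero_mat[OF W_carrier[OF \<mu>]])
  then show "(V a c d \<mu> * \<psi> d f * W a c d \<mu>) $$ (i * nd c + i', j * nd c + j') = 0"
    using ij by (simp add: pair_index_less)
qed

lemma mtrace_V_psi_W:
  assumes \<mu>: "\<mu> < N a c d"
  shows "mtrace (V a c d \<mu> * \<psi> d f * W a c d \<mu>) = mtrace (\<psi> d f)"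
proof -
  note carrier = V_carrier[OF \<mu>] W_carrier[OF \<mu>] psi.rep_carrier
  have "mtrace (V a c d \<mu> * \<psi> d f * W a c d \<mu>) = mtrace (W a c d \<mu> * (V a c d \<mu> * \<psi> d f))"
    by (rule mtrace_mult_commute[OF mult_carrier_mat[OF carrier(1,3)] carrier(2)])
  also have "W a c d \<mu> * (V a c d \<mu> * \<psi> d f) = \<psi> d f"
    unfolding assoc_mult_mat[OF carrier(2,1,3), symmetric] W_V[OF \<mu>]
    by (rule left_mult_one_mat[OF carrier(3)])
  finally show ?thesis .
qed

lemma dsw_tr_tr: "dual.sw f (\<lambda>p q. tr a p * tr c q) = (\<Sum>d\<in>UNIV. of_nat (N a c d) * tr d f)"
proof -
  let ?X = "\<lambda>d \<mu>. V a c d \<mu> * \<psi> d f * W a c d \<mu>"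
  have "dual.sw f (\<lambda>p q. tr a p * tr c q) =
     (\<Sum>i<nd a. \<Sum>i'<nd c. dual.sw f (\<lambda>p q. \<psi> a p $$ (i, i) * \<psi> c q $$ (i', i')))"
    by (simp add: tr_eq_mtrace mtrace_def sum_product sweedler_sum)
  also have "\<dots> = (\<Sum>i<nd a. \<Sum>i'<nd c. \<Sum>d\<in>UNIV. \<Sum>\<mu><N a c d. ?X d \<mu> $$ (i * nd c + i', i * nd c + i'))"
    by (intro sum.cong refl) (simp add: dsw_psi_psi)
  also have "\<dots> = (\<Sum>d\<in>UNIV. \<Sum>\<mu><N a c d. \<Sum>t<nd a * nd c. ?X d \<mu> $$ (t, t))"
    unfolding sum_lessThan_mult[symmetric, of "\<lambda>t. \<Sum>d\<in>UNIV. \<Sum>\<mu><N a c d. ?X d \<mu> $$ (t, t)"]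
    by (subst sum.swap, rule sum.cong[OF refl], rule sum.swap)
  also have "\<dots> = (\<Sum>d\<in>UNIV. \<Sum>\<mu><N a c d. mtrace (?X d \<mu>))"
    by (intro sum.cong refl) (simp add: mtrace_def carrier_matD(1)[OF V_carrier])
  also have "\<dots> = (\<Sum>d\<in>UNIV. of_nat (N a c d) * tr d f)"
    by (simp add: mtrace_V_psi_W tr_eq_mtrace)
  finally show ?thesis .
qed

lemma counit_vacuum_vectors:
  "ev f (un H) = (\<Sum>e\<in>vacE nd b. \<Sum>i<nd e. \<Sum>j<nd e. u e $ i * \<psi> e f $$ (i, j) * v e $ j)"
proof -
  have "ev f (un H) = (\<Sum>a\<in>UNIV. mtrace (b a * \<psi> a f))"
    using vac unfolding vacuum_def by blast
  also have "\<dots> = (\<Sum>e\<in>vacE nd b. mtrace (b e * \<psi> e f))"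
    by (rule sum.mono_neutral_right)
        (auto simp: vacE_def left_mult_zero_mat[OF psi.rep_carrier] mtrace_def)
  finally show ?thesis
    by (simp add: b_outer mult_outer_mtrace[OF v_carrier u_carrier psi.rep_carrier])
qed

sublocale fusion_weak_hopf "dmul H" "ep H" "dcop H" "\<lambda>f. ev f (un H)" "dant H" nd coeff matrix_unit
  N "vacE nd b" "\<lambda>e i. u e $ i" "\<lambda>e i. v e $ i" l r
proof
  show "ev f (un H) = (\<Sum>e\<in>vacE nd b. \<Sum>i<nd e. \<Sum>j<nd e. u e $ i * coeff e i j f * v e $ j)" for f
    by (simp add: counit_vacuum_vectors coeff_def)
  show "dual.sw f (\<lambda>p q. coeff a i j p * coeff c i' j' q) = 0"
    if zero: "\<And>d i j. N a c d \<noteq> 0 \<Longrightarrow> i < nd d \<Longrightarrow> j < nd d \<Longrightarrow> coeff d i j f = 0"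
      and ij: "i < nd a" "j < nd a" "i' < nd c" "j' < nd c" for a c f i j i' j'
  proof -
    have "\<psi> d f = 0\<^sub>m (nd d) (nd d)" if "N a c d \<noteq> 0" for d
      using zero[OF that] by (intro eq_matI) (auto simp: coeff_def)
    from dsw_psi_psi_zero[OF this ij] show ?thesis using ij by (simp add: coeff_def)
  qed
  show "dual.sw f (\<lambda>p q. tr a p * tr c q) = (\<Sum>d\<in>UNIV. of_nat (N a c d) * tr d f)" for a c f
    by (rule dsw_tr_tr)
  show "l a \<in> vacE nd b" "r a \<in> vacE nd b" for a
    using lr by (auto simp: left_right_def)
  show "N e a c = (if e = l a \<and> a = c then 1 else 0)" "N a e c = (if e = r a \<and> a = c then 1 else 0)"
    if "e \<in> vacE nd b" for e a c
    using lr that unfolding left_right_def by blast+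
qed

lemma counit_block_unit_vectors:
  assumes e: "e \<in> vacE nd b"
  shows "ev (block_unit e) (un H) = u e \<bullet> v e"
proof -
  have "ev (block_unit e) (un H) = (\<Sum>i<nd e. \<Sum>j<nd e. u e $ i * coeff e i j (ep H) * v e $ j)"
    using counit_block_unit[of e "ep H"] e by (simp add: dual.r_one)
  also have "\<dots> = u e \<bullet> v e" using v_carrier[OF e]
    by (simp add: rho_one scalar_prod_def atLeast0LessThan if_distrib[of "\<lambda>z. _ * z"]
        if_distrib[of "\<lambda>z. z * _"] cong: if_cong)
  finally show ?thesis .
qed

end

locale dual_conjugation = dual_fusion H nd \<psi> N V W b u v l r
  for H :: "('i::finite) wha" and nd :: "'r::finite \<Rightarrow> nat" and \<psi> N V W b u v l r +
  fixes cb :: "'r \<Rightarrow> 'r" and Z :: "'r \<Rightarrow> complex mat" and k :: "'i \<Rightarrow> complex"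
  assumes conj: "conjugation H nd \<psi> cb Z" and piv: "pivotal H k"
begin

lemma nd_cb: "nd (cb a) = nd a"
proof -
  have "Z a \<in> carrier_mat (nd a) (nd (cb a))" "invertible_mat (Z a)"
    using conj by (auto simp: conjugation_def)
  then show ?thesis by (simp add: invertible_mat_def)
qed

lemma Z_carrier: "Z a \<in> carrier_mat (nd a) (nd a)"
  and Z_invertible: "invertible_mat (Z a)"
  and psi_dant: "transpose_mat (\<psi> a (dant H f)) = Z a * \<psi> (cb a) f * minv (Z a)"
  using conj nd_cb unfolding conjugation_def by auto

lemma psi_cb_carrier: "\<psi> (cb a) f \<in> carrier_mat (nd a) (nd a)"
  using psi.rep_carrier[of "cb a" f] by (simp add: nd_cb)

lemmas minv_Z = minv_inverse[OF Z_carrier Z_invertible]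

lemma Z_cb_carrier: "Z (cb a) \<in> carrier_mat (nd a) (nd a)"
  and minv_Z_cb_carrier: "minv (Z (cb a)) \<in> carrier_mat (nd a) (nd a)"
  and Z_cb_minv: "Z (cb a) * minv (Z (cb a)) = 1\<^sub>m (nd a)"
  using Z_carrier[of "cb a"] minv_Z[of "cb a"] by (simp_all add: nd_cb)

lemma tr_cb: "tr (cb a) f = tr a (dant H f)"
proof -
  have "tr a (dant H f) = mtrace (Z a * \<psi> (cb a) f * minv (Z a))"
    unfolding psi_dant[symmetric] tr_eq_mtrace by (rule mtrace_transpose[symmetric, OF psi.rep_carrier])
  also have "\<dots> = tr (cb a) f"
    unfolding tr_eq_mtrace by (rule mtrace_conjugate[OF Z_carrier psi_cb_carrier minv_Z(1,3)])
  finally show ?thesis ..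
qed

lemma dmul_dinv: "dmul H k (dinv H k) = ep H" "dmul H (dinv H k) k = ep H"
proof -
  obtain h where h: "dmul H k h = ep H" "dmul H h k = ep H"
    using piv by (auto simp: pivotal_def dinvertible_def)
  have "dinv H k = h" unfolding dinv_def
  proof (rule the_equality)
    fix h' assume h': "dmul H k h' = ep H \<and> dmul H h' k = ep H"
    have "h' = dmul H (dmul H h' k) h" by (simp add: dual.m_assoc h dual.r_one)
    then show "h' = h" using h' by (simp add: dual.l_one)
  qed (use h in simp)
  then show "dmul H k (dinv H k) = ep H" "dmul H (dinv H k) k = ep H" using h by simp_all
qed

sublocale pivotal_fusion_weak_hopf "dmul H" "ep H" "dcop H" "\<lambda>f. ev f (un H)"
    "dant H" nd coeff matrix_unit
  N "vacE nd b" "\<lambda>e i. u e $ i" "\<lambda>e i. v e $ i" l r k "dinv H k" cb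
proof unfold_locales
  show "dmul H k (dinv H k) = ep H" "dmul H (dinv H k) k = ep H" by (rule dmul_dinv)+
  show "dant H (dant H f) = dmul H (dmul H k f) (dinv H k)" for f
    using piv by (simp add: pivotal_def)
  show "tr (cb a) f = tr a (dant H f)" for a f by (rule tr_cb)
  show "dual.sw k K = dual.sw (ep H) (\<lambda>a b. K (dmul H k a) (dmul H k b))"
    "dual.sw k K = dual.sw (ep H) (\<lambda>a b. K (dmul H a k) (dmul H b k))" if "bilin_form K" for K
    using piv that unfolding pivotal_def group_like_def
    by (auto intro!: sweedler_transfer simp flip: dmul2_tn_left dmul2_tn_right)
qed

lemma N_cb_nonzero: "N (cb c) c (r c) > 0"
proof -
  have "N (cb c) c (r c) \<noteq> 0"
  proof (rule fusion_conjugate_nonzero)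
    fix i j f assume ij: "i < nd c" "j < nd c"
    have "coeff c i j (dant H f) = transpose_mat (\<psi> c (dant H f)) $$ (j, i)"
      using ij by (simp add: coeff_def)
    also have "\<dots> = (\<Sum>s<nd c. \<Sum>t<nd c. Z c $$ (j, s) * minv (Z c) $$ (t, i) * \<psi> (cb c) f $$ (s, t))"
      unfolding psi_dant by (rule mult_mult_index[OF Z_carrier psi_cb_carrier minv_Z(1) ij(2,1)])
    finally show "coeff c i j (dant H f) =
        (\<Sum>s<nd (cb c). \<Sum>t<nd (cb c). Z c $$ (j, s) * minv (Z c) $$ (t, i) * coeff (cb c) s t f)"
      by (simp add: coeff_def nd_cb)
  qed
  then show ?thesis by simp
qed

definition conjugator :: "'r \<Rightarrow> complex mat" where
  "conjugator a = transpose_mat (minv (Z a)) * Z (cb a)"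

definition conjugator_inverse :: "'r \<Rightarrow> complex mat" where
  "conjugator_inverse a = minv (Z (cb a)) * transpose_mat (Z a)"

lemma conjugator_carrier: "conjugator a \<in> carrier_mat (nd a) (nd a)"
  unfolding conjugator_def
  by (rule mult_carrier_mat[of _ _ "nd a"]) (simp_all add: Z_cb_carrier minv_Z(1))

lemma conjugator_inverse_carrier: "conjugator_inverse a \<in> carrier_mat (nd a) (nd a)"
  unfolding conjugator_inverse_def
  by (rule mult_carrier_mat[of _ _ "nd a"]) (simp_all add: Z_carrier minv_Z_cb_carrier)

lemma conjugator_mult_inverse: "conjugator a * conjugator_inverse a = 1\<^sub>m (nd a)"
  unfolding conjugator_def conjugator_inverse_def
proof (rule mult_inverse_product)
  show "transpose_mat (minv (Z a)) * transpose_mat (Z a) = 1\<^sub>m (nd a)"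
    by (simp add: transpose_mult[OF Z_carrier minv_Z(1), symmetric] minv_Z(2))
qed (use Z_carrier Z_cb_carrier minv_Z(1) minv_Z_cb_carrier Z_cb_minv in auto)

lemma conjugator_transpose: "transpose_mat (conjugator a) = transpose_mat (Z (cb a)) * minv (Z a)"
  unfolding conjugator_def
  by (subst transpose_mult) (use minv_Z(1)[of a] Z_cb_carrier[of a] in auto)

end

locale dual_spherical = dual_conjugation H nd \<psi> N V W b u v l r cb Z k
  for H :: "('i::finite) wha" and nd :: "'r::finite \<Rightarrow> nat" and \<psi> N V W b u v l r cb Z k +
  fixes w d \<xi> :: "'r \<Rightarrow> complex" and g :: "'i \<Rightarrow> complex"
  assumes wd: "wdata nd cb Z r V W u v w" and dd: "ddata cb w d" and gd: "gdata \<psi> cb Z w d g"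
    and sph: "spherical_element H nd \<psi> b u v l r k" and xi: "\<psi> a k = \<xi> a \<cdot>\<^sub>m \<psi> a g"
begin

abbreviation vac_value :: "'r \<Rightarrow> complex" where
  "vac_value e \<equiv> u e \<bullet> v e"

lemma vac_value_nonzero: "e \<in> vacE nd b \<Longrightarrow> vac_value e \<noteq> 0"
  using sph by (simp add: spherical_element_def)

lemma w_nonzero: "w a \<noteq> 0"
  using wd by (auto simp: wdata_def)

lemma d_squared: "(d a)\<^sup>2 = w a * w (cb a)"
  using dd by (simp add: ddata_def)

lemma d_nonzero: "d a \<noteq> 0"
  using d_squared[of a] w_nonzero[of a] w_nonzero[of "cb a"] by auto

lemma mtrace_wdata: "mtrace (transpose_mat (Z c) * minv (Z (cb c))) = w c * vac_value (r c)"
proof -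
  let ?M = "nd (cb c) * nd c" and ?V = "V (cb c) c (r c) 0" and ?W = "W (cb c) c (r c) 0"
  define uW where "uW = transpose_mat ?W *\<^sub>v u (r c)"
  define Vv where "Vv = ?V *\<^sub>v v (r c)"
  note carrier = V_carrier[OF N_cb_nonzero[of c]] W_carrier[OF N_cb_nonzero[of c]]
    u_carrier[OF r_vac[of c]] v_carrier[OF r_vac[of c]]
  have Vv: "Vv \<in> carrier_vec ?M" unfolding Vv_def by (rule mult_mat_vec_carrier[OF carrier(1,4)])
  have entry: "Z c $$ (t mod nd c, t div nd c) * minv (Z (cb c)) $$ (t mod nd c, t div nd c) =
      w c * (uW $ t * Vv $ t)"
    if "t < ?M" for t
    using wd that unfolding wdata_def Let_def uW_def Vv_def mult.assoc by blast
  have "mtrace (transpose_mat (Z c) * minv (Z (cb c))) =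
      (\<Sum>p<nd c. \<Sum>q<nd c. Z c $$ (q, p) * minv (Z (cb c)) $$ (q, p))"
    by (rule mtrace_transpose_mult[OF Z_carrier minv_Z_cb_carrier])
  also have "\<dots> = (\<Sum>t<?M. Z c $$ (t mod nd c, t div nd c) * minv (Z (cb c)) $$ (t mod nd c, t div nd c))"
    unfolding sum_lessThan_mult nd_cb by (intro sum.cong refl) simp
  also have "\<dots> = w c * (uW \<bullet> Vv)"
    using Vv by (simp add: entry scalar_prod_def sum_distrib_left atLeast0LessThan)
  also have "uW \<bullet> Vv = u (r c) \<bullet> (?W *\<^sub>v Vv)"
    unfolding uW_def by (rule transpose_vec_mult_scalar[OF carrier(2) Vv carrier(3)])
  also have "?W *\<^sub>v Vv = v (r c)"
    unfolding Vv_def assoc_mult_mat_vec[OF carrier(2,1,4), symmetric] W_V[OF N_cb_nonzero]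
    by (rule one_mult_mat_vec[OF carrier(4)])
  finally show ?thesis .
qed

lemma mtrace_conjugator: "mtrace (conjugator a) = w (cb a) * vac_value (l a)"
  using mtrace_wdata[of "cb a"] mtrace_transpose[OF conjugator_carrier, of a]
  by (simp add: conjugator_transpose bar_bar r_bar)

lemma mtrace_conjugator_inverse: "mtrace (conjugator_inverse a) = w a * vac_value (r a)"
  using mtrace_wdata[of a] unfolding conjugator_inverse_def
  by (subst mtrace_mult_commute[OF minv_Z_cb_carrier]) (use Z_carrier[of a] in auto)

lemma psi_k: "\<psi> a k = (\<xi> a * d a / w (cb a)) \<cdot>\<^sub>m conjugator a"
  using xi[of a] gd by (auto simp: gdata_def conjugator_def)

lemma tr_k_dim: "tr a k = \<xi> a * d a * vac_value (l a)"
  using w_nonzero[of "cb a"]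
  by (simp add: tr_eq_mtrace psi_k mtrace_smult[OF conjugator_carrier] mtrace_conjugator)

lemma psi_dinv: "(\<xi> a * d a / w (cb a)) \<cdot>\<^sub>m \<psi> a (dinv H k) = conjugator_inverse a"
proof -
  let ?Q = "\<psi> a (dinv H k)" and ?s = "\<xi> a * d a / w (cb a)"
  note carrier = psi.rep_carrier conjugator_carrier conjugator_inverse_carrier
  have "conjugator_inverse a = ?Q * \<psi> a k * conjugator_inverse a"
    by (simp add: left_mult_one_mat[OF carrier(3)] dmul_dinv psi.rep_one flip: psi.rep_mult)
  also have "\<dots> = ?s \<cdot>\<^sub>m (?Q * conjugator a * conjugator_inverse a)"
    unfolding psi_k mult_smult_distrib[OF carrier(1,2)]
    by (rule mult_smult_assoc_mat[OF mult_carrier_mat[OF carrier(1,2)] carrier(3)])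
  also have "?Q * conjugator a * conjugator_inverse a = ?Q"
    unfolding assoc_mult_mat[OF carrier] conjugator_mult_inverse
    by (rule right_mult_one_mat[OF carrier(1)])
  finally show ?thesis ..
qed

lemma tr_dinv: "\<xi> a * d a * tr a (dinv H k) = (d a)\<^sup>2 * vac_value (r a)"
proof -
  have "\<xi> a * d a / w (cb a) * tr a (dinv H k) = w a * vac_value (r a)"
    by (simp add: tr_eq_mtrace psi_dinv mtrace_conjugator_inverse
        flip: mtrace_smult[OF psi.rep_carrier])
  then show ?thesis using w_nonzero[of "cb a"] by (simp add: d_squared field_simps)
qed

lemma xi_nonzero: "\<xi> a \<noteq> 0"
  using tr_dinv[of a] d_nonzero[of a] vac_value_nonzero[OF r_vac[of a]] by auto

sublocale spherical_weak_hopf "dmul H" "ep H" "dcop H" "\<lambda>f. ev f (un H)" "dant H" nd coeff matrix_unit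
  N "vacE nd b" "\<lambda>e i. u e $ i" "\<lambda>e i. v e $ i" l r k "dinv H k" cb
proof unfold_locales
  show "ev (block_unit e) (un H) \<noteq> 0" if "e \<in> vacE nd b" for e
    using that by (simp add: counit_block_unit_vectors vac_value_nonzero)
  show "tr a k / ev (block_unit (l a)) (un H) = tr a (dinv H k) / ev (block_unit (r a)) (un H)" for a
    using sph by (simp add: spherical_element_def counit_block_unit_vectors l_vac r_vac tr_eq_mtrace)
  show "tr a k \<noteq> 0" for a
    by (simp add: tr_k_dim xi_nonzero d_nonzero vac_value_nonzero l_vac)
qed

lemma qdim_eq_mult: "qdim a = \<xi> a * d a"
  by (simp add: qdim_def counit_block_unit_vectors l_vac tr_k_dim vac_value_nonzero)

lemma qdim_eq_divide: "qdim a = d a / \<xi> a"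
proof -
  have "\<xi> a * d a * (qdim a * vac_value (r a)) = (d a)\<^sup>2 * vac_value (r a)"
    using tr_dinv[of a] tr_ki[of a] by (simp add: counit_block_unit_vectors r_vac)
  then show ?thesis
    using xi_nonzero[of a] d_nonzero[of a] vac_value_nonzero[OF r_vac[of a]]
    by (simp add: field_simps power2_eq_square)
qed

lemma qdim_squared: "(qdim a)\<^sup>2 = (d a)\<^sup>2"
proof -
  have "(qdim a)\<^sup>2 = \<xi> a * d a * (d a / \<xi> a)"
    by (simp only: power2_eq_square flip: qdim_eq_mult qdim_eq_divide)
  then show ?thesis using xi_nonzero[of a] by (simp add: power2_eq_square)
qed

lemma ev_Omega_el: "ev f (Omega_el \<psi> l d \<xi>) = \<omega> f"
proof -
  have "Omega_el \<psi> l d \<xi> = (\<lambda>i. \<omega> (bas i))"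
    unfolding Omega_el_def \<omega>_def sector_dim_eq qdim_squared
    unfolding qdim_eq_divide tr_eq_mtrace by (simp add: mult.commute)
  then show ?thesis
    using lin_form_ev[OF lin_form_omega[OF lin_map_id], of f] by simp
qed

sublocale dual_trace_idempotent "mul H" "un H" "cop H" "cou H" "ant H" "Omega_el \<psi> l d \<xi>" k "dinv H k"
proof (unfold_locales, unfold dual_structure ev_Omega_el)
  fix f g
  show "\<omega> (dmul H f g) = \<omega> (dmul H g f)" by (rule omega_commute)
  show "dual.sw f (\<lambda>p q. \<omega> p * \<omega> q) = \<omega> f" by (rule omega_multiplicative)
  show "dual.sw g (\<lambda>p q. G p * \<omega> (dmul H f q)) =
      dual.sw f (\<lambda>p q. G (dmul H (dant H p) k) * \<omega> (dmul H q g))"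
    if "lin_form G" for G
    by (rule omega_shift[OF that])
  show "\<omega> (dant H f) = \<omega> f" by (rule omega_S)
  show "f = (\<lambda>_. 0)" if "\<And>g. \<omega> (dmul H f g) = 0" by (rule omega_faithful[OF that])
  show "dmul H k (dinv H k) = ep H" by (rule dmul_dinv)
qed

lemma nondegenerate_Omega_el: "nondegenerate H (Omega_el \<psi> l d \<xi>)"
  using \<Omega>_nondegenerate unfolding nondegenerate_def sweedler_coord_left sweedler_coord_right
  by (simp add: mult.commute)

lemma cocommutative_Omega_el: "cocommutative H (Omega_el \<psi> l d \<xi>)"
  by (auto simp: cocommutative_def \<Omega>_cocommutative)

lemma mul2_Omega_el:
  "mul2 H (tn (un H) x) (cop H (Omega_el \<psi> l d \<xi>)) =
      mul2 H (tn (twist x) (un H)) (cop H (Omega_el \<psi> l d \<xi>))"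
  by (auto simp: mul2_tn mul_un \<Omega>_shift)

lemma cop_twist:
  "cop H (twist x) = (\<lambda>(p, q). \<Sum>i\<in>UNIV. \<Sum>j\<in>UNIV. \<Sum>h\<in>UNIV.
    cop2 H x (i, j, h) * dinv H k j * twist (bas h) p * twist (bas i) q)"
  by (auto simp: \<Delta>_twist sweedler_cop2 mult.assoc)

lemma twist_Omega_el:
  "(\<lambda>q. \<Sum>i\<in>UNIV. \<Sum>j\<in>UNIV. cop H (Omega_el \<psi> l d \<xi>) (i, j) * twist (bas i) q * dinv H k j) =
    ant H (Omega_el \<psi> l d \<xi>)"
  unfolding fun_eq_iff twist_\<Omega>[symmetric] by (simp add: sweedler_def mult.assoc)

end

theorem theorem5p15:
  fixes H :: "('i::finite) wha"
    and nd :: "('r::finite) \<Rightarrow> nat"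
    and \<psi> :: "'r \<Rightarrow> ('i \<Rightarrow> complex) \<Rightarrow> complex mat"
    and N :: "'r \<Rightarrow> 'r \<Rightarrow> 'r \<Rightarrow> nat"
    and V W :: "'r \<Rightarrow> 'r \<Rightarrow> 'r \<Rightarrow> nat \<Rightarrow> complex mat"
    and b :: "'r \<Rightarrow> complex mat"
    and u v :: "'r \<Rightarrow> complex vec"
    and l r cb :: "'r \<Rightarrow> 'r"
    and Z :: "'r \<Rightarrow> complex mat"
    and w d \<xi> :: "'r \<Rightarrow> complex"
    and g k :: "'i \<Rightarrow> complex"
  assumes wha: "weak_hopf_algebra H"
    and ss: "dual_semisimple H"
    and irr: "irreps H nd \<psi>"
    and fus: "fusion H nd \<psi> N V W"
    and vac: "vacuum H nd \<psi> b"
    and uv: "vac_vectors nd b u v"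
    and lr: "left_right nd b N l r"
    and conj: "conjugation H nd \<psi> cb Z"
    and wd: "wdata nd cb Z r V W u v w"
    and dd: "ddata cb w d"
    and gd: "gdata \<psi> cb Z w d g"
    and sph: "spherical_element H nd \<psi> b u v l r k"
    and xi: "\<forall>a. \<psi> a k = \<xi> a \<cdot>\<^sub>m \<psi> a g"
  shows "nondegenerate H (Omega_el \<psi> l d \<xi>) \<and> cocommutative H (Omega_el \<psi> l d \<xi>) \<and>
    mul H (Omega_el \<psi> l d \<xi>) (Omega_el \<psi> l d \<xi>) = Omega_el \<psi> l d \<xi> \<and>
    (\<exists>T. clinear T \<and>
       (\<forall>x. mul2 H (tn (un H) x) (cop H (Omega_el \<psi> l d \<xi>)) =
            mul2 H (tn (T x) (un H)) (cop H (Omega_el \<psi> l d \<xi>))) \<and>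
       (\<forall>x. cop H (T x) =
            (\<lambda>(p, q). \<Sum>i\<in>UNIV. \<Sum>j\<in>UNIV. \<Sum>h\<in>UNIV.
               cop2 H x (i, j, h) * dinv H k j * T (bas h) p * T (bas i) q)) \<and>
       (\<lambda>q. \<Sum>i\<in>UNIV. \<Sum>j\<in>UNIV. cop H (Omega_el \<psi> l d \<xi>) (i, j) * T (bas i) q * dinv H k j)
          = ant H (Omega_el \<psi> l d \<xi>) \<and>
       ant H (Omega_el \<psi> l d \<xi>) = Omega_el \<psi> l d \<xi>)"
proof -
  interpret dual_spherical H nd \<psi> N V W b u v l r cb Z k w d \<xi> g
    using assms by unfold_locales (auto simp: spherical_element_def)
  show ?thesis
    using nondegenerate_Omega_el cocommutative_Omega_el \<Omega>_idempotent mul2_Omega_el cop_twist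
      twist_Omega_el S_\<Omega> lin_map_clinear[OF lin_map_twist] by blast
qed

end
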